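(* Let $d\ge2$ be an integer and $s\in(d-1,d)$. There exist positive constants $C_{16}$ and $\beta$, depending only on $s$ and $d$, such that for every finite nonnegative Borel measure $\mu$ on $\mathbf{R}^d$ with $\|R(\mu)\|_{L^\infty}\le1$, every $\delta\in(0,1)$, every $q\in\mathbf{N}=\{1,2,3,\dots\}$ and every ball $B_0=B(x_0,r_0)\subset\mathbf{R}^d$, $$\mu\bigl(E^q_\delta(B_0)\bigr)\le\frac1q\exp\Bigl(\frac{C_{16}}{\delta^{\beta}}\Bigr)\mu(B_0).$$
   Context: $B(x,r)$ is the open ball of radius $r$ centred at $x$; $\frac12B_0=B(x_0,r_0/2)$. The $s$-dimensional Riesz transform of a finite nonnegative Borel measure $\mu$ is $R(\mu)(x)=\int_{\mathbf{R}^d}\frac{y-x}{|y-x|^{1+s}}\,d\mu(y)$ (convergent for Lebesgue-a.e. $x$), and $\|\cdot\|_{L^\infty}$ is the essential supremum norm with respect to Lebesgue measure. The set $E^q_\delta(B_0)$ (depending on $\mu$) is $$E^q_\delta(B_0)=\Bigl\{x\in\tfrac12B_0:\ \frac{\mu(B(x,r))}{r^s}>\delta\ \text{ for all } r\in\Bigl[\frac{r_0}{2^q},\frac{r_0}{4}\Bigr]\Bigr\}.$$ *)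

theory Defs
  imports "HOL-Probability.Essential_Supremum"
begin

text \<open>
  The library's division by zero makes the kernel vanish at \<open>y = x\<close>. The Bochner integral is \<open>0\<close>
  at points \<open>x\<close> where the kernel is not \<open>\<mu>\<close>-integrable; for finite \<open>\<mu>\<close> and \<open>0 < s < d\<close> both
  conventions only concern a Lebesgue-null set of \<open>x\<close>.
\<close>
definition riesz_transform :: "real \<Rightarrow> (real ^ 'n) measure \<Rightarrow> real ^ 'n \<Rightarrow> real ^ 'n"
  where "riesz_transform s \<mu> x = (\<integral>y. (1 / norm (y - x) powr (1 + s)) *\<^sub>R (y - x) \<partial>\<mu>)"

text \<open>\<^const>\<open>esssup\<close> is \<open>\<infinity>\<close> on non-measurable functions. The Riesz transform of a finite Borel measure is
  Borel measurable, so this case does not arise.\<close>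
definition Linfty_norm :: "(real ^ 'n \<Rightarrow> real ^ 'n) \<Rightarrow> ereal"
  where "Linfty_norm f = esssup lborel (\<lambda>x. ereal (norm (f x)))"

text \<open>The ball is given by its centre \<open>x0\<close> and radius \<open>r0\<close>. For \<open>q = 1\<close> the range of radii is empty.
  The set is open: a limit of points outside it, with witness radii in the compact interval, stays
  outside because \<open>(x, r) \<mapsto> measure \<mu> (ball x r)\<close> is lower semicontinuous. So \<^const>\<open>measure\<close> does
  not take its default value \<open>0\<close> on it.\<close>
definition dense_set ::
    "real \<Rightarrow> (real ^ 'n) measure \<Rightarrow> nat \<Rightarrow> real \<Rightarrow> real ^ 'n \<Rightarrow> real \<Rightarrow> (real ^ 'n) set"
  where "dense_set s \<mu> q \<delta> x0 r0 =
    {x \<in> ball x0 (r0 / 2). \<forall>r \<in> {r0 / 2 ^ q .. r0 / 4}. measure \<mu> (ball x r) / r powr s > \<delta>}"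

end

theory Submission
  imports Defs
begin

text \<open>
  Averaging the Riesz transform against \<open>(|w|\<^sup>2 + z\<^sup>2)\<^sup>-\<^sup>p\<close> with \<open>2 p = 2 d + 1 - s\<close>, the Poisson kernel of
  \<open>(-\<Delta>)\<^sup>\<alpha>\<^sup>/\<^sup>2\<close> for \<open>\<alpha> = d + 1 - s\<close>, turns the kernel \<open>v / |v|\<^sup>1\<^sup>+\<^sup>s\<close> into a multiple of
  \<open>v / (|v|\<^sup>2 + z\<^sup>2)\<^bsup>(1+s)/2\<^esup>\<close>, so these regularised fields are bounded. Testing with the radial field
  \<open>- w (|w|\<^sup>2 + z\<^sup>2)\<^sup>-\<^sup>p\<close> instead produces a positive kernel and hence the growth bound \<open>\<mu>(B(x,r)) \<le> G r\<^sup>s\<close>.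

  Since \<open>s < d\<close>, the set \<open>E\<close> of dense points is porous: near each of its points at scale \<open>\<rho>\<close> there is a ball
  missing \<open>E\<close> and touching its closure at some \<open>x\<close>. If this ball carried almost no mass, \<open>\<mu>\<close> would live near
  \<open>x\<close> essentially in a half-space. As \<open>s > d - 1\<close>, it cannot concentrate near the bounding hyperplane, so
  every dense scale at \<open>x\<close> adds a fixed amount \<open>\<delta>\<^sup>\<beta>\<close> to the normal component of the field, which is
  impossible for more than \<open>\<delta>\<^sup>-\<^sup>\<beta>\<close> scales. Hence the holes carry a share \<open>exp (- C / \<delta>\<^sup>\<beta>)\<close> of the mass, the
  \<open>\<rho>\<close>-neighbourhoods of \<open>E\<close> lose that share whenever \<open>\<rho>\<close> shrinks by the factor \<open>exp (- C / \<delta>\<^sup>\<beta>)\<close>, and about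
  \<open>q \<delta>\<^sup>\<beta>\<close> such steps fit between the scales \<open>r0\<close> and \<open>r0 / 2\<^sup>q\<close>.
\<close>

subsection \<open>Integrals of powers\<close>

text \<open>The hypothesis is an almost-everywhere bound, while the contradiction takes place at one
  chosen point of the closure of the dense set; averaging against an explicit weight transfers the
  bound to every point and every height \<open>z\<close>. For the exponent \<open>D + 1\<close> that
  Feynman's formula produces, the zeroth and second moments of the profile agree, so both averages
  have closed forms with one positive constant that is never evaluated.

  The hole must avoid a whole neighbourhood of the dense set, so the touching ball is shrunk by some
  \<open>t\<close>. The half-space picture then has two errors at scale \<open>z\<close>: the
  curvature of the ball, of order \<open>z / R\<close>, and the shrinking, of order
  \<open>t / z\<close>. Over dyadic scales these are geometric series running in opposite
  directions, so their total stays bounded, while the gain is \<open>N\<close> times a multiple of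
  \<open>h * \<delta>\<close>.

  The slab estimate forces \<open>h powr (s + 1 - d)\<close> to be of order \<open>\<delta>\<close>,
  so \<open>N\<close> is of order \<open>\<delta> powr (- \<beta>)\<close> with
  \<open>\<beta> = 1 + 1 / (s + 1 - d)\<close>. The factor \<open>2 ^ N\<close> is what makes the
  final constant exponential.\<close>

lemma integrable_nonneg_dominated:
  fixes f g :: "'a \<Rightarrow> real"
  assumes "f \<in> borel_measurable M" "integrable M g" "\<And>x. 0 \<le> f x" "\<And>x. f x \<le> g x"
  shows "integrable M f"
  by (rule Bochner_Integration.integrable_bound[OF assms(2,1)])
    (use assms(3,4) in \<open>auto intro!: AE_I2 order_trans[OF assms(4)] abs_ge_self\<close>)

lemma integrable_powr_near_0:
  fixes a :: real
  assumes "-1 < a"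
  shows "integrable lborel (\<lambda>x. indicator {0..1} x * x powr a)"
proof (rule integrableI_nonneg)
  have "(\<integral>\<^sup>+ x. ennreal (indicator {0..1} x * x powr a) \<partial>lborel) = ennreal (1 powr (a + 1) / (a + 1))"
    by (rule nn_integral_has_integral_lebesgue) (use has_integral_powr_from_0[OF assms, of 1] in auto)
  then show "(\<integral>\<^sup>+ x. ennreal (indicator {0..1} x * x powr a) \<partial>lborel) < \<infinity>" by simp
qed auto

lemma integrable_powr_near_infinity:
  fixes a :: real
  assumes "a < -1"
  shows "integrable lborel (\<lambda>x. indicator {1..} x * x powr a)"
proof (rule integrableI_nonneg)
  have "(\<integral>\<^sup>+ x. ennreal (indicator {1..} x * x powr a) \<partial>lborel) = ennreal (- (1 powr (a + 1)) / (a + 1))"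
    by (rule nn_integral_has_integral_lebesgue) (use has_integral_powr_to_inf[OF assms, of 1] in auto)
  then show "(\<integral>\<^sup>+ x. ennreal (indicator {1..} x * x powr a) \<partial>lborel) < \<infinity>" by simp
qed auto

text \<open>Euler's Beta function \<open>B(c, e - c)\<close> as an integral over the half-line. Only
  its positivity enters the final constants.\<close>

definition beta_integral :: "real \<Rightarrow> real \<Rightarrow> real" where
  "beta_integral c e = (\<integral>x. indicator {0<..} x * (x powr (c - 1) * (1 + x) powr (- e)) \<partial>lborel)"

lemma beta_integrable:
  fixes c e :: real
  assumes "0 < c" "c < e"
  shows "integrable lborel (\<lambda>x. indicator {0<..} x * (x powr (c - 1) * (1 + x) powr (- e)))"
proof (rule integrable_nonneg_dominated)
  show "integrable lborel (\<lambda>x. indicator {0..1} x * x powr (c - 1) + indicator {1..} x * x powr (c - 1 - e))"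
    using assms by (intro Bochner_Integration.integrable_add integrable_powr_near_0 integrable_powr_near_infinity) auto
  fix x :: real
  show "indicator {0<..} x * (x powr (c - 1) * (1 + x) powr (- e))
      \<le> indicator {0..1} x * x powr (c - 1) + indicator {1..} x * x powr (c - 1 - e)"
  proof (cases "0 < x")
    case True
    show ?thesis
    proof (cases "x \<le> 1")
      case x1: True
      have "(1 + x) powr (- e) \<le> 1"
        using powr_mono2'[of "-e" 1 "1+x"] assms True by auto
      then have "x powr (c - 1) * (1 + x) powr (- e) \<le> x powr (c - 1)"
        by (simp add: mult_left_le)
      then show ?thesis using True x1 by (auto simp: indicator_def intro: add_increasing2)
    next
      case False
      have "(1 + x) powr (- e) \<le> x powr (- e)"
        using powr_mono2'[of "-e" x "1+x"] assms True by auto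
      then have "x powr (c - 1) * (1 + x) powr (- e) \<le> x powr (c - 1) * x powr (- e)"
        by (intro mult_left_mono) auto
      also have "\<dots> = x powr (c - 1 - e)" by (simp add: powr_add[symmetric])
      finally show ?thesis using True False by (auto simp: indicator_def)
    qed
  qed (auto simp: indicator_def)
qed auto

lemma beta_integral_pos:
  fixes c e :: real
  assumes "0 < c" "c < e"
  shows "0 < beta_integral c e"
proof -
  let ?f = "\<lambda>x::real. indicator {0<..} x * (x powr (c - 1) * (1 + x) powr (- e))"
  have nn: "AE x in lborel. 0 \<le> ?f x" by (auto simp: indicator_def)
  have "beta_integral c e \<noteq> 0"
  proof
    assume "beta_integral c e = 0"
    then have "AE x in lborel. ?f x = 0"
      using integral_nonneg_eq_0_iff_AE[OF beta_integrable[OF assms] nn] by (simp add: beta_integral_def)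
    then have "AE x in lborel. x \<notin> {0<..<(1::real)}"
      by eventually_elim (auto simp: indicator_def)
    then have "emeasure lborel {0<..<(1::real)} = 0"
      by (subst (asm) AE_iff_measurable[where N="{0<..<1}"]) auto
    then show False by simp
  qed
  moreover have "0 \<le> beta_integral c e" unfolding beta_integral_def
    by (intro integral_nonneg_AE nn)
  ultimately show ?thesis by simp
qed

text \<open>Feynman's parametrisation of \<open>a powr (- c) * b powr (c - e)\<close>: substituting
  \<open>(b / a) * x\<close> for \<open>x\<close> reduces it to \<open>beta_integral\<close>. Below
  it is read in both directions, first with \<open>e = D + 1\<close> and then with
  \<open>e = D / 2 + 1\<close>.\<close>

lemma has_bochner_integral_beta_scaled:
  fixes a b c e :: real
  assumes "0 < c" "c < e" "0 < a" "0 < b"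
  shows "has_bochner_integral lborel
    (\<lambda>x. indicator {0<..} x * (x powr (c - 1) * (x * a + b) powr (- e)))
    (beta_integral c e * (a powr (- c) * b powr (c - e)))"
proof -
  let ?k = "b / a"
  have k: "?k > 0" using assms by simp
  have eq: "indicator {0<..} (0 + ?k * x) * ((0 + ?k * x) powr (c - 1) * ((0 + ?k * x) * a + b) powr (- e))
     = (?k powr (c - 1) * b powr (- e)) * (indicator {0<..} x * (x powr (c - 1) * (1 + x) powr (- e)))" for x :: real
  proof (cases "x > 0")
    case True
    have "?k * x * a + b = b * (1 + x)" using assms by (simp add: field_simps)
    moreover have "?k * x > 0" using True k by (rule mult_pos_pos[rotated])
    moreover have "(?k * x) powr (c - 1) = ?k powr (c - 1) * x powr (c - 1)"
      using True k by (intro powr_mult)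
    moreover have "(b * (1 + x)) powr (- e) = b powr (- e) * (1 + x) powr (- e)"
      using True assms by (intro powr_mult)
    ultimately show ?thesis using True by simp
  next
    case False
    then have "\<not> ?k * x > 0" using k by (metis mult_pos_neg not_less_iff_gr_or_eq mult_zero_right)
    then show ?thesis using False by simp
  qed
  have "has_bochner_integral lborel (\<lambda>x. indicator {0<..} x * (x powr (c - 1) * (1 + x) powr (- e))) (beta_integral c e)"
    using beta_integrable[OF assms(1,2)] by (simp add: has_bochner_integral_iff beta_integral_def)
  then have "has_bochner_integral lborel (\<lambda>x. (?k powr (c - 1) * b powr (- e)) * (indicator {0<..} x * (x powr (c - 1) * (1 + x) powr (- e))))
     ((?k powr (c - 1) * b powr (- e)) * beta_integral c e)"
    by (rule has_bochner_integral_mult_right)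
  moreover have "(beta_integral c e * (a powr (- c) * b powr (c - e))) /\<^sub>R \<bar>?k\<bar> = (?k powr (c - 1) * b powr (- e)) * beta_integral c e"
    using assms by (simp add: powr_divide powr_diff powr_minus field_simps)
  ultimately show ?thesis
    by (subst lborel_has_bochner_integral_real_affine_iff[where c="?k" and t=0])
      (use k in \<open>auto simp: eq[simplified] simp del: scaleR_conv_of_real\<close>)
qed

section \<open>Affine substitution and integrability of radial powers in several variables\<close>

lemma has_bochner_integral_lborel_affine:
  fixes f :: "'a::euclidean_space \<Rightarrow> 'b::{banach, second_countable_topology}"
  assumes "has_bochner_integral lborel f I" "k \<noteq> 0"
  shows "has_bochner_integral lborel (\<lambda>x. f (t + k *\<^sub>R x)) (I /\<^sub>R \<bar>k\<bar> ^ DIM('a))"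
proof -
  have [measurable]: "f \<in> borel_measurable borel" using assms(1) by (auto simp: has_bochner_integral_iff)
  have i: "integrable (density (distr lborel borel (\<lambda>x. t + k *\<^sub>R x)) (\<lambda>_. ennreal (\<bar>k\<bar>^DIM('a)))) f"
    "integral\<^sup>L (density (distr lborel borel (\<lambda>x. t + k *\<^sub>R x)) (\<lambda>_. ennreal (\<bar>k\<bar>^DIM('a)))) f = I"
    using assms(1) lborel_affine[OF assms(2), of t] by (auto simp: has_bochner_integral_iff)
  have "integrable lborel (\<lambda>x. (\<bar>k\<bar>^DIM('a)) *\<^sub>R f (t + k *\<^sub>R x))"
    using i(1) by (simp add: integrable_density integrable_distr_eq)
  then have int: "integrable lborel (\<lambda>x. f (t + k *\<^sub>R x))"
    using integrable_scaleR_right[of "inverse (\<bar>k\<bar>^DIM('a))" lborel "\<lambda>x. (\<bar>k\<bar>^DIM('a)) *\<^sub>R f (t + k *\<^sub>R x)"] assms(2)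
    by simp
  have "I = (\<integral>x. (\<bar>k\<bar>^DIM('a)) *\<^sub>R f (t + k *\<^sub>R x) \<partial>lborel)"
    using i(2) by (simp add: integral_density integral_distr)
  also have "\<dots> = (\<bar>k\<bar>^DIM('a)) *\<^sub>R (\<integral>x. f (t + k *\<^sub>R x) \<partial>lborel)"
    using int by (simp add: integral_scaleR_right)
  finally have "I = (\<bar>k\<bar>^DIM('a)) *\<^sub>R (\<integral>x. f (t + k *\<^sub>R x) \<partial>lborel)" .
  then show ?thesis using int assms(2) by (simp add: has_bochner_integral_iff)
qed

lemma integrable_lborel_prod:
  fixes f :: "real \<Rightarrow> real"
  assumes "integrable lborel f" "\<And>t. 0 \<le> f t"
  shows "integrable lborel (\<lambda>x::'a::euclidean_space. \<Prod>b\<in>Basis. f (x \<bullet> b))"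
proof (rule integrableI_nonneg)
  have [measurable]: "f \<in> borel_measurable borel" using assms(1) by auto
  show "(\<lambda>x::'a. \<Prod>b\<in>Basis. f (x \<bullet> b)) \<in> borel_measurable lborel" by measurable
  show "AE x::'a in lborel. 0 \<le> (\<Prod>b\<in>Basis. f (x \<bullet> b))" using assms(2) by (auto intro: prod_nonneg)
  have "(\<integral>\<^sup>+ (x::'a). ennreal (\<Prod>b\<in>Basis. f (x \<bullet> b)) \<partial>lborel) = (\<integral>\<^sup>+ (x::'a). (\<Prod>b\<in>Basis. ennreal (f (x \<bullet> b))) \<partial>lborel)"
    using assms(2) by (simp add: prod_ennreal)
  also have "\<dots> = (\<Prod>b\<in>(Basis::'a set). (\<integral>\<^sup>+x. ennreal (f x) \<partial>lborel))"
    by (rule nn_integral_lborel_prod) auto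
  also have "\<dots> < \<infinity>"
    using assms by (auto simp: nn_integral_eq_integral ennreal_power)
  finally show "(\<integral>\<^sup>+ (x::'a). ennreal (\<Prod>b\<in>Basis. f (x \<bullet> b)) \<partial>lborel) < \<infinity>" .
qed

text \<open>A coordinate is at most the norm, so with \<open>h = e / DIM('a)\<close> the integrand
  is at most a product of one-variable functions. Tonelli leaves one-dimensional integrals, finite
  because \<open>2 * h > 1\<close>.\<close>

lemma integrable_inverse_powr_norm:
  assumes "real DIM('a::euclidean_space) / 2 < e"
  shows "integrable lborel (\<lambda>x::'a. (1 + (norm x)\<^sup>2) powr (- e))"
proof -
  define h where "h = e / real DIM('a)"
  have h: "h > 1/2" unfolding h_def using assms by (simp add: field_simps)
  have he: "(1::real) * e = h * DIM('a)" unfolding h_def by simp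
  let ?f = "\<lambda>t::real. (1 + t\<^sup>2) powr (- h)"
  have half: "integrable lborel (\<lambda>t. indicator {0..} t * ?f t)"
  proof (rule integrable_nonneg_dominated)
    show "integrable lborel (\<lambda>t::real. indicator {0..1} t + indicator {1..} t * t powr (- (2 * h)))"
      using h by (intro Bochner_Integration.integrable_add integrable_powr_near_infinity) auto
    fix t :: real
    have 1: "?f t \<le> 1" using h powr_mono2'[of "-h" 1 "1+t\<^sup>2"] by auto
    have 2: "?f t \<le> t powr (- (2 * h))" if "t > 0"
    proof -
      have "?f t \<le> (t\<^sup>2) powr (- h)" using h that powr_mono2'[of "-h" "t\<^sup>2" "1+t\<^sup>2"] by auto
      also have "\<dots> = t powr (- (2 * h))" using that by (simp add: powr_powr flip: powr_numeral)
      finally show ?thesis .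
    qed
    show "indicator {0..} t * ?f t \<le> indicator {0..1} t + indicator {1..} t * t powr (- (2 * h))"
      using 1 2 by (cases "t = 0"; auto simp: indicator_def intro: add_increasing2)
  qed auto
  then have "integrable lborel (\<lambda>t. indicator {0..} (0 + (-1) * t) * ?f (0 + (-1) * t))"
    by (rule lborel_integrable_real_affine) auto
  with half have sum: "integrable lborel (\<lambda>t. indicator {0..} t * ?f t + indicator {0..} (- t) * ?f t)"
    by (intro Bochner_Integration.integrable_add) auto
  have f: "integrable lborel ?f"
    by (rule integrable_nonneg_dominated[OF _ sum]) (auto simp: indicator_def)
  show ?thesis
  proof (rule integrable_nonneg_dominated[OF _ integrable_lborel_prod[OF f]])
    fix x :: 'a
    have "(1 + (norm x)\<^sup>2) powr (- e) = ((1 + (norm x)\<^sup>2) powr (- h)) ^ DIM('a)"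
    proof -
      have "1 + (norm x)\<^sup>2 > 0" by (simp add: add_pos_nonneg)
      then show ?thesis using he by (simp add: powr_realpow[symmetric] powr_powr)
    qed
    also have "\<dots> = (\<Prod>b\<in>(Basis::'a set). (1 + (norm x)\<^sup>2) powr (- h))" by simp
    also have "\<dots> \<le> (\<Prod>b\<in>Basis. ?f (x \<bullet> b))"
    proof (rule prod_mono, safe)
      fix b :: 'a assume "b \<in> Basis"
      then have "\<bar>x \<bullet> b\<bar> \<le> norm x" by (rule Basis_le_norm)
      then have "(x \<bullet> b)\<^sup>2 \<le> (norm x)\<^sup>2" by (metis abs_norm_cancel power2_le_iff_abs_le norm_ge_zero)
      then show "(1 + (norm x)\<^sup>2) powr (- h) \<le> ?f (x \<bullet> b)"
        using h by (intro powr_mono2') (auto simp: add_pos_nonneg)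
    qed auto
    finally show "(1 + (norm x)\<^sup>2) powr (- e) \<le> (\<Prod>b\<in>Basis. ?f (x \<bullet> b))" .
  qed auto
qed

text \<open>The same comparison with a product, now with the one-variable singularity
  \<open>\<bar>t\<bar> powr (- h)\<close>, where \<open>h = s / DIM('a) < 1\<close>.\<close>

lemma integrable_norm_powr_unit_ball:
  assumes "0 \<le> s" "s < real DIM('a::euclidean_space)"
  shows "integrable lborel (\<lambda>x::'a. indicator (ball 0 1) x * norm x powr (- s))"
proof -
  define h where "h = s / real DIM('a)"
  have h: "0 \<le> h" "h < 1" unfolding h_def using assms by (auto simp: field_simps)
  have hs: "s = h * DIM('a)" unfolding h_def by simp
  let ?f = "\<lambda>t::real. indicator {-1..1} t * \<bar>t\<bar> powr (- h)"
  have half: "integrable lborel (\<lambda>t. indicator {0..1} t * t powr (- h))"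
    using h by (intro integrable_powr_near_0) auto
  then have "integrable lborel (\<lambda>t. indicator {0..1} (0 + (-1) * t) * (0 + (-1) * t) powr (- h))"
    by (rule lborel_integrable_real_affine) auto
  with half have sum: "integrable lborel (\<lambda>t. indicator {0..1} t * t powr (- h) + indicator {0..1} (- t) * (- t) powr (- h))"
    by (intro Bochner_Integration.integrable_add) auto
  have f: "integrable lborel ?f"
    by (rule integrable_nonneg_dominated[OF _ sum]) (auto simp: indicator_def abs_if)
  \<comment> \<open>Where a coordinate vanishes, \<open>0 powr (- h) = 0\<close> annihilates the
    product and the comparison fails, so the coordinate hyperplanes are discarded as a null
    set.\<close>
  have "\<exists>N. N \<in> null_sets (lborel :: 'a measure) \<and> {x. \<exists>b\<in>Basis. x \<bullet> b = 0} \<subseteq> N"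
  proof -
    have "(\<Union>b\<in>Basis. {x::'a. b \<bullet> x = 0}) \<in> null_sets lebesgue"
      by (intro null_sets_UN' countable_finite)
         (auto simp: negligible_hyperplane nonzero_Basis simp flip: negligible_iff_null_sets)
    then have "(\<Union>b\<in>Basis. {x::'a. b \<bullet> x = 0}) \<in> null_sets lborel"
      by (subst (asm) null_sets_completion_iff) (auto intro!: borel_closed closed_UN closed_hyperplane)
    then show ?thesis by (intro exI[of _ "(\<Union>b\<in>Basis. {x::'a. b \<bullet> x = 0})"]) (auto simp: inner_commute)
  qed
  then have ae: "AE x::'a in lborel. \<forall>b\<in>Basis. x \<bullet> b \<noteq> 0"
    by (auto simp: eventually_ae_filter)
  show ?thesis
  proof (rule Bochner_Integration.integrable_bound[OF integrable_lborel_prod[OF f, where 'a='a]])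
    show "AE x::'a in lborel. norm (indicator (ball 0 1) x * norm x powr (- s)) \<le> norm (\<Prod>b\<in>Basis. ?f (x \<bullet> b))"
      using ae
    proof eventually_elim
      fix x :: 'a
      assume nz: "\<forall>b\<in>Basis. x \<bullet> b \<noteq> 0"
      show "norm (indicator (ball 0 1) x * norm x powr (- s)) \<le> norm (\<Prod>b\<in>Basis. ?f (x \<bullet> b))"
      proof (cases "x \<in> ball 0 1")
        case True
        have "x \<noteq> 0" using nz nonempty_Basis by fastforce
        then have "norm x powr (- s) = (norm x powr (- h)) ^ DIM('a)"
          using hs by (simp add: powr_realpow[symmetric] powr_powr)
        also have "\<dots> = (\<Prod>b\<in>(Basis::'a set). norm x powr (- h))" by simp
        also have "\<dots> \<le> (\<Prod>b\<in>Basis. ?f (x \<bullet> b))"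
        proof (rule prod_mono, safe)
          fix b :: 'a assume b: "b \<in> Basis"
          have le: "\<bar>x \<bullet> b\<bar> \<le> norm x" using b by (rule Basis_le_norm)
          then have "norm x powr (- h) \<le> \<bar>x \<bullet> b\<bar> powr (- h)"
            using h nz b by (intro powr_mono2') auto
          moreover have "\<bar>x \<bullet> b\<bar> \<le> 1" using le True by auto
          ultimately show "norm x powr (- h) \<le> ?f (x \<bullet> b)" by (auto simp: indicator_def abs_le_iff)
        qed auto
        finally have "norm x powr (- s) \<le> (\<Prod>b\<in>Basis. ?f (x \<bullet> b))" .
        moreover have "norm (\<Prod>b\<in>Basis. ?f (x \<bullet> b)) = (\<Prod>b\<in>Basis. ?f (x \<bullet> b))"
          by (simp only: real_norm_def) (rule abs_of_nonneg, rule prod_nonneg, simp)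
        ultimately show ?thesis using True by (simp del: real_norm_def) simp
      qed auto
    qed
  qed (auto intro!: borel_measurable_times borel_measurable_indicator)
qed

subsection \<open>Poisson averages of the Riesz kernel\<close>

text \<open>The \<open>itself\<close> argument makes this a constant of the dimension alone. The
  exponent is the sum of \<open>c\<close>, from the squared distance in the Riesz kernel, and
  \<open>D + 1 - c\<close>, from the weight: it is the exponent of the quadratic form into which
  Feynman's formula merges them.\<close>

definition profile_mass :: "'a::euclidean_space itself \<Rightarrow> real" where
  "profile_mass _ = (\<integral>(g::'a). (1 + (norm g)\<^sup>2) powr (- (real DIM('a) + 1)) \<partial>lborel)"

lemma integrable_profile:
  "integrable lborel (\<lambda>g::'a::euclidean_space. (1 + (norm g)\<^sup>2) powr (- (real DIM('a) + 1)))"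
  by (rule integrable_inverse_powr_norm) simp

lemma profile_mass_pos: "0 < profile_mass TYPE('a::euclidean_space)"
proof -
  let ?f = "\<lambda>g::'a. (1 + (norm g)\<^sup>2) powr (- (real DIM('a) + 1))"
  have nz: "?f g \<noteq> 0" for g :: 'a
  proof -
    have "1 + (norm g)\<^sup>2 > 0" by (simp add: add_pos_nonneg)
    then show ?thesis by simp
  qed
  have nn: "AE g in lborel. 0 \<le> ?f g" by auto
  have "profile_mass TYPE('a) \<noteq> 0"
  proof
    assume "profile_mass TYPE('a) = 0"
    then have "AE g in (lborel::'a measure). ?f g = 0"
      using integral_nonneg_eq_0_iff_AE[OF integrable_profile nn] by (simp add: profile_mass_def)
    then have "AE g in (lborel::'a measure). False"
      by eventually_elim (use nz in auto)
    then have "emeasure (lborel::'a measure) UNIV = 0"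
      by (subst (asm) AE_iff_measurable[where N="UNIV"]) auto
    then show False by simp
  qed
  moreover have "0 \<le> profile_mass TYPE('a)" unfolding profile_mass_def
    by (intro integral_nonneg_AE nn)
  ultimately show ?thesis by simp
qed

lemma has_bochner_integral_profile_scaled:
  fixes k Q :: real
  assumes "0 < k" "0 < Q"
  shows "has_bochner_integral lborel (\<lambda>g::'a::euclidean_space. (k * (norm g)\<^sup>2 + Q) powr (- (real DIM('a) + 1)))
    (k powr (- real DIM('a) / 2) * Q powr (- (real DIM('a) / 2 + 1)) * profile_mass TYPE('a))"
proof -
  let ?D = "real DIM('a)"
  define r where "r = sqrt (k / Q)"
  have r: "r > 0" "r\<^sup>2 = k / Q" "r powr ?D = (k / Q) powr (?D / 2)"
  proof -
    show "r > 0" "r\<^sup>2 = k / Q" using assms by (auto simp: r_def)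
    have "r = (k / Q) powr (1 / 2)" using assms by (simp add: r_def powr_half_sqrt)
    then show "r powr ?D = (k / Q) powr (?D / 2)" by (simp add: powr_powr)
  qed
  have "has_bochner_integral lborel (\<lambda>g::'a. (1 + (norm g)\<^sup>2) powr (- (?D + 1))) (profile_mass TYPE('a))"
    using integrable_profile by (simp add: has_bochner_integral_iff profile_mass_def)
  from has_bochner_integral_lborel_affine[OF this, of r 0]
  have "has_bochner_integral lborel (\<lambda>g::'a. (1 + (norm (r *\<^sub>R g))\<^sup>2) powr (- (?D + 1)))
     (profile_mass TYPE('a) /\<^sub>R \<bar>r\<bar> ^ DIM('a))" using r by simp
  then have "has_bochner_integral lborel (\<lambda>g::'a. Q powr (- (?D + 1)) * (1 + (norm (r *\<^sub>R g))\<^sup>2) powr (- (?D + 1)))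
     (Q powr (- (?D + 1)) * (profile_mass TYPE('a) /\<^sub>R \<bar>r\<bar> ^ DIM('a)))"
    by (rule has_bochner_integral_mult_right)
  moreover have "Q powr (- (?D + 1)) * (1 + (norm (r *\<^sub>R g))\<^sup>2) powr (- (?D + 1)) = (k * (norm g)\<^sup>2 + Q) powr (- (?D + 1))" for g :: 'a
  proof -
    have "Q * (1 + (norm (r *\<^sub>R g))\<^sup>2) = k * (norm g)\<^sup>2 + Q"
      using assms r by (simp add: power_mult_distrib field_simps)
    then show ?thesis by (simp only: powr_mult[symmetric])
  qed
  moreover have "Q powr (- (?D + 1)) * (profile_mass TYPE('a) /\<^sub>R \<bar>r\<bar> ^ DIM('a))
    = k powr (- ?D / 2) * Q powr (- (?D / 2 + 1)) * profile_mass TYPE('a)"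
  proof -
    have "\<bar>r\<bar> ^ DIM('a) = (k / Q) powr (?D / 2)" using r(1,3) powr_realpow[of r "DIM('a)"] by simp
    moreover have "Q powr (- (?D + 1)) = Q powr (- (?D / 2)) * Q powr (- (?D / 2 + 1))"
      by (simp add: powr_add[symmetric])
    moreover have "k powr (- ?D / 2) = inverse (k powr (?D / 2))"
      by (simp flip: powr_minus)
    moreover have "inverse b * X * (Y /\<^sub>R (a / b)) = inverse a * X * Y" if "a > 0" "b > 0" for a b X Y :: real
      using that by (simp add: field_simps)
    ultimately show ?thesis using assms by (simp add: powr_divide powr_minus[of Q "?D / 2"])
  qed
  ultimately show ?thesis by (simp only:)
qed

text \<open>Integrating \<open>q \<mapsto> D (|g|\<^sup>2 + q)\<^sup>-\<^sup>D\<^sup>-\<^sup>1\<close> over \<open>{1..}\<close> first gives half of the left-hand side back.\<close>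
lemma integral_profile_lower_power:
  "(\<integral>(g::'a::euclidean_space). (1 + (norm g)\<^sup>2) powr (- real DIM('a)) \<partial>lborel) = 2 * profile_mass TYPE('a)"
proof -
  let ?D = "real DIM('a)"
  have D: "?D > 0" by simp
  have nn: "(\<integral>\<^sup>+(g::'a). ennreal ((1 + (norm g)\<^sup>2) powr (- ?D)) \<partial>lborel) = ennreal (2 * profile_mass TYPE('a))"
  proof -
    have "(\<integral>\<^sup>+(g::'a). ennreal ((1 + (norm g)\<^sup>2) powr (- ?D)) \<partial>lborel)
       = (\<integral>\<^sup>+(g::'a). (\<integral>\<^sup>+q. ennreal (?D * (1 * (norm g)\<^sup>2 + q) powr (- (?D + 1))) * indicator {1..} q \<partial>lborel) \<partial>lborel)"
    proof (rule nn_integral_cong)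
      fix g :: 'a
      have "(\<integral>\<^sup>+q. ennreal (?D * (1 * (norm g)\<^sup>2 + q) powr (- (?D + 1))) * indicator {1..} q \<partial>lborel)
         = 0 - (- (((norm g)\<^sup>2 + 1) powr (- ?D)))"
      proof (rule nn_integral_FTC_atLeast[where F="\<lambda>q. - (((norm g)\<^sup>2 + q) powr (- ?D))"])
        fix q :: real assume "1 \<le> q"
        then have "(norm g)\<^sup>2 + q > 0" by (simp add: add_nonneg_pos)
        then show "((\<lambda>q. - (((norm g)\<^sup>2 + q) powr (- ?D))) has_real_derivative ?D * (1 * (norm g)\<^sup>2 + q) powr (- (?D + 1))) (at q)"
        proof -
          have "((\<lambda>q. - (((norm g)\<^sup>2 + q) powr (- ?D))) has_real_derivative ?D * ((norm g)\<^sup>2 + q) powr (- ?D - 1)) (at q)"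
            using \<open>(norm g)\<^sup>2 + q > 0\<close> by (auto intro!: derivative_eq_intros)
          moreover have "- ?D - 1 = - (?D + 1)" by simp
          ultimately show ?thesis by (simp only: mult_1)
        qed
      next
        show "((\<lambda>q. - (((norm g)\<^sup>2 + q) powr (- ?D))) \<longlongrightarrow> 0) at_top"
        proof -
          have "filterlim (\<lambda>q. (norm g)\<^sup>2 + q) at_top at_top"
            by (intro filterlim_tendsto_add_at_top[OF tendsto_const] filterlim_ident)
          from tendsto_minus[OF tendsto_neg_powr[OF _ this, of "- ?D"]] show ?thesis by simp
        qed
      qed auto
      then show "ennreal ((1 + (norm g)\<^sup>2) powr (- ?D)) = (\<integral>\<^sup>+q. ennreal (?D * (1 * (norm g)\<^sup>2 + q) powr (- (?D + 1))) * indicator {1..} q \<partial>lborel)"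
        by (simp add: add.commute)
    qed
    also have "\<dots> = (\<integral>\<^sup>+q. (\<integral>\<^sup>+(g::'a). ennreal (?D * (1 * (norm g)\<^sup>2 + q) powr (- (?D + 1))) * indicator {1..} q \<partial>lborel) \<partial>lborel)"
      by (rule lborel_pair.Fubini') simp
    also have "\<dots> = (\<integral>\<^sup>+q. ennreal (indicator {1..} q * q powr (- (?D / 2 + 1))) * ennreal (?D * profile_mass TYPE('a)) \<partial>lborel)"
    proof (rule nn_integral_cong)
      fix q :: real
      show "(\<integral>\<^sup>+(g::'a). ennreal (?D * (1 * (norm g)\<^sup>2 + q) powr (- (?D + 1))) * indicator {1..} q \<partial>lborel)
        = ennreal (indicator {1..} q * q powr (- (?D / 2 + 1))) * ennreal (?D * profile_mass TYPE('a))"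
      proof (cases "1 \<le> q")
        case True
        have "(\<integral>\<^sup>+(g::'a). ennreal (?D * (1 * (norm g)\<^sup>2 + q) powr (- (?D + 1))) \<partial>lborel)
          = ennreal (?D * (1 powr (- ?D / 2) * q powr (- (?D / 2 + 1)) * profile_mass TYPE('a)))"
        proof -
          have "has_bochner_integral lborel (\<lambda>g::'a. ?D * (1 * (norm g)\<^sup>2 + q) powr (- (?D + 1)))
             (?D * (1 powr (- ?D / 2) * q powr (- (?D / 2 + 1)) * profile_mass TYPE('a)))"
            using True by (intro has_bochner_integral_mult_right has_bochner_integral_profile_scaled) auto
          note h = this[unfolded has_bochner_integral_iff]
          have "(\<integral>\<^sup>+(g::'a). ennreal (?D * (1 * (norm g)\<^sup>2 + q) powr (- (?D + 1))) \<partial>lborel)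
            = ennreal (\<integral>(g::'a). ?D * (1 * (norm g)\<^sup>2 + q) powr (- (?D + 1)) \<partial>lborel)"
            using h[THEN conjunct1] by (rule nn_integral_eq_integral) simp
          then show ?thesis by (simp only: h[THEN conjunct2])
        qed
        then show ?thesis using True profile_mass_pos[where 'a='a] by (simp add: ennreal_mult[symmetric] mult_ac)
      qed auto
    qed
    also have "\<dots> = (\<integral>\<^sup>+q. ennreal (indicator {1..} q * q powr (- (?D / 2 + 1))) \<partial>lborel) * ennreal (?D * profile_mass TYPE('a))"
      by (rule nn_integral_multc) simp
    also have "(\<integral>\<^sup>+q. ennreal (indicator {1..} q * q powr (- (?D / 2 + 1))) \<partial>lborel)
       = ennreal (- (1 powr (- (?D / 2 + 1) + 1)) / (- (?D / 2 + 1) + 1))"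
      by (rule nn_integral_has_integral_lebesgue) (use has_integral_powr_to_inf[of "- (?D / 2 + 1)" 1] in auto)
    also have "\<dots> * ennreal (?D * profile_mass TYPE('a)) = ennreal (2 * profile_mass TYPE('a))"
      using profile_mass_pos[where 'a='a] by (subst ennreal_mult[symmetric]) (auto simp: field_simps)
    finally show ?thesis .
  qed
  show ?thesis
    by (subst integral_eq_nn_integral) (simp_all add: nn profile_mass_pos less_imp_le)
qed

text \<open>Write \<open>(norm g)\<^sup>2\<close> as \<open>(1 + (norm g)\<^sup>2) - 1\<close> and
  subtract. That the second moment equals the zeroth one is special to the exponent
  \<open>D + 1\<close>.\<close>

lemma has_bochner_integral_profile_square:
  "has_bochner_integral lborel (\<lambda>g::'a::euclidean_space. (norm g)\<^sup>2 * (1 + (norm g)\<^sup>2) powr (- (real DIM('a) + 1)))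
    (profile_mass TYPE('a))"
proof -
  have "has_bochner_integral lborel (\<lambda>g::'a. (1 + (norm g)\<^sup>2) powr (- real DIM('a)) - (1 + (norm g)\<^sup>2) powr (- (real DIM('a) + 1)))
     (2 * profile_mass TYPE('a) - profile_mass TYPE('a))"
    using integrable_profile[where 'a='a] integrable_inverse_powr_norm[where 'a='a, of "real DIM('a)"]
    by (intro has_bochner_integral_diff)
      (simp_all add: has_bochner_integral_iff integral_profile_lower_power profile_mass_def)
  moreover have "(1 + (norm g)\<^sup>2) powr (- real DIM('a)) - (1 + (norm g)\<^sup>2) powr (- (real DIM('a) + 1))
     = (norm g)\<^sup>2 * (1 + (norm g)\<^sup>2) powr (- (real DIM('a) + 1))" for g :: 'a
  proof -
    have p: "1 + (norm g)\<^sup>2 > 0" by (simp add: add_pos_nonneg)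
    have "(1 + (norm g)\<^sup>2) powr (- real DIM('a)) = (1 + (norm g)\<^sup>2) powr 1 * (1 + (norm g)\<^sup>2) powr (- (real DIM('a) + 1))"
      by (simp only: powr_add[symmetric]) simp
    then show ?thesis using p by (simp add: algebra_simps)
  qed
  ultimately show ?thesis by simp
qed

lemma has_bochner_integral_profile_square_scaled:
  fixes k Q :: real
  assumes "0 < k" "0 < Q"
  shows "has_bochner_integral lborel (\<lambda>g::'a::euclidean_space. (norm g)\<^sup>2 * (k * (norm g)\<^sup>2 + Q) powr (- (real DIM('a) + 1)))
    (k powr (- (real DIM('a) / 2 + 1)) * Q powr (- real DIM('a) / 2) * profile_mass TYPE('a))"
proof -
  let ?D = "real DIM('a)"
  define r where "r = sqrt (k / Q)"
  have r: "r > 0" "r\<^sup>2 = k / Q" "r powr ?D = (k / Q) powr (?D / 2)"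
  proof -
    show "r > 0" "r\<^sup>2 = k / Q" using assms by (auto simp: r_def)
    have "r = (k / Q) powr (1 / 2)" using assms by (simp add: r_def powr_half_sqrt)
    then show "r powr ?D = (k / Q) powr (?D / 2)" by (simp add: powr_powr)
  qed
  from has_bochner_integral_lborel_affine[OF has_bochner_integral_profile_square[where 'a='a], of r 0]
  have "has_bochner_integral lborel (\<lambda>g::'a. (norm (r *\<^sub>R g))\<^sup>2 * (1 + (norm (r *\<^sub>R g))\<^sup>2) powr (- (?D + 1)))
     (profile_mass TYPE('a) /\<^sub>R \<bar>r\<bar> ^ DIM('a))" using r by simp
  then have "has_bochner_integral lborel (\<lambda>g::'a. (Q / k * Q powr (- (?D + 1))) * ((norm (r *\<^sub>R g))\<^sup>2 * (1 + (norm (r *\<^sub>R g))\<^sup>2) powr (- (?D + 1))))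
     ((Q / k * Q powr (- (?D + 1))) * (profile_mass TYPE('a) /\<^sub>R \<bar>r\<bar> ^ DIM('a)))"
    by (rule has_bochner_integral_mult_right)
  moreover have "(Q / k * Q powr (- (?D + 1))) * ((norm (r *\<^sub>R g))\<^sup>2 * (1 + (norm (r *\<^sub>R g))\<^sup>2) powr (- (?D + 1)))
     = (norm g)\<^sup>2 * (k * (norm g)\<^sup>2 + Q) powr (- (?D + 1))" for g :: 'a
  proof -
    have "Q * (1 + (norm (r *\<^sub>R g))\<^sup>2) = k * (norm g)\<^sup>2 + Q"
      using assms r by (simp add: power_mult_distrib field_simps)
    then have "(k * (norm g)\<^sup>2 + Q) powr (- (?D + 1)) = Q powr (- (?D + 1)) * (1 + (norm (r *\<^sub>R g))\<^sup>2) powr (- (?D + 1))"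
      by (simp only: powr_mult[symmetric])
    moreover have "Q / k * (norm (r *\<^sub>R g))\<^sup>2 = (norm g)\<^sup>2" using assms r by (simp add: power_mult_distrib)
    moreover have "(Q / k * b) * (a * c) = (Q / k * a) * (b * c)" for a b c by simp
    ultimately show ?thesis by (simp only:)
  qed
  moreover have "(Q / k * Q powr (- (?D + 1))) * (profile_mass TYPE('a) /\<^sub>R \<bar>r\<bar> ^ DIM('a))
    = k powr (- (?D / 2 + 1)) * Q powr (- ?D / 2) * profile_mass TYPE('a)"
  proof -
    have "\<bar>r\<bar> ^ DIM('a) = (k / Q) powr (?D / 2)" using r(1,3) powr_realpow[of r "DIM('a)"] by simp
    moreover have "Q powr (- (?D + 1)) = Q powr (- (?D / 2)) * Q powr (- (?D / 2)) / Q"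
    proof -
      have "- (?D + 1) = - (?D / 2) + - (?D / 2) + - 1" by simp
      then show ?thesis using assms by (simp only: powr_add powr_neg_one) simp
    qed
    moreover have "k powr (- (?D / 2 + 1)) = k powr (- (?D / 2)) / k"
    proof -
      have "- (?D / 2 + 1) = - (?D / 2) + - 1" by simp
      then show ?thesis using assms by (simp only: powr_add powr_neg_one) simp
    qed
    moreover have "Q powr (- ?D / 2) = inverse (Q powr (?D / 2))"
      by (simp flip: powr_minus)
    moreover have "(Q / k * (inverse b * inverse b / Q)) * (Y /\<^sub>R (a / b)) = inverse a / k * inverse b * Y"
      if "a > 0" "b > 0" for a b Y :: real
      using that assms by (simp add: field_simps)
    ultimately show ?thesis using assms by (simp add: powr_divide powr_minus[of _ "?D / 2"])
  qed
  ultimately show ?thesis by (simp only:)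
qed

lemma has_bochner_integral_profile_odd:
  fixes k Q :: real and u :: "'a::euclidean_space"
  assumes "0 < k" "0 < Q"
  shows "has_bochner_integral lborel (\<lambda>g. (u \<bullet> g) * (k * (norm g)\<^sup>2 + Q) powr (- (real DIM('a) + 1))) 0"
proof -
  let ?D = "real DIM('a)"
  let ?f = "\<lambda>g::'a. (u \<bullet> g) * (k * (norm g)\<^sup>2 + Q) powr (- (?D + 1))"
  have "integrable lborel (\<lambda>g::'a. norm u * ((k * (norm g)\<^sup>2 + Q) powr (- (?D + 1)) + (norm g)\<^sup>2 * (k * (norm g)\<^sup>2 + Q) powr (- (?D + 1))))"
    using has_bochner_integral_profile_scaled[OF assms, where 'a='a] has_bochner_integral_profile_square_scaled[OF assms, where 'a='a]
    by (intro integrable_mult_right Bochner_Integration.integrable_add) (auto simp: has_bochner_integral_iff)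
  then have int: "integrable lborel ?f"
  proof (rule Bochner_Integration.integrable_bound)
    show "AE g in lborel. norm (?f g) \<le> norm (norm u * ((k * (norm g)\<^sup>2 + Q) powr (- (?D + 1)) + (norm g)\<^sup>2 * (k * (norm g)\<^sup>2 + Q) powr (- (?D + 1))))"
    proof (rule AE_I2)
      fix g :: 'a
      let ?p = "(k * (norm g)\<^sup>2 + Q) powr (- (?D + 1))"
      have "norm g \<le> 1 + (norm g)\<^sup>2"
        using zero_le_power2[of "norm g - 1/2"] by (simp add: power2_eq_square algebra_simps)
      then have "\<bar>u \<bullet> g\<bar> \<le> norm u * (1 + (norm g)\<^sup>2)"
        using Cauchy_Schwarz_ineq2[of u g] by (meson mult_left_mono norm_ge_zero order_trans)
      then have "\<bar>u \<bullet> g\<bar> * ?p \<le> (norm u * (1 + (norm g)\<^sup>2)) * ?p" by (rule mult_right_mono) simp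
      then show "norm (?f g) \<le> norm (norm u * (?p + (norm g)\<^sup>2 * ?p))"
        by (simp add: abs_mult algebra_simps)
    qed
  qed measurable
  let ?I = "integral\<^sup>L lborel ?f"
  have h: "has_bochner_integral lborel ?f ?I" using int by (simp add: has_bochner_integral_iff)
  from has_bochner_integral_lborel_affine[OF this, of "-1" 0]
  have "has_bochner_integral lborel (\<lambda>g. - ?f g) ?I" by simp
  moreover have "has_bochner_integral lborel (\<lambda>g. - ?f g) (- ?I)" using h by (rule has_bochner_integral_minus)
  ultimately have "?I = - ?I" by (rule has_bochner_integral_eq)
  then show ?thesis using h by simp
qed

text \<open>Since the zeroth and second moments agree, \<open>\<alpha>\<close> and
  \<open>\<beta>\<close> carry the same factor up to \<open>k\<close> and \<open>Q\<close>; the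
  linear part is odd about \<open>m\<close> and drops out. Both test fields have this form once the
  square is completed.\<close>

lemma has_bochner_integral_profile_quadratic:
  fixes k Q \<alpha> \<beta> :: real and u m :: "'a::euclidean_space"
  assumes "0 < k" "0 < Q"
  shows "has_bochner_integral lborel
    (\<lambda>w. (\<alpha> + \<beta> * (norm (w - m))\<^sup>2 + u \<bullet> (w - m)) * (k * (norm (w - m))\<^sup>2 + Q) powr (- (real DIM('a) + 1)))
    ((\<alpha> * k + \<beta> * Q) * (k * Q) powr (- (real DIM('a) / 2 + 1)) * profile_mass TYPE('a))"
proof -
  let ?D = "real DIM('a)"
  let ?p = "\<lambda>g::'a. (k * (norm g)\<^sup>2 + Q) powr (- (?D + 1))"
  let ?Z = "profile_mass TYPE('a)"
  have "has_bochner_integral lborel (\<lambda>g. \<alpha> * ?p g + \<beta> * ((norm g)\<^sup>2 * ?p g) + (u \<bullet> g) * ?p g)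
    (\<alpha> * (k powr (- ?D / 2) * Q powr (- (?D / 2 + 1)) * ?Z) + \<beta> * (k powr (- (?D / 2 + 1)) * Q powr (- ?D / 2) * ?Z) + 0)"
    by (intro has_bochner_integral_add has_bochner_integral_mult_right has_bochner_integral_profile_scaled
       has_bochner_integral_profile_square_scaled has_bochner_integral_profile_odd assms)
  from has_bochner_integral_lborel_affine[OF this, of 1 "-m"]
  have 1: "has_bochner_integral lborel (\<lambda>w. (\<alpha> + \<beta> * (norm (w - m))\<^sup>2 + u \<bullet> (w - m)) * ?p (w - m))
    (\<alpha> * (k powr (- ?D / 2) * Q powr (- (?D / 2 + 1)) * ?Z) + \<beta> * (k powr (- (?D / 2 + 1)) * Q powr (- ?D / 2) * ?Z))"
    by (simp add: algebra_simps)
  have k1: "k powr (- ?D / 2) = k * k powr (- (?D / 2 + 1))" and Q1: "Q powr (- ?D / 2) = Q * Q powr (- (?D / 2 + 1))"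
    using assms by (simp_all add: powr_mult_base)
  have kQ: "(k * Q) powr (- (?D / 2 + 1)) = k powr (- (?D / 2 + 1)) * Q powr (- (?D / 2 + 1))"
    using assms by (simp add: powr_mult)
  have "(\<alpha> * (k powr (- ?D / 2) * Q powr (- (?D / 2 + 1)) * ?Z) + \<beta> * (k powr (- (?D / 2 + 1)) * Q powr (- ?D / 2) * ?Z))
     = (\<alpha> * k + \<beta> * Q) * (k * Q) powr (- (?D / 2 + 1)) * ?Z"
    unfolding k1 Q1 kQ by (simp only: distrib_left distrib_right mult_ac)
  then show ?thesis using 1 by simp
qed

text \<open>Completing the square in \<open>w\<close> moves the centre to \<open>m\<close> and gives
  \<open>k * Q = x * ((norm y)\<^sup>2 + z\<^sup>2) + z\<^sup>2\<close>. The parameter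
  \<open>x\<close> survives only in the power of this affine expression, so the integration over
  \<open>x\<close> is again of Feynman's form.\<close>

lemma feynman_inner_integral:
  fixes x z :: real and y n :: "'a::euclidean_space"
  assumes "0 < x" "0 < z"
  defines "q \<equiv> \<lambda>w. x * (norm (y - w))\<^sup>2 + ((norm w)\<^sup>2 + z\<^sup>2)"
    and "R \<equiv> (x * ((norm y)\<^sup>2 + z\<^sup>2) + z\<^sup>2) powr (- (real DIM('a) / 2 + 1))"
  shows feynman_inner_integral_direction:
      "has_bochner_integral lborel (\<lambda>w. n \<bullet> (y - w) * q w powr (- (real DIM('a) + 1)))
        ((n \<bullet> y) * R * profile_mass TYPE('a))" (is ?thesis1)
    and feynman_inner_integral_radial:
      "has_bochner_integral lborel (\<lambda>w. - (w \<bullet> (y - w)) * q w powr (- (real DIM('a) + 1)))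
        (z\<^sup>2 * R * profile_mass TYPE('a))" (is ?thesis2)
proof -
  define k Q m where "k = 1 + x" and "Q = z\<^sup>2 + x * (norm y)\<^sup>2 / (1 + x)" and "m = (x / (1 + x)) *\<^sub>R y"
  have pos: "0 < k" "0 < Q" using assms by (auto simp: k_def Q_def add_pos_nonneg)
  have kQ: "k * Q = x * ((norm y)\<^sup>2 + z\<^sup>2) + z\<^sup>2" using assms by (simp add: k_def Q_def field_simps)
  have q: "q w = k * (norm (w - m))\<^sup>2 + Q" for w
  proof -
    have "k * (norm (w - m))\<^sup>2 = k * (w \<bullet> w) - 2 * (k * (x / (1 + x))) * (w \<bullet> y) + (k * (x / (1 + x)) * (x / (1 + x))) * (y \<bullet> y)"
      by (simp add: power2_norm_eq_inner m_def inner_simps inner_commute algebra_simps)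
    also have "k * (x / (1 + x)) = x" using assms by (simp add: k_def)
    finally have "k * (norm (w - m))\<^sup>2 + Q = k * (w \<bullet> w) - 2 * x * (w \<bullet> y) + (x * (x / (1 + x)) + x / (1 + x)) * (y \<bullet> y) + z\<^sup>2"
      by (simp add: Q_def power2_norm_eq_inner algebra_simps)
    also have "x * (x / (1 + x)) + x / (1 + x) = (1 + x) * (x / (1 + x))" by (simp only: distrib_right mult_1 add.commute)
    also have "\<dots> = x" using assms by simp
    finally show ?thesis
      by (simp add: q_def k_def power2_norm_eq_inner inner_simps inner_commute algebra_simps)
  qed
  have frac: "1 - x / (1 + x) = 1 / (1 + x)" using assms by (simp add: field_simps)
  have y: "y - m = (1 / (1 + x)) *\<^sub>R y" unfolding m_def frac[symmetric] by (simp add: algebra_simps)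
  have l1: "n \<bullet> (y - w) = (n \<bullet> y) / (1 + x) + 0 * (norm (w - m))\<^sup>2 + (- n) \<bullet> (w - m)" for w
  proof -
    have "n \<bullet> (y - w) = n \<bullet> (y - m) - n \<bullet> (w - m)" by (simp add: inner_simps)
    then show ?thesis by (simp add: y)
  qed
  have v1: "(n \<bullet> y) / (1 + x) * k + 0 * Q = n \<bullet> y" using assms by (simp add: k_def)
  show ?thesis1
  proof (rule has_bochner_integral_cong[THEN iffD1, OF refl _ _
        has_bochner_integral_profile_quadratic[OF pos, of "(n \<bullet> y) / (1 + x)" 0 m "- n"]])
    fix w
    show "((n \<bullet> y) / (1 + x) + 0 * (norm (w - m))\<^sup>2 + (- n) \<bullet> (w - m)) * (k * (norm (w - m))\<^sup>2 + Q) powr (- (real DIM('a) + 1))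
        = n \<bullet> (y - w) * q w powr (- (real DIM('a) + 1))"
      by (simp only: l1[of w] q[of w])
  qed (simp only: v1 R_def kQ)
  have l2: "- (w \<bullet> (y - w)) = - (m \<bullet> (y - m)) + 1 * (norm (w - m))\<^sup>2 + (m - (y - m)) \<bullet> (w - m)" for w
    by (simp add: power2_norm_eq_inner inner_simps inner_commute)
  \<comment> \<open>The two terms \<open>x * (norm y)\<^sup>2 / (1 + x)\<close> cancel. The
    remaining \<open>z\<^sup>2\<close> is positive and free of \<open>y\<close>, which is why the
    radial field yields a positive kernel.\<close>
  have v2: "- (m \<bullet> (y - m)) * k + 1 * Q = z\<^sup>2"
  proof -
    have "1 / (1 + x) * k = 1" using assms by (simp add: k_def)
    moreover have "m \<bullet> (y - m) * k = (x / (1 + x) * (y \<bullet> y)) * (1 / (1 + x) * k)"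
      unfolding y by (simp add: m_def)
    ultimately show ?thesis by (simp add: Q_def power2_norm_eq_inner)
  qed
  show ?thesis2
  proof (rule has_bochner_integral_cong[THEN iffD1, OF refl _ _
        has_bochner_integral_profile_quadratic[OF pos, of "- (m \<bullet> (y - m))" 1 m "m - (y - m)"]])
    fix w
    show "(- (m \<bullet> (y - m)) + 1 * (norm (w - m))\<^sup>2 + (m - (y - m)) \<bullet> (w - m)) * (k * (norm (w - m))\<^sup>2 + Q) powr (- (real DIM('a) + 1))
        = - (w \<bullet> (y - w)) * q w powr (- (real DIM('a) + 1))"
      by (simp only: l2[of w] q[of w])
  qed (simp only: v2 R_def kQ)
qed

text \<open>Feynman's formula \<open>a\<^sup>-\<^sup>c b\<^sup>c\<^sup>-\<^sup>D\<^sup>-\<^sup>1 \<propto> \<integral> x\<^sup>c\<^sup>-\<^sup>1 (x a + b)\<^sup>-\<^sup>D\<^sup>-\<^sup>1 dx\<close> merges the two singular factors into one quadratic form in \<open>w\<close>.\<close>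
lemma integral_feynman:
  fixes \<l> :: "'a::euclidean_space \<Rightarrow> real" and y :: 'a and c z L :: real
  defines "D \<equiv> real DIM('a)"
  assumes c: "0 < c" "c < D / 2 + 1" and z: "0 < z"
    and [measurable]: "\<l> \<in> borel_measurable borel"
    and int: "integrable lborel (\<lambda>w. \<l> w * norm (y - w) powr (- 2 * c) * ((norm w)\<^sup>2 + z\<^sup>2) powr (- (D + 1 - c)))"
    and inner: "\<And>x. 0 < x \<Longrightarrow> has_bochner_integral lborel
      (\<lambda>w. \<l> w * (x * (norm (y - w))\<^sup>2 + ((norm w)\<^sup>2 + z\<^sup>2)) powr (- (D + 1)))
      (L * (x * ((norm y)\<^sup>2 + z\<^sup>2) + z\<^sup>2) powr (- (D / 2 + 1)) * profile_mass TYPE('a))"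
  shows "(\<integral>w. \<l> w * norm (y - w) powr (- 2 * c) * ((norm w)\<^sup>2 + z\<^sup>2) powr (- (D + 1 - c)) \<partial>lborel)
    = L * (profile_mass TYPE('a) * beta_integral c (D / 2 + 1) / beta_integral c (D + 1))
        * ((norm y)\<^sup>2 + z\<^sup>2) powr (- c) * (z\<^sup>2) powr (c - (D / 2 + 1))"
proof -
  let ?B = "beta_integral c (D + 1)" and ?B' = "beta_integral c (D / 2 + 1)" and ?Z = "profile_mass TYPE('a)"
  let ?g = "\<lambda>w. \<l> w * norm (y - w) powr (- 2 * c) * ((norm w)\<^sup>2 + z\<^sup>2) powr (- (D + 1 - c))"
  let ?F = "\<lambda>w x. indicator {0<..} x * (x powr (c - 1) * (x * (norm (y - w))\<^sup>2 + ((norm w)\<^sup>2 + z\<^sup>2)) powr (- (D + 1))) * \<l> w"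
  have D: "D > 0" by (simp add: D_def)
  have B: "?B > 0" using c D by (intro beta_integral_pos) auto
  have b: "(norm w)\<^sup>2 + z\<^sup>2 > 0" for w :: 'a using z by (simp add: add_nonneg_pos)
  \<comment> \<open>At \<open>w = y\<close> the coefficient of \<open>x\<close> is zero and the
    scaled Beta formula does not apply.\<close>
  have ae: "AE w in lborel. w \<noteq> y" by (rule AE_lborel_singleton)
  have sq: "((norm (y - w))\<^sup>2) powr (- c) = norm (y - w) powr (- 2 * c)" if "w \<noteq> y" for w
    using that by (simp add: powr_powr flip: powr_numeral)
  have base: "has_bochner_integral lborel (\<lambda>x. indicator {0<..} x * (x powr (c - 1) * (x * (norm (y - w))\<^sup>2 + ((norm w)\<^sup>2 + z\<^sup>2)) powr (- (D + 1))))
      (?B * (norm (y - w) powr (- 2 * c) * ((norm w)\<^sup>2 + z\<^sup>2) powr (- (D + 1 - c))))" if "w \<noteq> y" for w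
  proof -
    have "c - (D + 1) = - (D + 1 - c)" by simp
    then show ?thesis
      using has_bochner_integral_beta_scaled[of c "D + 1" "(norm (y - w))\<^sup>2" "(norm w)\<^sup>2 + z\<^sup>2"] c D b that sq[OF that] by simp
  qed
  have x: "has_bochner_integral lborel (?F w) (?B * ?g w)" if "w \<noteq> y" for w
    using has_bochner_integral_mult_left[OF base[OF that], of "\<l> w"] by (simp add: mult_ac)
  have nx: "(\<integral>x. norm (?F w x) \<partial>lborel) = ?B * \<bar>?g w\<bar>" if "w \<noteq> y" for w
    using has_bochner_integral_integral_eq[OF has_bochner_integral_mult_left[OF base[OF that], of "\<bar>\<l> w\<bar>"]]
    by (simp add: abs_mult mult_ac)
  have meas: "case_prod ?F \<in> borel_measurable (lborel \<Otimes>\<^sub>M lborel)" by measurable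
  \<comment> \<open>Absolute integrability for Fubini: the integral of the norm over
    \<open>x\<close> is \<open>?B\<close> times the absolute value of \<open>?g\<close>, which
    \<open>int\<close> controls.\<close>
  have intF: "integrable (lborel \<Otimes>\<^sub>M lborel) (case_prod ?F)"
  proof (rule lborel_pair.Fubini_integrable[OF meas])
    have "integrable lborel (\<lambda>w. ?B * \<bar>?g w\<bar>)" using int by simp
    then have "integrable lborel (\<lambda>w. \<integral>x. norm (?F w x) \<partial>lborel)"
    proof (rule integrable_cong_AE_imp)
      show "AE w in lborel. ?B * \<bar>?g w\<bar> = (\<integral>x. norm (?F w x) \<partial>lborel)"
        using ae by eventually_elim (rule nx[symmetric])
    qed measurable
    then show "integrable lborel (\<lambda>w. \<integral>x. norm (case (w, x) of (w, x) \<Rightarrow> ?F w x) \<partial>lborel)"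
      by (simp only: prod.case)
    show "AE w in lborel. integrable lborel (\<lambda>x. case (w, x) of (w, x) \<Rightarrow> ?F w x)"
      using ae by eventually_elim (use x in \<open>simp add: has_bochner_integral_iff\<close>)
  qed
  have "?B * (\<integral>w. ?g w \<partial>lborel) = (\<integral>w. ?B * ?g w \<partial>lborel)" by simp
  also have "\<dots> = (\<integral>w. (\<integral>x. ?F w x \<partial>lborel) \<partial>lborel)"
  proof (rule integral_cong_AE)
    show "AE w in lborel. ?B * ?g w = (\<integral>x. ?F w x \<partial>lborel)"
      using ae by eventually_elim (erule has_bochner_integral_integral_eq[OF x, symmetric])
  qed measurable
  also have "\<dots> = (\<integral>x. (\<integral>w. ?F w x \<partial>lborel) \<partial>lborel)"
    by (rule lborel_pair.Fubini_integral[OF intF, symmetric])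
  also have "\<dots> = (\<integral>x. L * ?Z * (indicator {0<..} x * (x powr (c - 1) * (x * ((norm y)\<^sup>2 + z\<^sup>2) + z\<^sup>2) powr (- (D / 2 + 1)))) \<partial>lborel)"
  proof (rule Bochner_Integration.integral_cong[OF refl])
    fix x :: real
    show "(\<integral>w. ?F w x \<partial>lborel) = L * ?Z * (indicator {0<..} x * (x powr (c - 1) * (x * ((norm y)\<^sup>2 + z\<^sup>2) + z\<^sup>2) powr (- (D / 2 + 1))))"
    proof (cases "0 < x")
      case True
      have "(\<integral>w. ?F w x \<partial>lborel) = (\<integral>w. x powr (c - 1) * (\<l> w * (x * (norm (y - w))\<^sup>2 + ((norm w)\<^sup>2 + z\<^sup>2)) powr (- (D + 1))) \<partial>lborel)"
        using True by (simp add: mult_ac)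
      also have "\<dots> = x powr (c - 1) * (L * (x * ((norm y)\<^sup>2 + z\<^sup>2) + z\<^sup>2) powr (- (D / 2 + 1)) * ?Z)"
        by (rule has_bochner_integral_integral_eq[OF has_bochner_integral_mult_right[OF inner[OF True]]])
      finally show ?thesis using True by simp
    qed simp
  qed
  \<comment> \<open>The parametrisation read backwards, with
    \<open>a = (norm y)\<^sup>2 + z\<^sup>2\<close>, \<open>b = z\<^sup>2\<close> and
    \<open>e = D / 2 + 1\<close>.\<close>
  also have "\<dots> = L * ?Z * (?B' * (((norm y)\<^sup>2 + z\<^sup>2) powr (- c) * (z\<^sup>2) powr (c - (D / 2 + 1))))"
    using c z b[of y]
    by (intro has_bochner_integral_integral_eq[OF has_bochner_integral_mult_right[OF has_bochner_integral_beta_scaled]]) auto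
  finally show ?thesis using B by (simp add: field_simps)
qed


section \<open>The weight, its moments, and Fubini against the Riesz kernel\<close>

definition poisson_weight :: "real \<Rightarrow> real \<Rightarrow> 'a::euclidean_space \<Rightarrow> real" where
  "poisson_weight s z w = ((norm w)\<^sup>2 + z\<^sup>2) powr (- (real DIM('a) + 1 - (1 + s) / 2))"

definition riesz_kernel :: "real \<Rightarrow> 'a::euclidean_space \<Rightarrow> 'a" where
  "riesz_kernel s v = (1 / norm v powr (1 + s)) *\<^sub>R v"

lemma borel_measurable_poisson_weight [measurable]: "poisson_weight s z \<in> borel_measurable borel"
  unfolding poisson_weight_def by measurable

lemma borel_measurable_riesz_kernel [measurable]: "riesz_kernel s \<in> borel_measurable borel"
  unfolding riesz_kernel_def by measurable

lemma norm_riesz_kernel: "norm (riesz_kernel s v) = norm v powr (- s)"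
proof (cases "v = 0")
  case False
  then have "norm v powr (- s) = norm v powr 1 * norm v powr (- (1 + s))"
    by (simp only: powr_add[symmetric]) simp
  also have "norm v powr (- (1 + s)) = 1 / norm v powr (1 + s)" by (rule powr_minus_divide)
  finally show ?thesis using False by (simp add: riesz_kernel_def)
qed (simp add: riesz_kernel_def)

lemma has_bochner_integral_norm_power_powr:
  fixes e z :: real and j :: nat
  assumes "real DIM('a) + j < 2 * e" "0 < z"
  shows "has_bochner_integral lborel (\<lambda>w::'a::euclidean_space. norm w ^ j * ((norm w)\<^sup>2 + z\<^sup>2) powr (- e))
    (z powr (real DIM('a) + j - 2 * e) * (\<integral>(w::'a). norm w ^ j * ((norm w)\<^sup>2 + 1) powr (- e) \<partial>lborel))"
proof -
  let ?D = "real DIM('a)"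
  let ?f = "\<lambda>w::'a. norm w ^ j * ((norm w)\<^sup>2 + 1) powr (- e)"
  have "integrable lborel ?f"
  proof (rule integrable_nonneg_dominated)
    show "integrable lborel (\<lambda>w::'a. (1 + (norm w)\<^sup>2) powr (- (e - j / 2)))"
      using assms by (intro integrable_inverse_powr_norm) auto
    fix w :: 'a
    have p: "1 + (norm w)\<^sup>2 > 0" by (simp add: add_pos_nonneg)
    have "norm w \<le> (1 + (norm w)\<^sup>2) powr (1 / 2)"
      using p by (simp add: powr_half_sqrt real_le_rsqrt)
    then have "norm w ^ j \<le> ((1 + (norm w)\<^sup>2) powr (1 / 2)) ^ j" by (rule power_mono) simp
    also have "\<dots> = (1 + (norm w)\<^sup>2) powr (j / 2)" using p by (simp add: powr_powr flip: powr_realpow)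
    finally have "?f w \<le> (1 + (norm w)\<^sup>2) powr (j / 2) * (1 + (norm w)\<^sup>2) powr (- e)"
      by (simp add: add.commute mult_right_mono)
    also have "\<dots> = (1 + (norm w)\<^sup>2) powr (- (e - j / 2))" by (simp add: powr_add[symmetric])
    finally show "?f w \<le> (1 + (norm w)\<^sup>2) powr (- (e - j / 2))" .
  qed auto
  then have "has_bochner_integral lborel ?f (integral\<^sup>L lborel ?f)" by (simp add: has_bochner_integral_iff)
  from has_bochner_integral_lborel_affine[OF this, of "1 / z" 0] assms(2)
  have "has_bochner_integral lborel (\<lambda>w. ?f ((1 / z) *\<^sub>R w)) (integral\<^sup>L lborel ?f /\<^sub>R (1 / z) ^ DIM('a))"
    by simp
  then have "has_bochner_integral lborel (\<lambda>w. z powr (j - 2 * e) * ?f ((1 / z) *\<^sub>R w))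
     (z powr (j - 2 * e) * (integral\<^sup>L lborel ?f /\<^sub>R (1 / z) ^ DIM('a)))"
    by (rule has_bochner_integral_mult_right)
  moreover have "z powr (j - 2 * e) * ?f ((1 / z) *\<^sub>R w) = norm w ^ j * ((norm w)\<^sup>2 + z\<^sup>2) powr (- e)" for w :: 'a
  proof -
    have "(norm w)\<^sup>2 + z\<^sup>2 = z\<^sup>2 * ((norm ((1 / z) *\<^sub>R w))\<^sup>2 + 1)"
      using assms(2) by (simp add: field_simps)
    then have 1: "((norm w)\<^sup>2 + z\<^sup>2) powr (- e) = (z\<^sup>2) powr (- e) * ((norm ((1 / z) *\<^sub>R w))\<^sup>2 + 1) powr (- e)"
      by (simp only: powr_mult)
    have 2: "(z\<^sup>2) powr (- e) = z powr (- (2 * e))"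
      using assms(2) by (simp add: powr_powr flip: powr_numeral)
    have 3: "z powr (j - 2 * e) = z ^ j * z powr (- (2 * e))"
      using assms(2) by (simp add: powr_add[symmetric] flip: powr_realpow)
    have 4: "norm w ^ j = z ^ j * norm ((1 / z) *\<^sub>R w) ^ j"
      using assms(2) by (simp add: power_mult_distrib[symmetric])
    show ?thesis unfolding 1 2 3 4 by (simp only: mult_ac)
  qed
  moreover have "z powr (j - 2 * e) * (integral\<^sup>L lborel ?f /\<^sub>R (1 / z) ^ DIM('a))
     = z powr (?D + j - 2 * e) * integral\<^sup>L lborel ?f"
  proof -
    have "z powr (?D + j - 2 * e) = z powr (j - 2 * e) * z ^ DIM('a)"
      using assms(2) by (simp add: powr_add[symmetric] algebra_simps flip: powr_realpow)
    then show ?thesis by (simp add: power_divide)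
  qed
  ultimately show ?thesis by (simp only:)
qed

text \<open>\<open>j = 0\<close> serves the constant test direction and \<open>j = 1\<close> the
  radial field, which grows like \<open>norm w\<close>; \<open>s < D\<close> is exactly
  integrability for \<open>j = 1\<close>.\<close>

lemma has_bochner_integral_poisson_weight:
  fixes s z :: real
  assumes "s < real DIM('a)" "0 < z" "j \<le> (1::nat)"
  shows "has_bochner_integral lborel (\<lambda>w::'a::euclidean_space. norm w ^ j * poisson_weight s z w)
    (z powr (s + j - real DIM('a) - 1) * (\<integral>(w::'a). norm w ^ j * poisson_weight s 1 w \<partial>lborel))"
proof -
  have "real DIM('a) + j - 2 * (real DIM('a) + 1 - (1 + s) / 2) = s + j - real DIM('a) - 1"
    by (simp add: field_simps)
  moreover have "real DIM('a) + j < 2 * (real DIM('a) + 1 - (1 + s) / 2)"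
    using assms by (simp add: field_simps)
  ultimately show ?thesis
    using has_bochner_integral_norm_power_powr[of j "real DIM('a) + 1 - (1 + s) / 2" z, where 'a='a] assms(2)
    by (simp only: poisson_weight_def one_power2)
qed

lemma poisson_weight_bounded:
  fixes s z :: real
  assumes "s < real DIM('a)" "0 < z" "j \<le> (1::nat)"
  shows "norm w ^ j * poisson_weight s z (w::'a::euclidean_space)
    \<le> (z\<^sup>2) powr (j / 2 - (real DIM('a) + 1 - (1 + s) / 2))"
proof -
  let ?p = "real DIM('a) + 1 - (1 + s) / 2" and ?q = "(norm w)\<^sup>2 + z\<^sup>2"
  have q: "?q > 0" using assms by (simp add: add_nonneg_pos)
  have "norm w \<le> ?q powr (1 / 2)"
    using q by (simp add: powr_half_sqrt real_le_rsqrt)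
  then have "norm w ^ j \<le> (?q powr (1 / 2)) ^ j" by (rule power_mono) simp
  also have "\<dots> = ?q powr (j / 2)"
    by (subst powr_realpow[symmetric]) (use q in \<open>auto simp: powr_powr simp del: power2_less_0 zero_less_power2\<close>)
  finally have "norm w ^ j * poisson_weight s z w \<le> ?q powr (j / 2) * ?q powr (- ?p)"
    unfolding poisson_weight_def by (rule mult_right_mono) simp
  also have "\<dots> = ?q powr (j / 2 - ?p)" by (simp only: powr_add[symmetric] diff_conv_add_uminus)
  also have "\<dots> \<le> (z\<^sup>2) powr (j / 2 - ?p)"
    using assms by (intro powr_mono2') (auto simp: field_simps)
  finally show ?thesis .
qed

text \<open>Split at distance 1 from \<open>y\<close>: outside, the kernel is at most 1; inside, the
  weight is at most \<open>C\<close>. The bound is free of \<open>y\<close>, so it can be integrated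
  against a finite measure.\<close>

lemma integral_weight_norm_powr_le:
  fixes g :: "'a::euclidean_space \<Rightarrow> real"
  assumes int: "integrable lborel g" and nn: "\<And>w. 0 \<le> g w" and le: "\<And>w. g w \<le> C"
    and s: "0 \<le> s" "s < real DIM('a)"
  shows "integrable lborel (\<lambda>w. g w * norm (y - w) powr (- s))"
    and "(\<integral>w. g w * norm (y - w) powr (- s) \<partial>lborel)
      \<le> integral\<^sup>L lborel g + C * (\<integral>(v::'a). indicator (ball 0 1) v * norm v powr (- s) \<partial>lborel)"
proof -
  let ?I = "\<lambda>v::'a. indicator (ball 0 1) v * norm v powr (- s)"
  have [measurable]: "g \<in> borel_measurable borel" using int by auto
  have "has_bochner_integral lborel ?I (integral\<^sup>L lborel ?I)"
    using integrable_norm_powr_unit_ball[OF s] by (simp add: has_bochner_integral_iff)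
  from has_bochner_integral_lborel_affine[OF this, of "-1" y]
  have I: "has_bochner_integral lborel (\<lambda>w. ?I (y - w)) (integral\<^sup>L lborel ?I)" by simp
  have dom: "has_bochner_integral lborel (\<lambda>w. g w + C * ?I (y - w)) (integral\<^sup>L lborel g + C * integral\<^sup>L lborel ?I)"
    using int by (intro has_bochner_integral_add has_bochner_integral_mult_right I) (simp add: has_bochner_integral_iff)
  have C: "0 \<le> C" using nn le order_trans by blast
  have bd: "g w * norm (y - w) powr (- s) \<le> g w + C * ?I (y - w)" for w
  proof (cases "norm (y - w) < 1")
    case True
    have "g w * norm (y - w) powr (- s) \<le> C * norm (y - w) powr (- s)" using le by (rule mult_right_mono) simp
    then show ?thesis using True nn[of w] by simp
  next
    case False
    then have "norm (y - w) powr (- s) \<le> 1" using s powr_mono2'[of "-s" 1 "norm (y - w)"] by simp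
    then have "g w * norm (y - w) powr (- s) \<le> g w" using nn by (simp add: mult_left_le)
    then show ?thesis using False by simp
  qed
  show int': "integrable lborel (\<lambda>w. g w * norm (y - w) powr (- s))"
    by (rule integrable_nonneg_dominated[OF _ _ _ bd]) (use dom nn in \<open>auto simp: has_bochner_integral_iff\<close>)
  have "(\<integral>w. g w * norm (y - w) powr (- s) \<partial>lborel) \<le> (\<integral>w. g w + C * ?I (y - w) \<partial>lborel)"
    using dom by (intro integral_mono int' bd) (simp add: has_bochner_integral_iff)
  then show "(\<integral>w. g w * norm (y - w) powr (- s) \<partial>lborel) \<le> integral\<^sup>L lborel g + C * integral\<^sup>L lborel ?I"
    using dom by (simp add: has_bochner_integral_iff)
qed

lemma integrable_pair_riesz_kernel:
  fixes \<mu> :: "'a::euclidean_space measure"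
  assumes fin: "finite_measure \<mu>" and sets: "sets \<mu> = sets borel"
    and s: "0 < s" "s < real DIM('a)"
    and [measurable]: "q \<in> borel_measurable borel" and z: "0 < z"
    and q: "\<And>w::'a. norm (q w) \<le> norm w ^ j * poisson_weight s z w" and j: "j \<le> (1::nat)"
  shows
      "integrable (lborel \<Otimes>\<^sub>M \<mu>) (\<lambda>(w, y). norm (q (w - x)) * norm (y - w) powr (- s))" (is ?pair)
proof -
  interpret finite_measure \<mu> by fact
  interpret pair_sigma_finite "lborel::'a measure" \<mu> ..
  note sets[measurable_cong]
  let ?g = "\<lambda>w::'a. norm w ^ j * poisson_weight s z w"
  have g: "has_bochner_integral lborel ?g (z powr (s + j - real DIM('a) - 1) * (\<integral>(w::'a). norm w ^ j * poisson_weight s 1 w \<partial>lborel))"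
    using has_bochner_integral_poisson_weight s z j by blast
  from has_bochner_integral_lborel_affine[OF this, of 1 "-x"]
  have g': "integrable lborel (\<lambda>w. ?g (w - x))" by (simp add: has_bochner_integral_iff)
  define M where "M = integral\<^sup>L lborel (\<lambda>w. ?g (w - x))
     + (z\<^sup>2) powr (j / 2 - (real DIM('a) + 1 - (1 + s) / 2)) * (\<integral>(v::'a). indicator (ball 0 1) v * norm v powr (- s) \<partial>lborel)"
  have nn: "0 \<le> ?g (w - x)" for w by (simp add: poisson_weight_def)
  have bd: "?g (w - x) \<le> (z\<^sup>2) powr (j / 2 - (real DIM('a) + 1 - (1 + s) / 2))" for w
    by (rule poisson_weight_bounded) (use s z j in auto)
  have I: "integrable lborel (\<lambda>w. ?g (w - x) * norm (y - w) powr (- s))"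
     "(\<integral>w. ?g (w - x) * norm (y - w) powr (- s) \<partial>lborel) \<le> M" for y
    unfolding M_def using integral_weight_norm_powr_le[OF g' nn bd _ s(2)] s(1) by auto
  show ?pair
  proof (rule integrableI_bounded)
    show "(\<lambda>(w, y). norm (q (w - x)) * norm (y - w) powr (- s)) \<in> borel_measurable (lborel \<Otimes>\<^sub>M \<mu>)" by measurable
    have "(\<integral>\<^sup>+ p. ennreal (norm (case p of (w, y) \<Rightarrow> norm (q (w - x)) * norm (y - w) powr (- s))) \<partial>(lborel \<Otimes>\<^sub>M \<mu>))
       = (\<integral>\<^sup>+ y. (\<integral>\<^sup>+ w. ennreal (norm (q (w - x)) * norm (y - w) powr (- s)) \<partial>lborel) \<partial>\<mu>)"
      by (subst nn_integral_snd[symmetric]) (auto simp: measurable_split_conv)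
    also have "\<dots> \<le> (\<integral>\<^sup>+ y. ennreal M \<partial>\<mu>)"
    proof (rule nn_integral_mono)
      fix y
      have "(\<integral>\<^sup>+ w. ennreal (norm (q (w - x)) * norm (y - w) powr (- s)) \<partial>lborel)
         \<le> (\<integral>\<^sup>+ w. ennreal (?g (w - x) * norm (y - w) powr (- s)) \<partial>lborel)"
        by (intro nn_integral_mono ennreal_leI mult_right_mono q) simp
      also have "\<dots> = ennreal (\<integral>w. ?g (w - x) * norm (y - w) powr (- s) \<partial>lborel)"
        by (intro nn_integral_eq_integral I AE_I2 mult_nonneg_nonneg nn) auto
      also have "\<dots> \<le> ennreal M" by (rule ennreal_leI) (rule I)
      finally show "(\<integral>\<^sup>+ w. ennreal (norm (q (w - x)) * norm (y - w) powr (- s)) \<partial>lborel) \<le> ennreal M" .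
    qed
    also have "\<dots> < \<infinity>" using emeasure_finite[of "space \<mu>"] by (simp add: ennreal_mult_eq_top_iff less_top[symmetric])
    finally show "(\<integral>\<^sup>+ p. ennreal (norm (case p of (w, y) \<Rightarrow> norm (q (w - x)) * norm (y - w) powr (- s))) \<partial>(lborel \<Otimes>\<^sub>M \<mu>)) < \<infinity>" .
  qed
qed

text \<open>Tonelli gives integrability after multiplication by the weight at height 1, and this
  weight vanishes nowhere. At almost every point the Bochner integral therefore takes no default
  value, so inner products may be moved through it.\<close>

lemma integrable_riesz_kernel_AE:
  fixes \<mu> :: "'a::euclidean_space measure"
  assumes fin: "finite_measure \<mu>" and sets: "sets \<mu> = sets borel"
    and s: "0 < s" "s < real DIM('a)"
  shows "AE w in lborel. integrable \<mu> (\<lambda>y. riesz_kernel s (y - w))"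
proof -
  interpret finite_measure \<mu> by fact
  interpret pair_sigma_finite "lborel::'a measure" \<mu> ..
  note sets[measurable_cong]
  obtain b :: 'a where b: "b \<in> Basis" using nonempty_Basis by blast
  let ?q = "\<lambda>w::'a. poisson_weight s 1 w *\<^sub>R b"
  have "integrable (lborel \<Otimes>\<^sub>M \<mu>) (\<lambda>(w, y). norm (?q (w - 0)) * norm (y - w) powr (- s))"
    by (rule integrable_pair_riesz_kernel[OF fin sets s, where j=0 and z=1])
      (use b in \<open>auto simp: poisson_weight_def\<close>)
  from AE_integrable_fst'[OF this]
  have "AE w in lborel. integrable \<mu> (\<lambda>y. norm (?q w) * norm (y - w) powr (- s))" by simp
  then show ?thesis
  proof eventually_elim
    fix w :: 'a
    assume h: "integrable \<mu> (\<lambda>y. norm (?q w) * norm (y - w) powr (- s))"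
    have "1 + (norm w)\<^sup>2 > 0" by (simp add: add_pos_nonneg)
    then have "norm (?q w) \<noteq> 0" using b by (auto simp: poisson_weight_def add.commute)
    then have "integrable \<mu> (\<lambda>y. norm (y - w) powr (- s))" using h by simp
    then have "integrable \<mu> (\<lambda>y. norm (riesz_kernel s (y - w)))" by (simp add: norm_riesz_kernel)
    then show "integrable \<mu> (\<lambda>y. riesz_kernel s (y - w))" by (rule integrable_norm_cancel) measurable
  qed
qed

text \<open>The left-hand side is \<open>q\<close> tested against the Riesz transform of \<open>\<mu>\<close>, by Fubini.\<close>
lemma riesz_smoothing_bound:
  fixes \<mu> :: "'a::euclidean_space measure"
  assumes fin: "finite_measure \<mu>" and sets: "sets \<mu> = sets borel"
    and s: "0 < s" "s < real DIM('a)"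
    and bdd: "AE w in lborel. norm (\<integral>y. riesz_kernel s (y - w) \<partial>\<mu>) \<le> 1"
    and [measurable]: "q \<in> borel_measurable borel" and z: "0 < z"
    and q: "\<And>w::'a. norm (q w) \<le> norm w ^ j * poisson_weight s z w" and j: "j \<le> (1::nat)"
  shows "\<bar>\<integral>y. (\<integral>w. q w \<bullet> riesz_kernel s ((y - x) - w) \<partial>lborel) \<partial>\<mu>\<bar>
    \<le> z powr (s + j - real DIM('a) - 1) * (\<integral>(w::'a). norm w ^ j * poisson_weight s 1 w \<partial>lborel)"
proof -
  interpret finite_measure \<mu> by fact
  interpret pair_sigma_finite "lborel::'a measure" \<mu> ..
  note sets[measurable_cong]
  let ?h = "\<lambda>w y. q (w - x) \<bullet> riesz_kernel s (y - w)"
  let ?g = "\<lambda>w::'a. norm w ^ j * poisson_weight s z w"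
  have int: "integrable (lborel \<Otimes>\<^sub>M \<mu>) (case_prod ?h)"
  proof (rule Bochner_Integration.integrable_bound[OF integrable_pair_riesz_kernel[OF fin sets s _ z q j]])
    show "AE p in lborel \<Otimes>\<^sub>M \<mu>. norm (case p of (w, y) \<Rightarrow> ?h w y)
        \<le> norm (case p of (w, y) \<Rightarrow> norm (q (w - x)) * norm (y - w) powr (- s))"
      by (intro AE_I2) (auto simp: Cauchy_Schwarz_ineq2 simp flip: norm_riesz_kernel)
  qed measurable
  have g: "has_bochner_integral lborel ?g (z powr (s + j - real DIM('a) - 1) * (\<integral>(w::'a). norm w ^ j * poisson_weight s 1 w \<partial>lborel))"
    using has_bochner_integral_poisson_weight s z j by blast
  from has_bochner_integral_lborel_affine[OF this, of 1 "-x"]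
  have g': "has_bochner_integral lborel (\<lambda>w. ?g (w - x)) (z powr (s + j - real DIM('a) - 1) * (\<integral>(w::'a). norm w ^ j * poisson_weight s 1 w \<partial>lborel))"
    by simp
  have "(\<integral>w. q w \<bullet> riesz_kernel s ((y - x) - w) \<partial>lborel) = (\<integral>w. ?h w y \<partial>lborel)" for y
  proof -
    have "(\<integral>w. ?h w y \<partial>lborel) = (\<integral>w. ?h w y \<partial>(distr lborel borel ((+) x)))"
      by (simp add: lborel_distr_plus)
    also have "\<dots> = (\<integral>w. ?h (x + w) y \<partial>lborel)"
      by (rule integral_distr) auto
    finally show ?thesis by (simp add: algebra_simps)
  qed
  then have "(\<integral>y. (\<integral>w. q w \<bullet> riesz_kernel s ((y - x) - w) \<partial>lborel) \<partial>\<mu>) = (\<integral>y. (\<integral>w. ?h w y \<partial>lborel) \<partial>\<mu>)"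
    by simp
  also have "\<dots> = (\<integral>w. (\<integral>y. ?h w y \<partial>\<mu>) \<partial>lborel)"
    by (rule Fubini_integral[OF int])
  finally have eq: "(\<integral>y. (\<integral>w. q w \<bullet> riesz_kernel s ((y - x) - w) \<partial>lborel) \<partial>\<mu>) = (\<integral>w. (\<integral>y. ?h w y \<partial>\<mu>) \<partial>lborel)" .
  have "AE w in lborel. norm (\<integral>y. ?h w y \<partial>\<mu>) \<le> ?g (w - x)"
    using bdd integrable_riesz_kernel_AE[OF fin sets s]
  proof eventually_elim
    fix w :: 'a
    assume 1: "norm (\<integral>y. riesz_kernel s (y - w) \<partial>\<mu>) \<le> 1" and 2: "integrable \<mu> (\<lambda>y. riesz_kernel s (y - w))"
    have "(\<integral>y. ?h w y \<partial>\<mu>) = q (w - x) \<bullet> (\<integral>y. riesz_kernel s (y - w) \<partial>\<mu>)"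
      using 2 by (intro integral_inner_right) auto
    then have "norm (\<integral>y. ?h w y \<partial>\<mu>) \<le> norm (q (w - x)) * norm (\<integral>y. riesz_kernel s (y - w) \<partial>\<mu>)"
      by (simp add: Cauchy_Schwarz_ineq2)
    also have "\<dots> \<le> norm (q (w - x))" using 1 by (simp add: mult_left_le)
    also have "\<dots> \<le> ?g (w - x)" by (rule q)
    finally show "norm (\<integral>y. ?h w y \<partial>\<mu>) \<le> ?g (w - x)" .
  qed
  then have "norm (\<integral>w. (\<integral>y. ?h w y \<partial>\<mu>) \<partial>lborel) \<le> (\<integral>w. ?g (w - x) \<partial>lborel)"
  proof -
    have "integrable lborel (\<lambda>w. norm (\<integral>y. ?h w y \<partial>\<mu>))"
      using integrable_fst'[OF int] by simp
    moreover have "integrable lborel (\<lambda>w. ?g (w - x))" using g' by (simp add: has_bochner_integral_iff)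
    moreover assume "AE w in lborel. norm (\<integral>y. ?h w y \<partial>\<mu>) \<le> ?g (w - x)"
    ultimately have "(\<integral>w. norm (\<integral>y. ?h w y \<partial>\<mu>) \<partial>lborel) \<le> (\<integral>w. ?g (w - x) \<partial>lborel)"
      by (rule integral_mono_AE)
    then show ?thesis by (rule order_trans[OF integral_norm_bound])
  qed
  then show ?thesis unfolding eq using g' by (simp add: has_bochner_integral_iff)
qed


text \<open>One statement for both test fields: \<open>a\<close> is the direction, and
  \<open>L\<close> is the numerator left by the inner Gaussian-like integral, namely
  \<open>n \<bullet> y\<close> for \<open>a w = n\<close> and \<open>z\<^sup>2\<close> for
  \<open>a w = - w\<close>.\<close>

lemma integral_poisson_riesz_kernel:
  fixes s z L :: real and q :: "'a::euclidean_space \<Rightarrow> 'a" and y :: 'a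
  defines "D \<equiv> real DIM('a)" and "c \<equiv> (1 + s) / 2"
  assumes s: "0 < s" "s < D" and z: "0 < z"
    and [measurable]: "a \<in> borel_measurable borel"
    and q: "\<And>w. q w = poisson_weight s z w *\<^sub>R a w" and a: "\<And>w. norm (a w) \<le> norm w ^ j" and j: "j \<le> (1::nat)"
    and inner: "\<And>x. 0 < x \<Longrightarrow> has_bochner_integral lborel
      (\<lambda>w. a w \<bullet> (y - w) * (x * (norm (y - w))\<^sup>2 + ((norm w)\<^sup>2 + z\<^sup>2)) powr (- (D + 1)))
      (L * (x * ((norm y)\<^sup>2 + z\<^sup>2) + z\<^sup>2) powr (- (D / 2 + 1)) * profile_mass TYPE('a))"
  shows "(\<integral>w. q w \<bullet> riesz_kernel s (y - w) \<partial>lborel)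
    = z powr (s - D - 1) * (profile_mass TYPE('a) * beta_integral c (D / 2 + 1) / beta_integral c (D + 1))
        * (L * ((norm y)\<^sup>2 + z\<^sup>2) powr (- c))"
proof -
  have e: "q w \<bullet> riesz_kernel s (y - w) = (a w \<bullet> (y - w)) * norm (y - w) powr (- 2 * c) * ((norm w)\<^sup>2 + z\<^sup>2) powr (- (D + 1 - c))" for w
  proof -
    have "- 2 * c = - (1 + s)" by (simp add: c_def)
    then have "norm (y - w) powr (- 2 * c) = 1 / norm (y - w) powr (1 + s)" by (simp only: powr_minus_divide)
    then show ?thesis by (simp add: q riesz_kernel_def poisson_weight_def flip: D_def c_def)
  qed
  have int: "integrable lborel (\<lambda>w. (a w \<bullet> (y - w)) * norm (y - w) powr (- 2 * c) * ((norm w)\<^sup>2 + z\<^sup>2) powr (- (D + 1 - c)))"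
  proof (rule Bochner_Integration.integrable_bound)
    show "integrable lborel (\<lambda>w. (norm w ^ j * poisson_weight s z w) * norm (y - w) powr (- s))"
    proof (rule integral_weight_norm_powr_le(1))
      show "integrable lborel (\<lambda>w::'a. norm w ^ j * poisson_weight s z w)"
        using has_bochner_integral_poisson_weight[of s z j, where 'a='a] s z j by (simp add: has_bochner_integral_iff D_def)
      show "norm w ^ j * poisson_weight s z w \<le> (z\<^sup>2) powr (j / 2 - (real DIM('a) + 1 - (1 + s) / 2))" for w :: 'a
        using poisson_weight_bounded s z j unfolding D_def by blast
    qed (use s in \<open>auto simp: poisson_weight_def D_def\<close>)
    show "AE w in lborel. norm ((a w \<bullet> (y - w)) * norm (y - w) powr (- 2 * c) * ((norm w)\<^sup>2 + z\<^sup>2) powr (- (D + 1 - c)))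
        \<le> norm ((norm w ^ j * poisson_weight s z w) * norm (y - w) powr (- s))"
    proof (intro AE_I2)
      fix w
      have "norm (q w \<bullet> riesz_kernel s (y - w)) \<le> norm (q w) * norm (riesz_kernel s (y - w))"
        by (simp add: Cauchy_Schwarz_ineq2)
      also have "\<dots> = (norm (a w) * poisson_weight s z w) * norm (y - w) powr (- s)"
        by (simp add: q norm_riesz_kernel poisson_weight_def)
      also have "\<dots> \<le> (norm w ^ j * poisson_weight s z w) * norm (y - w) powr (- s)"
        using a by (intro mult_right_mono) (auto simp: poisson_weight_def)
      also have "\<dots> \<le> norm \<dots>" by simp
      finally show "norm ((a w \<bullet> (y - w)) * norm (y - w) powr (- 2 * c) * ((norm w)\<^sup>2 + z\<^sup>2) powr (- (D + 1 - c)))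
        \<le> norm ((norm w ^ j * poisson_weight s z w) * norm (y - w) powr (- s))" unfolding e .
    qed
  qed measurable
  have "(z\<^sup>2) powr (c - (D / 2 + 1)) = z powr (2 * (c - (D / 2 + 1)))"
    using z by (simp add: powr_powr flip: powr_numeral)
  also have "2 * (c - (D / 2 + 1)) = s - D - 1" by (simp add: c_def field_simps)
  finally have zz: "(z\<^sup>2) powr (c - (D / 2 + 1)) = z powr (s - D - 1)" .
  have "0 < c" "c < D / 2 + 1" using s by (auto simp: c_def)
  from integral_feynman[OF this[unfolded D_def] z _ int[unfolded D_def] inner[unfolded D_def]]
  show ?thesis unfolding e zz[symmetric] unfolding D_def by (simp add: mult_ac)
qed

text \<open>The mass of the weight divided by the prefactor \<open>z powr (s - D - 1)\<close> of the
  averaged kernel leaves \<open>z ^ j\<close>. With \<open>j = 0\<close> this is a constant; with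
  \<open>j = 1\<close> it is compared with the numerator \<open>z\<^sup>2\<close>, hence
  \<open>C / z\<close>. The constant \<open>C\<close> is fixed before the measure.\<close>

lemma riesz_poisson_bounds:
  fixes s :: real
  assumes s: "0 < s" "s < real DIM('a::euclidean_space)"
  obtains C where "0 < C"
    "\<And>(\<mu>::'a measure) x z n. \<lbrakk>finite_measure \<mu>; sets \<mu> = sets borel;
        AE w in lborel. norm (\<integral>y. riesz_kernel s (y - w) \<partial>\<mu>) \<le> 1; 0 < z; norm n = 1\<rbrakk> \<Longrightarrow>
      \<bar>\<integral>y. (n \<bullet> (y - x)) * ((norm (y - x))\<^sup>2 + z\<^sup>2) powr (- ((1 + s) / 2)) \<partial>\<mu>\<bar> \<le> C"
    "\<And>(\<mu>::'a measure) x z. \<lbrakk>finite_measure \<mu>; sets \<mu> = sets borel;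
        AE w in lborel. norm (\<integral>y. riesz_kernel s (y - w) \<partial>\<mu>) \<le> 1; 0 < z\<rbrakk> \<Longrightarrow>
      (\<integral>y. ((norm (y - x))\<^sup>2 + z\<^sup>2) powr (- ((1 + s) / 2)) \<partial>\<mu>) \<le> C / z"
proof -
  define D where "D = real DIM('a)"
  define c where "c = (1 + s) / 2"
  define k where "k = profile_mass TYPE('a) * beta_integral c (D / 2 + 1) / beta_integral c (D + 1)"
  define M where "M j = (\<integral>(w::'a). norm w ^ j * poisson_weight s 1 w \<partial>lborel)" for j
  have D: "0 < D" "s < D" using s by (auto simp: D_def)
  have k: "0 < k" unfolding k_def using s D
    by (intro divide_pos_pos mult_pos_pos profile_mass_pos beta_integral_pos) (auto simp: c_def)
  have M: "0 \<le> M j" for j unfolding M_def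
    by (intro integral_nonneg_AE AE_I2) (simp add: poisson_weight_def)
  define C where "C = (M 0 + M 1) / k + 1"
  have C: "0 < C" "M 0 / k \<le> C" "M 1 / k \<le> C"
    using k M[of 0] M[of 1] by (auto simp: C_def add_divide_distrib add_pos_pos add_nonneg_pos)
  have main: "\<bar>\<integral>y. L (y - x) * ((norm (y - x))\<^sup>2 + z\<^sup>2) powr (- c) \<partial>\<mu>\<bar> \<le> z ^ j * (M j / k)"
    if \<mu>: "finite_measure \<mu>" "sets \<mu> = sets borel" "AE w in lborel. norm (\<integral>y. riesz_kernel s (y - w) \<partial>\<mu>) \<le> 1" "0 < z"
      and a[measurable]: "a \<in> borel_measurable borel" "\<And>w. norm (a w) \<le> norm w ^ j" "j \<le> (1::nat)"
      and inner: "\<And>x y. 0 < x \<Longrightarrow> has_bochner_integral lborel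
        (\<lambda>w. a w \<bullet> (y - w) * (x * (norm (y - w))\<^sup>2 + ((norm w)\<^sup>2 + z\<^sup>2)) powr (- (D + 1)))
        (L y * (x * ((norm y)\<^sup>2 + z\<^sup>2) + z\<^sup>2) powr (- (D / 2 + 1)) * profile_mass TYPE('a))"
    for \<mu> :: "'a measure" and x z j a L
  proof -
    let ?q = "\<lambda>w. poisson_weight s z w *\<^sub>R a w"
    have q: "norm (?q w) \<le> norm w ^ j * poisson_weight s z w" for w
      using a(2)[of w] by (simp add: poisson_weight_def mult.commute mult_right_mono)
    have "(\<integral>w. ?q w \<bullet> riesz_kernel s (y - w) \<partial>lborel) = z powr (s - D - 1) * k * (L y * ((norm y)\<^sup>2 + z\<^sup>2) powr (- c))" for y
      unfolding D_def k_def c_def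
      by (rule integral_poisson_riesz_kernel[OF s that(4) a(1) refl a(2,3) inner[unfolded D_def]])
    then have "\<bar>z powr (s - D - 1) * k * (\<integral>y. L (y - x) * ((norm (y - x))\<^sup>2 + z\<^sup>2) powr (- c) \<partial>\<mu>)\<bar> \<le> z powr (s + j - D - 1) * M j"
      using riesz_smoothing_bound[OF \<mu>(1,2) s \<mu>(3) _ \<mu>(4) q a(3), of x] by (simp add: D_def M_def)
    also have "z powr (s + j - D - 1) = z powr (s - D - 1) * z ^ j"
      using \<mu>(4) by (simp add: powr_add[symmetric] algebra_simps flip: powr_realpow)
    finally show ?thesis using k \<mu>(4) by (simp add: abs_mult field_simps)
  qed
  show thesis
  proof
    show "0 < C" by (rule C)
  next
    fix \<mu> :: "'a measure" and x n :: 'a and z :: real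
    assume h: "finite_measure \<mu>" "sets \<mu> = sets borel" "AE w in lborel. norm (\<integral>y. riesz_kernel s (y - w) \<partial>\<mu>) \<le> 1" "0 < z"
      and n: "norm n = 1"
    have "\<bar>\<integral>y. (n \<bullet> (y - x)) * ((norm (y - x))\<^sup>2 + z\<^sup>2) powr (- c) \<partial>\<mu>\<bar> \<le> z ^ 0 * (M 0 / k)"
      by (rule main[OF h, where a="\<lambda>_. n"]) (use n feynman_inner_integral_direction[OF _ h(4)] in \<open>auto simp: D_def\<close>)
    then show "\<bar>\<integral>y. (n \<bullet> (y - x)) * ((norm (y - x))\<^sup>2 + z\<^sup>2) powr (- ((1 + s) / 2)) \<partial>\<mu>\<bar> \<le> C"
      using C by (simp add: c_def)
  next
    fix \<mu> :: "'a measure" and x :: 'a and z :: real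
    assume h: "finite_measure \<mu>" "sets \<mu> = sets borel" "AE w in lborel. norm (\<integral>y. riesz_kernel s (y - w) \<partial>\<mu>) \<le> 1" "0 < z"
    have "\<bar>\<integral>y. z\<^sup>2 * ((norm (y - x))\<^sup>2 + z\<^sup>2) powr (- c) \<partial>\<mu>\<bar> \<le> z ^ 1 * (M 1 / k)"
      by (rule main[OF h, where a="\<lambda>w. - w"]) (use feynman_inner_integral_radial[OF _ h(4)] in \<open>auto simp: D_def\<close>)
    also have "\<dots> \<le> z * C" using mult_left_mono[OF C(3), of z] h(4) by simp
    finally have "z\<^sup>2 * (\<integral>y. ((norm (y - x))\<^sup>2 + z\<^sup>2) powr (- c) \<partial>\<mu>) \<le> z * C" by (simp add: abs_le_iff)
    then show "(\<integral>y. ((norm (y - x))\<^sup>2 + z\<^sup>2) powr (- ((1 + s) / 2)) \<partial>\<mu>) \<le> C / z"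
      using h(4) by (simp add: c_def power2_eq_square field_simps)
  qed
qed

subsection \<open>Growth and porosity\<close>

text \<open>Packing: the slab has width \<open>4 * h * r\<close>, so its translates by multiples of
  \<open>5 * h * r\<close> along \<open>n\<close> are disjoint. As long as the total shift is at
  most \<open>2 * r\<close> they stay in \<open>ball x (4 * r)\<close>, which leaves room for more
  than \<open>2 / (5 * h)\<close> of them.\<close>

lemma measure_slab_le:
  fixes x n :: "'a::euclidean_space" and h r :: real
  assumes n: "norm n = 1" and h: "0 < h" and r: "0 < r"
  shows "measure lborel {w \<in> ball x (2 * r). \<bar>n \<bullet> (w - x)\<bar> \<le> 2 * h * r}
    \<le> 5 / 2 * h * (unit_ball_vol (DIM('a)) * (4 * r) ^ DIM('a))"
proof -
  let ?W = "{w \<in> ball x (2 * r). \<bar>n \<bullet> (w - x)\<bar> \<le> 2 * h * r}"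
  define K where "K = nat \<lfloor>2 / (5 * h)\<rfloor>"
  have K: "real K \<le> 2 / (5 * h)" "2 / (5 * h) < real K + 1"
    using h by (auto simp: K_def)
  let ?T = "\<lambda>k::nat. (+) ((5 * h * r * k) *\<^sub>R n) ` ?W"
  have W: "?W \<in> sets borel" by measurable
  then have W': "?W \<in> lmeasurable"
    by (intro bounded_set_imp_lmeasurable) (auto intro: bounded_subset[OF bounded_ball])
  have disj: "disjnt (?T j) (?T k)" if "j < k" for j k
  proof -
    have False if w: "w \<in> ?W" "w' \<in> ?W" "(5 * h * r * j) *\<^sub>R n + w = (5 * h * r * k) *\<^sub>R n + w'" for w w'
    proof -
      have "n \<bullet> ((5 * h * r * j) *\<^sub>R n + w - x) = n \<bullet> ((5 * h * r * k) *\<^sub>R n + w' - x)" using w(3) by simp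
      then have "5 * h * r * j + n \<bullet> (w - x) = 5 * h * r * k + n \<bullet> (w' - x)"
        using n by (simp add: inner_simps flip: power2_norm_eq_inner)
      moreover have "n \<bullet> (w - x) \<le> 2 * h * r" "- (2 * h * r) \<le> n \<bullet> (w' - x)" using w by auto
      ultimately have "5 * h * r * (real k - real j) \<le> 4 * h * r" by (simp add: algebra_simps)
      moreover have "5 * h * r * 1 \<le> 5 * h * r * (real k - real j)"
        using \<open>j < k\<close> h r by (intro mult_left_mono) auto
      ultimately show False using h r by (simp add: mult_pos_pos)
    qed
    then show ?thesis unfolding disjnt_def by blast
  qed
  have "(real K + 1) * measure lebesgue ?W = (\<Sum>k\<le>K. measure lebesgue (?T k))"
    by (simp only: measure_translation sum_constant card_atMost) (simp add: add.commute)
  also have "\<dots> = measure lebesgue (\<Union>k\<le>K. ?T k)"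
  proof (rule measure_UNION'[symmetric])
    show "pairwise (\<lambda>i j. disjnt (?T i) (?T j)) {..K}"
    proof (rule pairwiseI)
      fix i j :: nat assume "i \<noteq> j"
      then consider "i < j" | "j < i" by linarith
      then show "disjnt (?T i) (?T j)"
        by cases (rule disj, assumption, rule disjnt_sym, rule disj)
    qed
    show "?T k \<in> lmeasurable" for k by (rule measurable_translation[OF W'])
  qed simp
  also have "\<dots> \<le> measure lebesgue (ball x (4 * r))"
  proof (rule measure_mono_fmeasurable)
    show "(\<Union>k\<le>K. ?T k) \<subseteq> ball x (4 * r)"
    proof safe
      fix k w assume k: "k \<le> K" and w: "w \<in> ball x (2 * r)"
      have "5 * h * r * k \<le> 5 * h * r * (2 / (5 * h))"
        using k K(1) h r by (intro mult_left_mono) auto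
      then have "5 * h * r * k \<le> 2 * r" using h by (simp add: field_simps)
      then have "norm ((5 * h * r * k) *\<^sub>R n) \<le> 2 * r" using n h r by (simp add: abs_mult)
      moreover have "norm (w - x) < 2 * r" using w by (simp add: dist_norm norm_minus_commute)
      ultimately have "norm ((5 * h * r * k) *\<^sub>R n + (w - x)) < 4 * r" by (intro norm_triangle_lt) linarith
      then show "(5 * h * r * k) *\<^sub>R n + w \<in> ball x (4 * r)" by (simp add: dist_norm norm_minus_commute add_diff_eq)
    qed
    show "(\<Union>k\<le>K. ?T k) \<in> sets lebesgue"
      by (intro sets.finite_UN fmeasurableD measurable_translation[OF W']) simp
  qed simp
  finally have "(real K + 1) * measure lebesgue ?W \<le> measure lebesgue (ball x (4 * r))" .
  moreover have "2 / (5 * h) * measure lebesgue ?W \<le> (real K + 1) * measure lebesgue ?W"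
    using K(2) by (intro mult_right_mono) auto
  ultimately have "2 / (5 * h) * measure lebesgue ?W \<le> measure lborel (ball x (4 * r))" by (simp add: measure_completion)
  then have "measure lborel ?W \<le> 5 / 2 * h * measure lborel (ball x (4 * r))"
    using h W by (simp add: measure_completion field_simps)
  then show ?thesis using r by (simp add: content_ball)
qed

definition riesz_exponent :: "real \<Rightarrow> real" where
  "riesz_exponent s = (1 + s) / 2"

text \<open>Like the other derived constants, a function of \<open>s\<close> and \<open>C\<close>
  outside the locale: the parameters have to be chosen before any measure is given.\<close>

definition growth_const :: "real \<Rightarrow> real \<Rightarrow> real" where
  "growth_const s C = 1 + 2 powr riesz_exponent s * C"

text \<open>All that is retained of the bounded Riesz transform: the regularised fields and the
  positive kernel, at every point and every height.\<close>

locale poisson_bounded_measure = finite_measure \<mu> for \<mu> :: "'a::euclidean_space measure" +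
  fixes s C :: real
  assumes sets_eq_borel: "sets \<mu> = sets borel"
    and s_pos: "0 < s"
    and C_pos: "0 < C"
    and field_bound: "\<And>x z n. 0 < z \<Longrightarrow> norm n = 1 \<Longrightarrow>
      \<bar>\<integral>y. (n \<bullet> (y - x)) * ((norm (y - x))\<^sup>2 + z\<^sup>2) powr (- ((1 + s) / 2)) \<partial>\<mu>\<bar> \<le> C"
    and normal_bound: "\<And>x z. 0 < z \<Longrightarrow>
      (\<integral>y. ((norm (y - x))\<^sup>2 + z\<^sup>2) powr (- ((1 + s) / 2)) \<partial>\<mu>) \<le> C / z"
begin

lemmas [measurable_cong] = sets_eq_borel

lemma space_UNIV [simp]: "space \<mu> = UNIV"
  using sets_eq_imp_space_eq[OF sets_eq_borel] by simp

abbreviation c :: real where "c \<equiv> riesz_exponent s"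

lemmas c_def = riesz_exponent_def

abbreviation G :: real where "G \<equiv> growth_const s C"

lemmas G_def = growth_const_def

lemma G_ge_1: "1 \<le> G" using C_pos by (simp add: G_def)

lemma integrable_poisson_power:
  assumes "0 < z"
  shows "integrable \<mu> (\<lambda>y. ((norm (y - x))\<^sup>2 + z\<^sup>2) powr (- c))"
proof (rule integrable_const_bound[where B="(z\<^sup>2) powr (- c)"])
  show "AE y in \<mu>. norm (((norm (y - x))\<^sup>2 + z\<^sup>2) powr (- c)) \<le> (z\<^sup>2) powr (- c)"
    using assms s_pos by (intro AE_I2) (auto intro!: powr_mono2' simp: c_def)
qed measurable

text \<open>Take \<open>z = r\<close> in \<open>normal_bound\<close>: on the ball the kernel is at
  least \<open>(2 * r\<^sup>2) powr (- c)\<close>, and \<open>2 * c = 1 + s\<close>.\<close>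

lemma growth:
  assumes "0 < r"
  shows "measure \<mu> (ball x r) \<le> G * r powr s"
proof -
  let ?f = "\<lambda>y. ((norm (y - x))\<^sup>2 + r\<^sup>2) powr (- c)"
  have "(2 * r\<^sup>2) powr (- c) * measure \<mu> (ball x r) = (\<integral>y. indicator (ball x r) y *\<^sub>R (2 * r\<^sup>2) powr (- c) \<partial>\<mu>)"
    by simp
  also have "\<dots> \<le> (\<integral>y. ?f y \<partial>\<mu>)"
  proof (rule integral_mono)
    fix y
    show "indicator (ball x r) y *\<^sub>R (2 * r\<^sup>2) powr (- c) \<le> ?f y"
    proof (cases "y \<in> ball x r")
      case True
      then have "(norm (y - x))\<^sup>2 \<le> r\<^sup>2" by (intro power_mono) (auto simp: dist_norm norm_minus_commute)
      then show ?thesis using True assms s_pos by (auto simp: c_def add_nonneg_pos intro!: powr_mono2')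
    qed simp
    show "integrable \<mu> (\<lambda>y. indicator (ball x r) y *\<^sub>R (2 * r\<^sup>2) powr (- c))"
      by (intro integrable_scaleR_left integrable_real_indicator) (auto simp: emeasure_eq_measure)
  qed (rule integrable_poisson_power[OF assms])
  also have "\<dots> \<le> C / r" using normal_bound[OF assms] by (simp add: c_def)
  finally have "(2 * r\<^sup>2) powr (- c) * measure \<mu> (ball x r) \<le> C / r" .
  moreover have "(2 * r\<^sup>2) powr (- c) = inverse (2 powr c * r powr (1 + s))"
  proof -
    have "(r\<^sup>2) powr c = r powr (2 * c)" using assms by (simp add: powr_powr flip: powr_numeral)
    also have "2 * c = 1 + s" by (simp add: c_def)
    finally have "(r\<^sup>2) powr c = r powr (1 + s)" .
    then show ?thesis by (simp add: powr_minus powr_mult)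
  qed
  moreover have "r powr (1 + s) = r * r powr s" using assms by (simp add: powr_add)
  ultimately have "measure \<mu> (ball x r) \<le> 2 powr c * C * r powr s"
    using assms by (simp add: field_simps)
  also have "\<dots> \<le> G * r powr s" unfolding G_def by (intro mult_right_mono) auto
  finally show ?thesis .
qed

text \<open>Tonelli for the symmetric relation \<open>dist w y < r\<close>: each \<open>y\<close> in
  \<open>S\<close> is seen by a ball of centres \<open>w\<close>.\<close>

lemma nn_integral_measure_Int_ball:
  assumes [measurable]: "S \<in> sets borel"
  shows "(\<integral>\<^sup>+w. ennreal (measure \<mu> (S \<inter> ball w r)) \<partial>lborel)
    = ennreal (measure \<mu> S) * emeasure lborel (ball (0::'a) r)"
proof -
  interpret pair_sigma_finite "lborel::'a measure" \<mu> ..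
  let ?f = "\<lambda>w y. indicator S y * (if dist w y < r then 1 else 0 :: ennreal)"
  have "(\<integral>\<^sup>+w. ennreal (measure \<mu> (S \<inter> ball w r)) \<partial>lborel) = (\<integral>\<^sup>+w. (\<integral>\<^sup>+y. ?f w y \<partial>\<mu>) \<partial>lborel)"
  proof (rule nn_integral_cong)
    fix w
    have "ennreal (measure \<mu> (S \<inter> ball w r)) = (\<integral>\<^sup>+y. indicator (S \<inter> ball w r) y \<partial>\<mu>)"
      by (simp add: emeasure_eq_measure)
    also have "\<dots> = (\<integral>\<^sup>+y. ?f w y \<partial>\<mu>)"
      by (rule nn_integral_cong) (auto simp: indicator_def)
    finally show "ennreal (measure \<mu> (S \<inter> ball w r)) = (\<integral>\<^sup>+y. ?f w y \<partial>\<mu>)" .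
  qed
  also have "\<dots> = (\<integral>\<^sup>+y. (\<integral>\<^sup>+w. ?f w y \<partial>lborel) \<partial>\<mu>)"
    by (rule Fubini'[symmetric]) measurable
  also have "\<dots> = (\<integral>\<^sup>+y. indicator S y * emeasure lborel (ball (0::'a) r) \<partial>\<mu>)"
  proof (rule nn_integral_cong)
    fix y
    have "(\<integral>\<^sup>+w. ?f w y \<partial>lborel) = (\<integral>\<^sup>+w. indicator S y * indicator (ball y r) w \<partial>lborel)"
      by (rule nn_integral_cong) (auto simp: indicator_def dist_commute)
    also have "\<dots> = indicator S y * emeasure lborel (ball y r)"
      by (rule nn_integral_cmult_indicator) simp
    also have "emeasure lborel (ball y r) = emeasure lborel (ball (0::'a) r)"
      by (cases "0 \<le> r") (simp_all add: emeasure_ball ball_empty)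
    finally show "(\<integral>\<^sup>+w. ?f w y \<partial>lborel) = indicator S y * emeasure lborel (ball (0::'a) r)" .
  qed
  also have "\<dots> = ennreal (measure \<mu> S) * emeasure lborel (ball (0::'a) r)"
    by (subst nn_integral_multc) (auto simp: emeasure_eq_measure)
  finally show ?thesis .
qed

text \<open>Averaging over all centres replaces a covering of \<open>S\<close> by balls: only
  centres in \<open>W\<close> see \<open>S\<close>, and each of them sees at most
  \<open>G * r powr s\<close>.\<close>

lemma measure_mult_ball_le:
  assumes S: "S \<in> sets borel" and W: "W \<in> sets borel" "emeasure lborel W < \<infinity>" and r: "0 < r"
    and near: "\<And>y w. y \<in> S \<Longrightarrow> dist w y < r \<Longrightarrow> w \<in> W"
  shows "measure \<mu> S * (unit_ball_vol DIM('a) * r ^ DIM('a)) \<le> G * r powr s * measure lborel W"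
proof -
  have "ennreal (measure \<mu> S * (unit_ball_vol DIM('a) * r ^ DIM('a))) = (\<integral>\<^sup>+w. ennreal (measure \<mu> (S \<inter> ball w r)) \<partial>lborel)"
    using r by (simp add: nn_integral_measure_Int_ball[OF S] emeasure_ball ennreal_mult)
  also have "\<dots> \<le> (\<integral>\<^sup>+w. ennreal (G * r powr s) * indicator W w \<partial>lborel)"
  proof (rule nn_integral_mono)
    fix w
    show "ennreal (measure \<mu> (S \<inter> ball w r)) \<le> ennreal (G * r powr s) * indicator W w"
    proof (cases "w \<in> W")
      case True
      have "measure \<mu> (S \<inter> ball w r) \<le> measure \<mu> (ball w r)" by (rule finite_measure_mono) auto
      also have "\<dots> \<le> G * r powr s" by (rule growth[OF r])
      finally show ?thesis using True by (simp add: ennreal_leI)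
    next
      case False
      then have "S \<inter> ball w r = {}" using near by auto
      then show ?thesis by simp
    qed
  qed
  also have "\<dots> = ennreal (G * r powr s) * emeasure lborel W"
    using W by (simp add: nn_integral_cmult_indicator)
  also have "\<dots> = ennreal (G * r powr s * measure lborel W)"
    using W G_ge_1 by (simp add: emeasure_eq_ennreal_measure ennreal_mult)
  finally show ?thesis using G_ge_1 by (subst (asm) ennreal_le_iff) auto
qed

text \<open>Balls of radius \<open>h * r\<close> and the volume of the doubled slab give
  \<open>h powr s * h / h ^ D\<close>. For \<open>s > D - 1\<close> the exponent is positive, so
  thin slabs carry little mass.\<close>

lemma slab_mass_le:
  assumes n: "norm n = 1" and h: "0 < h" "h \<le> 1" and r: "0 < r"
  shows "measure \<mu> {y \<in> ball x r. \<bar>n \<bullet> (y - x)\<bar> \<le> h * r}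
    \<le> 5 / 2 * 4 ^ DIM('a) * G * h powr (s + 1 - DIM('a)) * r powr s"
proof -
  let ?D = "DIM('a)" and ?V = "unit_ball_vol DIM('a)"
  let ?S = "{y \<in> ball x r. \<bar>n \<bullet> (y - x)\<bar> \<le> h * r}" and ?W = "{w \<in> ball x (2 * r). \<bar>n \<bullet> (w - x)\<bar> \<le> 2 * h * r}"
  have hr: "0 < h * r" using h r by simp
  have "measure \<mu> ?S * (?V * (h * r) ^ ?D) \<le> G * (h * r) powr s * measure lborel ?W"
  proof (rule measure_mult_ball_le[OF _ _ _ hr])
    show "?S \<in> sets borel" "?W \<in> sets borel" by measurable
    have "emeasure lborel ?W \<le> emeasure lborel (ball x (2 * r))" by (rule emeasure_mono) auto
    then show "emeasure lborel ?W < \<infinity>" using emeasure_lborel_ball_finite le_less_trans by blast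
    fix y w assume y: "y \<in> ?S" and w: "dist w y < h * r"
    have "h * r \<le> r" using h r by simp
    then have "dist x w < 2 * r" using y w dist_triangle[of x w y] by (simp add: dist_commute)
    moreover have "\<bar>n \<bullet> (w - y)\<bar> \<le> h * r"
      using Cauchy_Schwarz_ineq2[of n "w - y"] n w by (simp add: dist_norm)
    moreover have "n \<bullet> (w - x) = n \<bullet> (w - y) + n \<bullet> (y - x)" by (simp add: inner_simps)
    ultimately show "w \<in> ?W" using y by auto
  qed
  also have "\<dots> \<le> G * (h * r) powr s * (5 / 2 * h * (?V * (4 * r) ^ ?D))"
    using G_ge_1 by (intro mult_left_mono measure_slab_le n h r) auto
  finally have "measure \<mu> ?S * (h * r) ^ ?D \<le> G * (h * r) powr s * (5 / 2 * h * (4 * r) ^ ?D)"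
    by (simp add: mult.assoc mult.left_commute[of _ ?V] mult_le_cancel_left)
  also have "\<dots> = (5 / 2 * 4 ^ ?D * G * h powr (s + 1 - ?D) * r powr s) * (h * r) ^ ?D"
  proof -
    have "h powr s * h = h powr (s + 1 - ?D) * h ^ ?D"
      using h by (simp add: powr_add[symmetric] powr_realpow[symmetric] powr_mult_base mult.commute add.commute)
    then have "h powr s * (h * X) = h powr (s + 1 - ?D) * (h ^ ?D * X)" for X by (metis mult.assoc)
    then show ?thesis by (simp add: powr_mult power_mult_distrib mult_ac)
  qed
  finally show ?thesis using hr by (simp add: mult_le_cancel_right)
qed

text \<open>Otherwise the \<open>2 \<eta> \<rho>\<close>-balls around all points of the ball would be too heavy for the growth bound.\<close>
lemma porosity:
  assumes dense: "\<And>e. e \<in> E \<Longrightarrow> \<delta> * (\<eta> * \<rho>) powr s \<le> measure \<mu> (ball e (\<eta> * \<rho>))"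
    and \<rho>: "0 < \<rho>" and \<eta>: "0 < \<eta>" "\<eta> \<le> 1 / 4"
    and small: "4 ^ DIM('a) * G * \<eta> powr (DIM('a) - s) < \<delta>"
  obtains z where "z \<in> ball a (\<rho> / 2)" "\<And>e. e \<in> E \<Longrightarrow> \<eta> * \<rho> \<le> dist z e"
proof -
  let ?D = "DIM('a)" and ?V = "unit_ball_vol DIM('a)"
  have "\<exists>z \<in> ball a (\<rho> / 2). \<forall>e\<in>E. \<eta> * \<rho> \<le> dist z e"
  proof (rule ccontr)
    assume "\<not> ?thesis"
    then have near: "\<exists>e\<in>E. dist w e < \<eta> * \<rho>" if "w \<in> ball a (\<rho> / 2)" for w using that by force
    have hr: "0 < 2 * \<eta> * \<rho>" "2 * \<eta> * \<rho> \<le> \<rho> / 2" using \<rho> \<eta> by auto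
    have \<delta>: "0 < \<delta>" using small G_ge_1 by (smt (verit) mult_nonneg_nonneg powr_ge_zero zero_le_power)
    have "ennreal (\<delta> * (\<eta> * \<rho>) powr s * (?V * (\<rho> / 2) ^ ?D)) = (\<integral>\<^sup>+w. ennreal (\<delta> * (\<eta> * \<rho>) powr s) * indicator (ball a (\<rho> / 2)) w \<partial>lborel)"
      using \<rho> \<delta> by (simp add: nn_integral_cmult_indicator emeasure_ball ennreal_mult)
    also have "\<dots> \<le> (\<integral>\<^sup>+w. ennreal (measure \<mu> (ball a \<rho> \<inter> ball w (2 * \<eta> * \<rho>))) \<partial>lborel)"
    proof (rule nn_integral_mono)
      fix w :: 'a
      show "ennreal (\<delta> * (\<eta> * \<rho>) powr s) * indicator (ball a (\<rho> / 2)) w \<le> ennreal (measure \<mu> (ball a \<rho> \<inter> ball w (2 * \<eta> * \<rho>)))"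
      proof (cases "w \<in> ball a (\<rho> / 2)")
        case True
        then obtain e where e: "e \<in> E" "dist w e < \<eta> * \<rho>" using near by blast
        have sub: "ball e (\<eta> * \<rho>) \<subseteq> ball a \<rho> \<inter> ball w (2 * \<eta> * \<rho>)"
        proof
          fix v assume v: "v \<in> ball e (\<eta> * \<rho>)"
          then have "dist w v < 2 * \<eta> * \<rho>" using e dist_triangle[of w v e] by auto
          moreover from this have "dist a v < \<rho>" using True hr(2) dist_triangle[of a v w] by auto
          ultimately show "v \<in> ball a \<rho> \<inter> ball w (2 * \<eta> * \<rho>)" by simp
        qed
        have "\<delta> * (\<eta> * \<rho>) powr s \<le> measure \<mu> (ball e (\<eta> * \<rho>))" by (rule dense[OF e(1)])
        also have "\<dots> \<le> measure \<mu> (ball a \<rho> \<inter> ball w (2 * \<eta> * \<rho>))"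
          by (rule finite_measure_mono[OF sub]) auto
        finally show ?thesis using True by (simp add: ennreal_leI)
      qed simp
    qed
    also have "\<dots> = ennreal (measure \<mu> (ball a \<rho>) * (?V * (2 * \<eta> * \<rho>) ^ ?D))"
      using hr by (subst nn_integral_measure_Int_ball) (auto simp: emeasure_ball ennreal_mult)
    also have "\<dots> \<le> ennreal (G * \<rho> powr s * (?V * (2 * \<eta> * \<rho>) ^ ?D))"
      using hr by (intro ennreal_leI mult_right_mono growth \<rho>) auto
    finally have "\<delta> * (\<eta> * \<rho>) powr s * (?V * (\<rho> / 2) ^ ?D) \<le> G * \<rho> powr s * (?V * (2 * \<eta> * \<rho>) ^ ?D)"
      using G_ge_1 hr by (subst (asm) ennreal_le_iff) auto
    then have "\<delta> * (\<eta> * \<rho>) powr s * (\<rho> / 2) ^ ?D \<le> G * \<rho> powr s * (2 * \<eta> * \<rho>) ^ ?D"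
      by (simp add: mult.assoc mult.left_commute[of _ ?V] mult_le_cancel_left)
    also have "\<dots> = (4 ^ ?D * G * \<eta> powr (?D - s)) * (\<eta> * \<rho>) powr s * (\<rho> / 2) ^ ?D"
    proof -
      have 1: "\<eta> powr (?D - s) * \<eta> powr s = \<eta> ^ ?D" using \<eta> by (simp add: powr_add[symmetric] powr_realpow[symmetric])
      have "2 * \<eta> * \<rho> = 4 * \<eta> * (\<rho> / 2)" by simp
      then have 2: "(2 * \<eta> * \<rho>) ^ ?D = 4 ^ ?D * \<eta> ^ ?D * (\<rho> / 2) ^ ?D"
        by (simp only: power_mult_distrib)
      show ?thesis unfolding 2 1[symmetric] powr_mult by (simp only: mult_ac)
    qed
    finally have "\<delta> \<le> 4 ^ ?D * G * \<eta> powr (?D - s)"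
      using \<eta> \<rho> by (simp add: mult_le_cancel_right mult.assoc)
    then show False using small by simp
  qed
  then show thesis using that by blast
qed

end

subsection \<open>Holes carry mass\<close>

text \<open>If \<open>A \<le> z\<^sup>2\<close>, then
  \<open>(A + z\<^sup>2) / (A + z\<^sup>2 / 4)\<close> is at least \<open>8 / 5\<close>, its value
  at \<open>A = z\<^sup>2\<close>; the factor \<open>2 powr (- c)\<close> comes from
  \<open>A + z\<^sup>2 \<le> 2 * z\<^sup>2\<close>.\<close>

definition gap_const :: "real \<Rightarrow> real" where
  "gap_const c = ((8 / 5) powr c - 1) * 2 powr (- c)"

lemma gap_const_pos:
  assumes "0 < c" shows "0 < gap_const c"
  using assms by (simp add: gap_const_def)

text \<open>The change of the kernel between heights \<open>z\<close> and \<open>z / 2\<close>. The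
  lower bound produces the gain at scale \<open>z\<close>; the upper bound controls the quadratic
  deviation of a sphere from its tangent plane, even far beyond scale \<open>z\<close>.\<close>

lemma poisson_power_diff:
  fixes A z c :: real
  assumes A: "0 \<le> A" and z: "0 < z" and c: "0 < c"
  defines "X \<equiv> A + (z / 2)\<^sup>2" and "Y \<equiv> A + z\<^sup>2"
  shows poisson_power_diff_nonneg: "0 \<le> X powr (- c) - Y powr (- c)"
    and poisson_power_diff_lower: "A \<le> z\<^sup>2 \<Longrightarrow> gap_const c * z powr (- (2 * c)) \<le> X powr (- c) - Y powr (- c)"
    and poisson_power_diff_upper: "A * (X powr (- c) - Y powr (- c)) \<le> c * 4 powr c * z\<^sup>2 * Y powr (- c)"
proof -
  have X: "0 < X" "X \<le> Y" "A \<le> X" and Y: "0 < Y"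
    using A z by (auto simp: X_def Y_def add_nonneg_pos power_divide)
  show "0 \<le> X powr (- c) - Y powr (- c)" using X c by (simp add: powr_mono2')
  have quot: "X powr (- c) = Y powr (- c) * (Y / X) powr c"
    using X Y by (simp add: powr_divide powr_minus field_simps)
  show "gap_const c * z powr (- (2 * c)) \<le> X powr (- c) - Y powr (- c)" if le: "A \<le> z\<^sup>2"
  proof -
    have "8 / 5 * X \<le> Y" using le by (simp add: X_def Y_def power_divide)
    then have "8 / 5 \<le> Y / X" using X by (simp add: field_simps)
    then have 1: "(8 / 5) powr c - 1 \<le> (Y / X) powr c - 1" using c by (simp add: powr_mono2)
    have "Y \<le> 2 * z\<^sup>2" using le by (simp add: Y_def)
    then have "(2 * z\<^sup>2) powr (- c) \<le> Y powr (- c)" using c Y by (simp add: powr_mono2')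
    moreover have "(2 * z\<^sup>2) powr (- c) = 2 powr (- c) * z powr (- (2 * c))"
      using z by (simp add: powr_mult powr_powr flip: powr_numeral)
    ultimately have 2: "2 powr (- c) * z powr (- (2 * c)) \<le> Y powr (- c)" by simp
    have "((8 / 5) powr c - 1) * (2 powr (- c) * z powr (- (2 * c))) \<le> ((Y / X) powr c - 1) * Y powr (- c)"
    proof (rule mult_mono[OF 1 2])
      have "1 \<le> (8 / 5 :: real) powr c" using c by (simp add: ge_one_powr_ge_zero)
      then show "0 \<le> (Y / X) powr c - 1" using 1 by simp
    qed simp
    then show ?thesis by (simp add: gap_const_def quot algebra_simps)
  qed
  define u where "u = 3 / 4 * z\<^sup>2 / X"
  have u: "0 \<le> u" "Y / X = 1 + u" using X by (auto simp: u_def X_def Y_def field_simps power_divide)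
  have "Y \<le> 4 * X" using A by (simp add: X_def Y_def power_divide)
  then have "Y / X \<le> 4" using X by (simp add: field_simps)
  then have four: "(Y / X) powr c \<le> 4 powr c" using X Y c by (intro powr_mono2) auto
  \<comment> \<open>From \<open>exp e - 1 \<le> e * exp e\<close> and
    \<open>ln (1 + u) \<le> u\<close> the relative increment is linear in \<open>u\<close>, and
    \<open>A * u \<le> z\<^sup>2\<close>.\<close>
  define e where "e = c * ln (Y / X)"
  have e: "(Y / X) powr c = exp e" using X Y by (simp add: powr_def e_def)
  have "1 - e \<le> exp (- e)" using exp_ge_add_one_self[of "- e"] by simp
  then have "(1 - e) * exp e \<le> 1" by (simp add: exp_minus field_simps)
  then have "(Y / X) powr c - 1 \<le> e * (Y / X) powr c" by (simp add: e algebra_simps)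
  also have "\<dots> \<le> c * u * 4 powr c"
  proof (rule mult_mono)
    show "e \<le> c * u" unfolding e_def u(2) using c u ln_add_one_self_le_self[of u] by (intro mult_left_mono) auto
  qed (use four c u in auto)
  finally have "(Y / X) powr c - 1 \<le> c * u * 4 powr c" .
  then have "A * Y powr (- c) * ((Y / X) powr c - 1) \<le> A * Y powr (- c) * (c * u * 4 powr c)"
    using A by (intro mult_left_mono) auto
  also have "\<dots> = (A * u) * (Y powr (- c) * c * 4 powr c)" by simp
  also have "\<dots> \<le> z\<^sup>2 * (Y powr (- c) * c * 4 powr c)"
  proof (rule mult_right_mono)
    have "A * u \<le> X * u" using X u by (intro mult_right_mono) auto
    also have "\<dots> \<le> z\<^sup>2" using X by (simp add: u_def)
    finally show "A * u \<le> z\<^sup>2" .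
  qed (use c in auto)
  finally show "A * (X powr (- c) - Y powr (- c)) \<le> c * 4 powr c * z\<^sup>2 * Y powr (- c)"
    by (simp add: quot algebra_simps)
qed

lemma norm_mult_poisson_power_le:
  fixes r z s :: real
  assumes "0 \<le> r" "0 < z" "0 < s"
  shows "r * (r\<^sup>2 + z\<^sup>2) powr (- ((1 + s) / 2)) \<le> z powr (- s)"
proof -
  let ?q = "r\<^sup>2 + z\<^sup>2"
  have q: "0 < ?q" using assms by (simp add: add_nonneg_pos)
  have "r \<le> ?q powr (1 / 2)" using q assms by (simp add: powr_half_sqrt real_le_rsqrt)
  then have "r * ?q powr (- ((1 + s) / 2)) \<le> ?q powr (1 / 2) * ?q powr (- ((1 + s) / 2))"
    by (rule mult_right_mono) simp
  also have "\<dots> = ?q powr (- (s / 2))" by (simp only: powr_add[symmetric]) (simp add: field_simps)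
  also have "\<dots> \<le> (z\<^sup>2) powr (- (s / 2))" using assms by (intro powr_mono2') auto
  also have "\<dots> = z powr (- s)" using assms by (simp add: powr_powr flip: powr_numeral)
  finally show ?thesis .
qed

text \<open>The first entry keeps a light hole below a quarter of the mass at scale
  \<open>z\<close>; the second keeps its negative contribution below half of the gain.\<close>

definition hole_factor :: "real \<Rightarrow> real" where
  "hole_factor s = min (1 / 4) (gap_const (riesz_exponent s) / 2 powr (s + 2))"

text \<open>Each scale gains \<open>h * gap_const c * \<delta> / 4\<close>, against at most
  \<open>(c * 4 powr c + 4) * C\<close> for the summed errors and the field at both ends. Beyond
  this value of \<open>N * h * \<delta>\<close> the gain wins.\<close>

definition scale_factor :: "real \<Rightarrow> real \<Rightarrow> real" where
  "scale_factor s C = 4 * ((riesz_exponent s * 4 powr riesz_exponent s + 4) * C) / gap_const (riesz_exponent s)"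

context poisson_bounded_measure
begin

lemma c_pos: "0 < c" and two_c: "2 * c = 1 + s" using s_pos by (auto simp: c_def)

abbreviation hole_const :: real where "hole_const \<equiv> hole_factor s"

lemmas hole_const_def = hole_factor_def

lemma hole_const_pos: "0 < hole_const"
  using gap_const_pos[OF c_pos] by (simp add: hole_const_def)

lemma hole_const_le: "hole_const \<le> 1 / 4" "hole_const \<le> gap_const c / 2 powr (s + 2)"
  unfolding hole_const_def by (rule min.cobounded1, rule min.cobounded2)

abbreviation scale_const :: real where "scale_const \<equiv> scale_factor s C"

lemmas scale_const_def = scale_factor_def

definition truncated_field :: "'a \<Rightarrow> 'a \<Rightarrow> real \<Rightarrow> real" where
  "truncated_field n x z = (\<integral>y. (n \<bullet> (y - x)) * ((norm (y - x))\<^sup>2 + z\<^sup>2) powr (- c) \<partial>\<mu>)"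

lemma integrable_truncated_field:
  assumes "norm n = 1" "0 < z"
  shows "integrable \<mu> (\<lambda>y. (n \<bullet> (y - x)) * ((norm (y - x))\<^sup>2 + z\<^sup>2) powr (- c))"
proof (rule integrable_const_bound[where B="z powr (- s)"])
  have "\<bar>n \<bullet> (y - x)\<bar> * ((norm (y - x))\<^sup>2 + z\<^sup>2) powr (- c) \<le> norm (y - x) * ((norm (y - x))\<^sup>2 + z\<^sup>2) powr (- c)" for y
    using Cauchy_Schwarz_ineq2[of n "y - x"] assms(1) by (intro mult_right_mono) auto
  also have "\<dots> y \<le> z powr (- s)" for y
    unfolding c_def using assms s_pos by (intro norm_mult_poisson_power_le) auto
  finally show "AE y in \<mu>. norm ((n \<bullet> (y - x)) * ((norm (y - x))\<^sup>2 + z\<^sup>2) powr (- c)) \<le> z powr (- s)"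
    by (intro AE_I2) (simp add: abs_mult)
qed measurable

text \<open>Away from the hole the supporting ball forces \<open>n \<bullet> (y - x) \<ge> - |y - x|\<^sup>2 / (2 R) - t\<close>, and by density
  a fixed share of the mass at scale \<open>z\<close> lies well above the tangent hyperplane.\<close>
lemma field_gain:
  assumes n: "norm n = 1" and R: "0 < R" and h: "0 < h" "h \<le> 1" and \<delta>: "0 < \<delta>"
    and z: "0 < z" "z \<le> h * R" and t: "0 \<le> t" "t \<le> h / 2 * z" "t \<le> R"
    and dense: "\<delta> * z powr s \<le> measure \<mu> (ball x z)"
    and slab: "5 / 2 * 4 ^ DIM('a) * G * h powr (s + 1 - DIM('a)) \<le> \<delta> / 4"
    and hole: "measure \<mu> (ball (x - R *\<^sub>R n) (R - t)) \<le> hole_const * h * \<delta> * z powr s"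
  shows "h * gap_const c * \<delta> / 4 - c * 4 powr c * C * z / (2 * R) - 2 * C * t / z
    \<le> truncated_field n x (z / 2) - truncated_field n x z"
proof -
  let ?H = "ball (x - R *\<^sub>R n) (R - t)"
  let ?L = "{y \<in> ball x z. \<bar>n \<bullet> (y - x)\<bar> \<le> h * z}"
  let ?S = "ball x z - ?H - ?L"
  let ?X = "\<lambda>y. ((norm (y - x))\<^sup>2 + (z / 2)\<^sup>2) powr (- c)" and ?Y = "\<lambda>y. ((norm (y - x))\<^sup>2 + z\<^sup>2) powr (- c)"
  have g: "0 < gap_const c" by (rule gap_const_pos[OF c_pos])
  have z2: "0 < z / 2" using z by simp
  let ?K = "c * 4 powr c * z\<^sup>2 / (2 * R)" and ?M = "(2 / z) powr s" and ?g = "h * gap_const c * z powr (- s)"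
  \<comment> \<open>Pointwise lower bound for the increment: the gain on the good set
    \<open>?S\<close>, minus the errors from curvature, from the shrinking \<open>t\<close>, and
    from mass inside the hole.\<close>
  let ?rhs = "\<lambda>y. ?g * indicator ?S y - ?K * ?Y y - t * ?X y - ?M * indicator ?H y"
  let ?lhs = "\<lambda>y. (n \<bullet> (y - x)) * ?X y - (n \<bullet> (y - x)) * ?Y y"
  have K: "0 \<le> ?K" "0 \<le> ?M" "0 \<le> ?g" using c_pos z R g h by auto
  have point: "?rhs y \<le> ?lhs y" for y
  proof -
    define w where "w = ?X y - ?Y y"
    have w: "0 \<le> w" "w \<le> ?X y" unfolding w_def using poisson_power_diff_nonneg[OF _ z(1) c_pos] by auto
    have l: "?lhs y = (n \<bullet> (y - x)) * w" by (simp add: w_def algebra_simps)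
    show ?thesis
    proof (cases "y \<in> ?H")
      case True
      have "- (norm (y - x) * w) \<le> (n \<bullet> (y - x)) * w"
        using Cauchy_Schwarz_ineq2[of n "y - x"] n w(1) mult_right_mono[of "- norm (y - x)" "n \<bullet> (y - x)" w] by (simp add: abs_le_iff)
      moreover have "norm (y - x) * w \<le> norm (y - x) * ?X y" using w by (intro mult_left_mono) auto
      moreover have "norm (y - x) * ?X y \<le> (z / 2) powr (- s)"
        unfolding c_def using z2 s_pos by (intro norm_mult_poisson_power_le) auto
      moreover have "(z / 2) powr (- s) = ?M" using z by (simp add: powr_minus powr_divide)
      moreover have "0 \<le> ?K * ?Y y" by (intro mult_nonneg_nonneg K) simp
      moreover have "0 \<le> t * ?X y" by (intro mult_nonneg_nonneg t) simp
      ultimately show ?thesis using True unfolding l by simp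
    next
      case False
      \<comment> \<open>The height of \<open>y\<close> above the tangent plane, corrected by the
        curvature and by \<open>t\<close>; expanding the square of the distance to the centre shows
        that it is nonnegative off the hole.\<close>
      define f where "f = n \<bullet> (y - x) + (norm (y - x))\<^sup>2 / (2 * R) + t"
      have "R - t \<le> norm (y - x + R *\<^sub>R n)" using False by (simp add: dist_norm norm_minus_commute algebra_simps)
      then have "(R - t)\<^sup>2 \<le> (norm (y - x + R *\<^sub>R n))\<^sup>2" using t by (intro power_mono) auto
      also have "\<dots> = (norm (y - x))\<^sup>2 + 2 * R * (n \<bullet> (y - x)) + R\<^sup>2"
        unfolding power2_norm_eq_inner using n
        by (simp add: inner_simps inner_commute power2_eq_square norm_eq_1 algebra_simps)
      finally have le: "(R - t)\<^sup>2 \<le> (norm (y - x))\<^sup>2 + 2 * R * (n \<bullet> (y - x)) + R\<^sup>2" .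
      have "2 * R * f = 2 * R * (n \<bullet> (y - x)) + (norm (y - x))\<^sup>2 + 2 * R * t"
        using R by (simp add: f_def algebra_simps)
      then have "0 \<le> 2 * R * f"
        using le power2_diff[of R t] zero_le_power2[of t] by linarith
      then have f: "0 \<le> f" using R by (simp add: zero_le_mult_iff)
      have fw: "?g * indicator ?S y \<le> f * w"
      proof (cases "y \<in> ?S")
        case True
        then have v: "norm (y - x) \<le> z" and nl: "h * z < \<bar>n \<bullet> (y - x)\<bar>"
          by (auto simp: dist_norm norm_minus_commute)
        then have v2: "(norm (y - x))\<^sup>2 \<le> z\<^sup>2" by (intro power_mono) auto
        have q: "(norm (y - x))\<^sup>2 / (2 * R) \<le> h / 2 * z"
        proof -
          have "z\<^sup>2 \<le> z * (h * R)" using z mult_left_mono[of z "h * R" z] by (simp add: power2_eq_square)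
          then have "(norm (y - x))\<^sup>2 \<le> z * (h * R)" using v2 by linarith
          then show ?thesis using R by (simp add: field_simps)
        qed
        have q0: "0 \<le> (norm (y - x))\<^sup>2 / (2 * R)" using R by simp
        \<comment> \<open>Both corrections are at most \<open>h / 2 * z\<close>, so a point more
          than \<open>h * z\<close> below the tangent plane would have \<open>f < 0\<close>. Points
          of \<open>?S\<close> therefore lie above it.\<close>
        have "h * z \<le> f"
        proof (cases "0 \<le> n \<bullet> (y - x)")
          case True
          then show ?thesis using nl q0 t(1) unfolding f_def by linarith
        next
          case False
          then show ?thesis using nl q t(2) f unfolding f_def by linarith
        qed
        moreover have "gap_const c * z powr (- (2 * c)) \<le> w"
          unfolding w_def using v2 z c_pos by (intro poisson_power_diff_lower) auto
        ultimately have "(h * z) * (gap_const c * z powr (- (2 * c))) \<le> f * w"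
          using h z g f by (intro mult_mono) auto
        also have "(h * z) * (gap_const c * z powr (- (2 * c))) = h * gap_const c * (z * z powr (- (2 * c)))"
          by (simp only: mult_ac)
        also have "z * z powr (- (2 * c)) = z powr (- s)"
          using z by (simp add: powr_mult_base two_c)
        finally show ?thesis using True by simp
      qed (use f w in auto)
      have "(norm (y - x))\<^sup>2 * w \<le> c * 4 powr c * z\<^sup>2 * ?Y y"
        unfolding w_def using z c_pos by (intro poisson_power_diff_upper) auto
      then have "(norm (y - x))\<^sup>2 * w / (2 * R) \<le> c * 4 powr c * z\<^sup>2 * ?Y y / (2 * R)"
        using R by (intro divide_right_mono) auto
      moreover have "t * w \<le> t * ?X y" using w t by (intro mult_left_mono) auto
      moreover have "f * w = (n \<bullet> (y - x)) * w + (norm (y - x))\<^sup>2 * w / (2 * R) + t * w"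
        by (simp add: f_def algebra_simps)
      ultimately show ?thesis using fw False unfolding l by simp
    qed
  qed
  have iX: "integrable \<mu> ?X" and iY: "integrable \<mu> ?Y" using integrable_poisson_power z z2 by auto
  have iS: "integrable \<mu> (indicator ?S :: 'a \<Rightarrow> real)" "integrable \<mu> (indicator ?H :: 'a \<Rightarrow> real)"
    by (auto intro!: integrable_real_indicator simp: emeasure_eq_measure)
  have int: "integrable \<mu> ?rhs"
    using iX iY iS by (intro Bochner_Integration.integrable_diff integrable_mult_right) auto
  have "?g * measure \<mu> ?S - ?K * integral\<^sup>L \<mu> ?Y - t * integral\<^sup>L \<mu> ?X - ?M * measure \<mu> ?H = integral\<^sup>L \<mu> ?rhs"
    using iX iY iS by simp
  also have "\<dots> \<le> integral\<^sup>L \<mu> ?lhs"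
    using integrable_truncated_field[OF n z2] integrable_truncated_field[OF n z(1)]
    by (intro integral_mono int point Bochner_Integration.integrable_diff) auto
  also have "\<dots> = truncated_field n x (z / 2) - truncated_field n x z"
    unfolding truncated_field_def
    using integrable_truncated_field[OF n z2] integrable_truncated_field[OF n z(1)]
    by (intro Bochner_Integration.integral_diff) auto
  finally have main: "?g * measure \<mu> ?S - ?K * integral\<^sup>L \<mu> ?Y - t * integral\<^sup>L \<mu> ?X - ?M * measure \<mu> ?H
      \<le> truncated_field n x (z / 2) - truncated_field n x z" .
  have zs: "0 < z powr s" using z by simp
  \<comment> \<open>Of the mass \<open>\<delta> * z powr s\<close>, the slab and the light hole take
    at most a quarter each.\<close>
  have S: "\<delta> / 2 * z powr s \<le> measure \<mu> ?S"
  proof -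
    have "measure \<mu> (ball x z) \<le> measure \<mu> (?S \<union> (?H \<union> ?L))" by (rule finite_measure_mono) auto
    also have "\<dots> \<le> measure \<mu> ?S + measure \<mu> (?H \<union> ?L)" by (rule measure_Un_le) auto
    also have "measure \<mu> (?H \<union> ?L) \<le> measure \<mu> ?H + measure \<mu> ?L" by (rule measure_Un_le) auto
    finally have "measure \<mu> (ball x z) \<le> measure \<mu> ?S + (measure \<mu> ?H + measure \<mu> ?L)" by simp
    moreover have "measure \<mu> ?L \<le> \<delta> / 4 * z powr s"
      by (rule order_trans[OF slab_mass_le[OF n h z(1)] mult_right_mono[OF slab]]) simp
    moreover have "measure \<mu> ?H \<le> \<delta> / 4 * z powr s"
    proof -
      have "hole_const * h \<le> 1 / 4 * 1" using h hole_const_pos hole_const_le by (intro mult_mono) auto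
      then have "hole_const * h * (\<delta> * z powr s) \<le> 1 / 4 * (\<delta> * z powr s)" using \<delta> by (intro mult_right_mono) auto
      then show ?thesis using hole by simp
    qed
    ultimately show ?thesis using dense by (simp add: algebra_simps)
  qed
  have cancel: "z powr (- s) * z powr s = 1" using z by (simp add: powr_minus)
  have "h * gap_const c * \<delta> / 2 = ?g * (\<delta> / 2 * z powr s)" using cancel by (simp add: mult_ac)
  also have "\<dots> \<le> ?g * measure \<mu> ?S" using S K by (intro mult_left_mono) auto
  finally have 1: "h * gap_const c * \<delta> / 2 \<le> ?g * measure \<mu> ?S" .
  have "?K * integral\<^sup>L \<mu> ?Y \<le> ?K * (C / z)" using normal_bound[OF z(1), of x] K by (intro mult_left_mono) (auto simp: c_def)
  also have "\<dots> = c * 4 powr c * C * z / (2 * R)" using z by (simp add: power2_eq_square)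
  finally have 2: "?K * integral\<^sup>L \<mu> ?Y \<le> c * 4 powr c * C * z / (2 * R)" .
  have "t * integral\<^sup>L \<mu> ?X \<le> t * (C / (z / 2))" using normal_bound[OF z2, of x] t by (intro mult_left_mono) (auto simp: c_def)
  then have 3: "t * integral\<^sup>L \<mu> ?X \<le> 2 * C * t / z" by (simp add: mult_ac)
  have "?M * measure \<mu> ?H \<le> ?M * (hole_const * h * \<delta> * z powr s)" using hole K by (intro mult_left_mono) auto
  also have "\<dots> = 2 powr s * hole_const * (h * \<delta>)" using z by (simp add: powr_divide field_simps)
  \<comment> \<open>The second bound on \<open>hole_const\<close> cancels the size
    \<open>(2 / z) powr s\<close> of the kernel at height \<open>z / 2\<close>; half of the gain is
    left.\<close>
  also have "\<dots> \<le> gap_const c / 4 * (h * \<delta>)"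
  proof (rule mult_right_mono)
    have "2 powr s * hole_const \<le> 2 powr s * (gap_const c / 2 powr (s + 2))"
      by (intro mult_left_mono hole_const_le) simp
    also have "\<dots> = gap_const c / 4" by (simp add: powr_add)
    finally show "2 powr s * hole_const \<le> gap_const c / 4" .
  qed (use h \<delta> in auto)
  finally have 4: "?M * measure \<mu> ?H \<le> h * gap_const c * \<delta> / 4" by (simp add: mult_ac)
  show ?thesis using main 1 2 3 4 by linarith
qed

text \<open>The gains telescope over \<open>N\<close> dyadic scales, while the field is bounded at both ends.\<close>
lemma hole_mass_gt:
  assumes n: "norm n = 1" and R: "0 < R" and h: "0 < h" "h \<le> 1" and \<delta>: "0 < \<delta>"
    and dense: "\<And>z. h * R / 2 ^ N \<le> z \<Longrightarrow> z \<le> h * R \<Longrightarrow> \<delta> * z powr s \<le> measure \<mu> (ball x z)"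
    and slab: "5 / 2 * 4 ^ DIM('a) * G * h powr (s + 1 - DIM('a)) \<le> \<delta> / 4"
    and N: "scale_const < real N * (h * \<delta>)"
  shows "hole_const * h * \<delta> * (h * R / 2 ^ N) powr s
    < measure \<mu> (ball (x - R *\<^sub>R n) (R - h / 2 * (h * R / 2 ^ N)))"
proof (rule ccontr)
  assume not: "\<not> ?thesis"
  let ?z = "\<lambda>j::nat. h * R / 2 ^ j" and ?F = "truncated_field n x"
  \<comment> \<open>Tied to the smallest scale, so that the shrinking is admissible at all scales at
    once.\<close>
  let ?t = "h / 2 * ?z N"
  have z: "0 < ?z j" for j using h R by simp
  have tz: "?t / ?z j = h / 2 * (1 / 2) ^ (N - j)" if "j \<le> N" for j
    using that h R by (simp add: power_diff power_divide field_simps)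
  have gain: "h * gap_const c * \<delta> / 4 - c * 4 powr c * C * ?z j / (2 * R) - 2 * C * ?t / ?z j \<le> ?F (?z (Suc j)) - ?F (?z j)"
    if j: "j < N" for j
  proof -
    have le: "?z N \<le> ?z j" using j h R by (intro divide_left_mono power_increasing) auto
    have le': "?z j \<le> h * R" using h R divide_left_mono[of 1 "2 ^ j" "h * R"] by simp
    have "h * R \<le> R" using h R by simp
    then have tR: "?t \<le> R"
      using le le' h z[of N] mult_mono[of "h / 2" 1 "?z N" R] by simp
    have "measure \<mu> (ball (x - R *\<^sub>R n) (R - ?t)) \<le> hole_const * h * \<delta> * ?z N powr s" using not by simp
    also have "\<dots> \<le> hole_const * h * \<delta> * ?z j powr s"
      using le z[of N] s_pos hole_const_pos h \<delta> by (intro mult_left_mono powr_mono2) auto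
    finally have hole: "measure \<mu> (ball (x - R *\<^sub>R n) (R - ?t)) \<le> hole_const * h * \<delta> * ?z j powr s" .
    have t0: "0 \<le> ?t" using h R by simp
    have tj: "?t \<le> h / 2 * ?z j" using le h by (intro mult_left_mono) auto
    note field_gain[OF n R h \<delta> z[of j] le' t0 tj tR dense[OF le le'] slab hole]
    then show ?thesis by (simp add: mult.commute)
  qed
  have g: "0 < gap_const c" by (rule gap_const_pos[OF c_pos])
  \<comment> \<open>Curvature errors decay towards fine scales and are summed here; errors from the
    shrinking decay towards coarse scales and are summed in \<open>geo'\<close>.\<close>
  have geo: "(\<Sum>j<N. (1 / 2 :: real) ^ j) \<le> 2"
    by (simp add: geometric_sum)
  have geo': "(\<Sum>j<N. (1 / 2 :: real) ^ (N - j)) \<le> 1"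
  proof -
    have "(\<Sum>j<N. (1 / 2 :: real) ^ (N - j)) = (\<Sum>j<N. (1 / 2) ^ Suc j)"
      by (rule sum.reindex_bij_witness[of _ "\<lambda>j. N - Suc j" "\<lambda>j. N - Suc j"]) (auto simp: Suc_diff_Suc)
    also have "\<dots> = 1 / 2 * (\<Sum>j<N. (1 / 2) ^ j)" by (simp add: sum_distrib_left)
    finally show ?thesis using geo by simp
  qed
  have "real N * (h * gap_const c * \<delta> / 4) - c * 4 powr c * C * h - C * h
    \<le> (\<Sum>j<N. h * gap_const c * \<delta> / 4 - c * 4 powr c * C * ?z j / (2 * R) - 2 * C * ?t / ?z j)"
  proof -
    have "(\<Sum>j<N. c * 4 powr c * C * ?z j / (2 * R)) = (c * 4 powr c * C * h / 2) * (\<Sum>j<N. (1 / 2) ^ j)"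
      unfolding sum_distrib_left using R by (intro sum.cong) (auto simp: power_divide)
    also have "\<dots> \<le> (c * 4 powr c * C * h / 2) * 2"
      using c_pos C_pos h by (intro mult_left_mono geo) auto
    finally have 1: "(\<Sum>j<N. c * 4 powr c * C * ?z j / (2 * R)) \<le> c * 4 powr c * C * h" by simp
    have "(\<Sum>j<N. 2 * C * ?t / ?z j) = (\<Sum>j<N. C * h * (1 / 2) ^ (N - j))"
    proof (rule sum.cong[OF refl])
      fix j assume j: "j \<in> {..<N}"
      have "2 * C * ?t / ?z j = 2 * C * (?t / ?z j)" by (rule times_divide_eq_right[symmetric])
      also have "?t / ?z j = h / 2 * (1 / 2) ^ (N - j)" using j by (intro tz) simp
      finally show "2 * C * ?t / ?z j = C * h * (1 / 2) ^ (N - j)" by simp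
    qed
    also have "\<dots> = C * h * (\<Sum>j<N. (1 / 2) ^ (N - j))" by (simp add: sum_distrib_left)
    also have "\<dots> \<le> C * h * 1" using C_pos h by (intro mult_left_mono geo') auto
    finally show ?thesis using 1 by (simp add: sum_subtractf)
  qed
  also have "\<dots> \<le> (\<Sum>j<N. ?F (?z (Suc j)) - ?F (?z j))" by (intro sum_mono gain) auto
  also have "\<dots> = ?F (?z N) - ?F (?z 0)" by (rule sum_lessThan_telescope)
  also have "\<dots> \<le> 2 * C"
    using field_bound[OF z[of N] n, of x] field_bound[OF z[of 0] n, of x]
    by (simp add: truncated_field_def c_def abs_le_iff)
  finally have "real N * (h * gap_const c * \<delta> / 4) \<le> (c * 4 powr c + 1) * C * h + 2 * C" by (simp add: algebra_simps)
  also have "\<dots> \<le> (c * 4 powr c + 1) * C * 1 + 2 * C"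
    using h C_pos c_pos by (intro add_mono mult_left_mono) auto
  also have "\<dots> \<le> (c * 4 powr c + 4) * C" using C_pos by (simp add: algebra_simps)
  finally have "real N * (h * \<delta>) \<le> scale_const" using g by (simp add: scale_const_def field_simps)
  then show False using N by simp
qed

end

section \<open>Neighbourhoods of the dense set and their decay\<close>

definition nbhd :: "'a::metric_space set \<Rightarrow> real \<Rightarrow> 'a set" where
  "nbhd E r = (\<Union>e\<in>E. ball e r)"

lemma nbhd_borel [measurable]: "nbhd E r \<in> sets borel"
  unfolding nbhd_def by (intro borel_open open_UN) auto

lemma nbhd_mono: "r \<le> r' \<Longrightarrow> nbhd E r \<subseteq> nbhd E r'"
  by (auto simp: nbhd_def)

text \<open>The parameters of the argument at density \<open>\<delta>\<close>: relative hole radius \<open>\<eta>\<close>, slab thickness \<open>h\<close>, number \<open>N\<close>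
  of scales, and ratio \<open>2\<^sup>-\<^sup>m\<close> of consecutive neighbourhoods.\<close>
locale hole_parameters = poisson_bounded_measure \<mu> s C for \<mu> :: "'a::euclidean_space measure" and s C :: real +
  fixes \<delta> \<eta> h :: real and N m :: nat
  assumes \<delta>: "0 < \<delta>" and \<eta>: "0 < \<eta>" "\<eta> \<le> 1 / 4" and h: "0 < h" "h \<le> 1"
    and \<eta>_small: "4 ^ DIM('a) * G * \<eta> powr (DIM('a) - s) < \<delta>"
    and h_small: "5 / 2 * 4 ^ DIM('a) * G * h powr (s + 1 - DIM('a)) \<le> \<delta> / 4"
    and N_large: "scale_const < real N * (h * \<delta>)"
    and m_large: "1 / 2 ^ m \<le> h\<^sup>2 * \<eta> / 2 ^ Suc N"
begin

text \<open>The bound of \<open>hole_mass_gt\<close> for the smallest possible hole radius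
  \<open>R = \<eta> * \<rho>\<close>, divided by \<open>\<rho> powr s\<close>.\<close>

definition \<kappa> :: real where "\<kappa> = hole_const * h * \<delta> * (h * \<eta> / 2 ^ N) powr s"

lemma \<kappa>_pos: "0 < \<kappa>"
  using hole_const_pos h \<eta> \<delta> by (simp add: \<kappa>_def)

text \<open>Density is assumed on the closure because the argument runs at the nearest point, which
  need not lie in \<open>E\<close>. The centre is within \<open>\<rho> / 2\<close> of
  \<open>a\<close> and \<open>R < \<rho> / 2\<close>, so the hole stays in
  \<open>ball a \<rho>\<close>.\<close>

lemma hole:
  assumes dense: "\<And>x r. x \<in> closure E \<Longrightarrow> l \<le> r \<Longrightarrow> r \<le> L \<Longrightarrow> \<delta> * r powr s \<le> measure \<mu> (ball x r)"
    and a: "a \<in> E" and \<rho>: "0 < \<rho>" "l \<le> \<rho> / 2 ^ m" "\<rho> \<le> L"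
  shows "\<kappa> * \<rho> powr s \<le> measure \<mu> (ball a \<rho> - nbhd E (\<rho> / 2 ^ m))"
proof -
  have frac: "h\<^sup>2 * \<eta> / 2 ^ Suc N \<le> \<eta>" "h\<^sup>2 * \<eta> / 2 ^ Suc N \<le> h * \<eta> / 2 ^ N"
  proof -
    have "h\<^sup>2 * \<eta> / 2 ^ Suc N = (h / 2) * (h * \<eta> / 2 ^ N)" by (simp add: power2_eq_square)
    also have "\<dots> \<le> 1 * (h * \<eta> / 2 ^ N)" using h \<eta> by (intro mult_right_mono) auto
    finally show 1: "h\<^sup>2 * \<eta> / 2 ^ Suc N \<le> h * \<eta> / 2 ^ N" by simp
    also have "\<dots> \<le> h * \<eta> / 1" using h \<eta> by (intro divide_left_mono) auto
    also have "\<dots> \<le> 1 * \<eta>" using h \<eta> by (simp add: mult_right_mono)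
    finally show "h\<^sup>2 * \<eta> / 2 ^ Suc N \<le> \<eta>" by simp
  qed
  have \<tau>: "\<rho> / 2 ^ m \<le> \<rho> * (h\<^sup>2 * \<eta> / 2 ^ Suc N)" using mult_left_mono[OF m_large, of \<rho>] \<rho> by simp
  have "\<rho> * (h\<^sup>2 * \<eta> / 2 ^ Suc N) \<le> \<rho> * \<eta>" using frac \<rho> by (intro mult_left_mono) auto
  then have l\<eta>: "l \<le> \<eta> * \<rho>" using \<tau> \<rho> by (simp add: mult.commute)
  have "\<eta> * \<rho> \<le> 1 * \<rho>" using \<eta> \<rho> by (intro mult_right_mono) auto
  then have \<eta>L: "\<eta> * \<rho> \<le> L" using \<rho> by linarith
  obtain z where z: "z \<in> ball a (\<rho> / 2)" and far: "\<And>e. e \<in> closure E \<Longrightarrow> \<eta> * \<rho> \<le> dist z e"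
    by (rule porosity[of "closure E" \<delta> \<eta> \<rho> a]) (use dense[OF _ l\<eta> \<eta>L] \<rho> \<eta> \<eta>_small in auto)
  have a': "a \<in> closure E" using a closure_subset by blast
  have "\<exists>x\<in>closure E. \<forall>e\<in>closure E. dist z x \<le> dist z e"
    by (rule distance_attains_inf[of "closure E" z]) (use a' in auto)
  then obtain x where x: "x \<in> closure E" "\<And>e. e \<in> closure E \<Longrightarrow> dist z x \<le> dist z e"
    by blast
  define R where "R = dist z x"
  have R: "\<eta> * \<rho> \<le> R" "R < \<rho> / 2" using far[OF x(1)] x(2)[OF a'] z by (auto simp: R_def dist_commute)
  then have R0: "0 < R" using \<eta> \<rho> by (smt (verit) mult_pos_pos)
  define n where "n = (1 / R) *\<^sub>R (x - z)"
  have n: "norm n = 1" using R0 by (simp add: n_def R_def dist_norm norm_minus_commute)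
  have zx: "x - R *\<^sub>R n = z" using R0 by (simp add: n_def)
  have "\<rho> * (h * \<eta> / 2 ^ N) = h * (\<eta> * \<rho>) / 2 ^ N" by simp
  also have "\<dots> \<le> h * R / 2 ^ N" using R h by (intro divide_right_mono mult_left_mono) auto
  finally have zN: "\<rho> * (h * \<eta> / 2 ^ N) \<le> h * R / 2 ^ N" .
  have lz: "l \<le> h * R / 2 ^ N"
  proof -
    have "\<rho> * (h\<^sup>2 * \<eta> / 2 ^ Suc N) \<le> \<rho> * (h * \<eta> / 2 ^ N)" using frac \<rho> by (intro mult_left_mono) auto
    then show ?thesis using \<tau> \<rho> zN by linarith
  qed
  have hR: "h * R \<le> R" using h R0 by simp
  let ?t = "h / 2 * (h * R / 2 ^ N)"
  \<comment> \<open>This is what \<open>m_large\<close> is for: after shrinking by \<open>?t\<close>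
    the ball avoids the whole \<open>\<rho> / 2 ^ m\<close>-neighbourhood of \<open>E\<close>, not
    only \<open>E\<close>.\<close>
  have t: "\<rho> / 2 ^ m \<le> ?t"
  proof -
    have "\<rho> * (h\<^sup>2 * \<eta> / 2 ^ Suc N) = h / 2 * (\<rho> * (h * \<eta> / 2 ^ N))" by (simp add: power2_eq_square)
    also have "\<dots> \<le> ?t" using zN h by (intro mult_left_mono) auto
    finally show ?thesis using \<tau> by linarith
  qed
  have "hole_const * h * \<delta> * (h * R / 2 ^ N) powr s < measure \<mu> (ball (x - R *\<^sub>R n) (R - ?t))"
  proof (rule hole_mass_gt[OF n R0 h \<delta> _ h_small N_large])
    fix w assume w: "h * R / 2 ^ N \<le> w" "w \<le> h * R"
    show "\<delta> * w powr s \<le> measure \<mu> (ball x w)"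
      using w lz hR R \<rho> by (intro dense x) auto
  qed
  also have "ball (x - R *\<^sub>R n) (R - ?t) \<subseteq> ball a \<rho> - nbhd E (\<rho> / 2 ^ m)"
  proof
    fix y assume "y \<in> ball (x - R *\<^sub>R n) (R - ?t)"
    then have y: "dist z y < R - ?t" by (simp add: zx)
    have "0 \<le> ?t" using h R0 by simp
    then have "dist a y < \<rho>" using y z R dist_triangle[of a y z] by simp
    moreover have "\<rho> / 2 ^ m \<le> dist e y" if "e \<in> E" for e
    proof -
      have "e \<in> closure E" using that closure_subset by blast
      then have "R \<le> dist z e" unfolding R_def by (rule x)
      then show ?thesis using dist_triangle[of z e y] y t by (simp add: dist_commute)
    qed
    ultimately show "y \<in> ball a \<rho> - nbhd E (\<rho> / 2 ^ m)" by (auto simp: nbhd_def not_less)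
  qed
  then have "measure \<mu> (ball (x - R *\<^sub>R n) (R - ?t)) \<le> measure \<mu> (ball a \<rho> - nbhd E (\<rho> / 2 ^ m))"
    by (rule finite_measure_mono) auto
  finally have "hole_const * h * \<delta> * (h * R / 2 ^ N) powr s < measure \<mu> (ball a \<rho> - nbhd E (\<rho> / 2 ^ m))" .
  moreover have "\<kappa> * \<rho> powr s \<le> hole_const * h * \<delta> * (h * R / 2 ^ N) powr s"
  proof -
    have "\<kappa> * \<rho> powr s = hole_const * h * \<delta> * (\<rho> * (h * \<eta> / 2 ^ N)) powr s"
      unfolding \<kappa>_def by (simp only: powr_mult mult_ac)
    also have "\<dots> \<le> hole_const * h * \<delta> * (h * R / 2 ^ N) powr s"
      using zN \<rho> h \<eta> \<delta> hole_const_pos s_pos by (intro mult_left_mono powr_mono2) auto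
    finally show ?thesis .
  qed
  ultimately show ?thesis by linarith
qed

text \<open>A hole of mass at least \<open>\<kappa> * \<rho> powr s\<close> against a covering ball
  of mass at most \<open>G * (3 * \<rho>) powr s\<close>.\<close>

definition \<theta> :: real where "\<theta> = \<kappa> / (G * 3 powr s)"

lemma \<theta>_pos: "0 < \<theta>" using \<kappa>_pos G_ge_1 by (simp add: \<theta>_def)

text \<open>Every ball of a maximal separated family loses a fixed share of its mass to its hole.\<close>
lemma nbhd_decay:
  assumes dense: "\<And>x r. x \<in> closure E \<Longrightarrow> l \<le> r \<Longrightarrow> r \<le> L \<Longrightarrow> \<delta> * r powr s \<le> measure \<mu> (ball x r)"
    and \<rho>: "0 < \<rho>" "l \<le> \<rho> / 2 ^ m" "\<rho> \<le> L"
  shows "measure \<mu> (nbhd E (\<rho> / 2 ^ m)) \<le> (1 - \<theta>) * measure \<mu> (nbhd E \<rho>)"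
proof -
  let ?U = "nbhd E \<rho>" and ?V = "nbhd E (\<rho> / 2 ^ m)"
  have "\<rho> / 2 ^ m \<le> \<rho>" using \<rho>(1) by (simp add: divide_le_eq)
  then have VU: "?V \<subseteq> ?U" by (rule nbhd_mono)
  have diff: "measure \<mu> (?U - ?V) = measure \<mu> ?U - measure \<mu> ?V"
    by (rule finite_measure_Diff[OF _ _ VU]) auto
  \<comment> \<open>Separation \<open>2 * \<rho>\<close> makes the \<open>\<rho>\<close>-balls
    disjoint; by maximality the \<open>3 * \<rho>\<close>-balls cover \<open>?U\<close>.\<close>
  define sep where "sep A \<longleftrightarrow> finite A \<and> A \<subseteq> E \<and> (\<forall>a\<in>A. \<forall>b\<in>A. a \<noteq> b \<longrightarrow> 2 * \<rho> \<le> dist a b)" for A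
  have k\<rho>: "0 < \<kappa> * \<rho> powr s" using \<kappa>_pos \<rho> by simp
  have card: "card A * (\<kappa> * \<rho> powr s) \<le> measure \<mu> (?U - ?V)" if A: "sep A" for A
  proof -
    have "card A * (\<kappa> * \<rho> powr s) = (\<Sum>a\<in>A. \<kappa> * \<rho> powr s)" by simp
    also have "\<dots> \<le> (\<Sum>a\<in>A. measure \<mu> (ball a \<rho> - ?V))"
      using A by (intro sum_mono hole[OF dense _ \<rho>]) (auto simp: sep_def)
    also have "\<dots> = measure \<mu> (\<Union>a\<in>A. ball a \<rho> - ?V)"
    proof (rule measure_UNION'[symmetric])
      show "pairwise (\<lambda>a b. disjnt (ball a \<rho> - ?V) (ball b \<rho> - ?V)) A"
      proof (rule pairwiseI)
        fix a b assume "a \<in> A" "b \<in> A" "a \<noteq> b"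
        then have "2 * \<rho> \<le> dist a b" using A by (auto simp: sep_def)
        then have "ball a \<rho> \<inter> ball b \<rho> = {}" by (intro disjoint_ballI) simp
        then show "disjnt (ball a \<rho> - ?V) (ball b \<rho> - ?V)" by (auto simp: disjnt_def)
      qed
    qed (use A in \<open>auto simp: sep_def fmeasurable_eq_sets\<close>)
    also have "\<dots> \<le> measure \<mu> (?U - ?V)"
    proof (rule finite_measure_mono)
      show "(\<Union>a\<in>A. ball a \<rho> - ?V) \<subseteq> ?U - ?V" using A by (auto simp: sep_def nbhd_def)
    qed measurable
    finally show ?thesis .
  qed
  have "sep {}" by (simp add: sep_def)
  \<comment> \<open>Each member owns mass at least \<open>\<kappa> * \<rho> powr s\<close> of the
    finite difference \<open>?U - ?V\<close>; this bounds the cardinality without boundedness of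
    \<open>E\<close> and provides a maximal family.\<close>
  moreover have "\<forall>A. sep A \<longrightarrow> card A \<le> nat \<lceil>measure \<mu> (?U - ?V) / (\<kappa> * \<rho> powr s)\<rceil>"
  proof safe
    fix A assume "sep A"
    then have "real (card A) \<le> measure \<mu> (?U - ?V) / (\<kappa> * \<rho> powr s)"
      using card k\<rho> by (simp add: pos_le_divide_eq)
    then show "card A \<le> nat \<lceil>measure \<mu> (?U - ?V) / (\<kappa> * \<rho> powr s)\<rceil>" by linarith
  qed
  ultimately obtain A where A: "sep A" and max: "\<And>B. sep B \<Longrightarrow> card B \<le> card A"
    using ex_has_greatest_nat[of sep "{}" card] by (metis less_Suc_eq_le)
  have cover: "?U \<subseteq> (\<Union>a\<in>A. ball a (3 * \<rho>))"
  proof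
    fix y assume "y \<in> ?U"
    then obtain e where e: "e \<in> E" "dist e y < \<rho>" by (auto simp: nbhd_def)
    have "\<exists>a\<in>A. dist a e < 2 * \<rho>"
    proof (rule ccontr)
      assume "\<not> ?thesis"
      then have far: "\<And>a. a \<in> A \<Longrightarrow> 2 * \<rho> \<le> dist a e" by force
      then have "e \<notin> A" using \<rho>(1) by force
      moreover have "sep (insert e A)" using A e(1) far by (auto simp: sep_def dist_commute)
      ultimately show False using max[of "insert e A"] A by (simp add: sep_def)
    qed
    then obtain a where a: "a \<in> A" "dist a e < 2 * \<rho>" by blast
    then have "dist a y < 3 * \<rho>" using e dist_triangle[of a y e] by linarith
    then show "y \<in> (\<Union>a\<in>A. ball a (3 * \<rho>))" using a by auto
  qed
  have fin: "finite A" using A by (simp add: sep_def)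
  have "measure \<mu> ?U \<le> measure \<mu> (\<Union>a\<in>A. ball a (3 * \<rho>))"
    using fin by (intro finite_measure_mono[OF cover]) auto
  also have "\<dots> \<le> (\<Sum>a\<in>A. measure \<mu> (ball a (3 * \<rho>)))" by (rule measure_UNION_le[OF fin]) auto
  also have "\<dots> \<le> (\<Sum>a\<in>A. G * (3 * \<rho>) powr s)" using \<rho> by (intro sum_mono growth) auto
  also have "\<dots> = card A * (G * (3 * \<rho>) powr s)" by simp
  finally have "\<theta> * measure \<mu> ?U \<le> \<theta> * (card A * (G * (3 * \<rho>) powr s))"
    using \<theta>_pos by (intro mult_left_mono) auto
  also have "\<dots> = card A * (\<kappa> * \<rho> powr s)" using G_ge_1 by (simp add: \<theta>_def powr_mult)
  also have "\<dots> \<le> measure \<mu> ?U - measure \<mu> ?V" using card[OF A] diff by simp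
  finally show ?thesis by (simp add: algebra_simps)
qed

lemma m_pos: "0 < m"
proof (rule ccontr)
  assume "\<not> 0 < m"
  then have "1 \<le> h\<^sup>2 * \<eta> / 2 ^ Suc N" using m_large by simp
  also have "\<dots> \<le> 1 * (1 / 4) / 1"
    using h \<eta> by (intro frac_le mult_mono) (auto simp: power_le_one one_le_power[of 2 "Suc N", simplified])
  finally show False by simp
qed

text \<open>The decay is iterated in the linear form
  \<open>u j * (1 + \<theta>' * j) \<le> M\<close>, stable because \<open>(1 - \<theta>') * (1 +
  \<theta>' * (j + 1)) \<le> 1 + \<theta>' * j\<close>. This matches the factor
  \<open>1 / q\<close>, since about \<open>q / m\<close> steps are available.\<close>

lemma measure_dense_le:
  assumes dense: "\<And>x r. x \<in> closure E \<Longrightarrow> 4 * L / 2 ^ q \<le> r \<Longrightarrow> r \<le> L \<Longrightarrow> \<delta> * r powr s \<le> measure \<mu> (ball x r)"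
    and L: "0 < L" and q: "1 \<le> q" and sub: "nbhd E L \<subseteq> B" and B: "B \<in> sets borel"
  shows "measure \<mu> E \<le> 1 / real q * (4 * m / min 1 \<theta>) * measure \<mu> B"
proof -
  define M where "M = measure \<mu> B"
  define \<theta>' where "\<theta>' = min 1 \<theta>"
  have \<theta>': "0 < \<theta>'" "\<theta>' \<le> 1" "\<theta>' \<le> \<theta>" using \<theta>_pos by (auto simp: \<theta>'_def)
  have M0: "0 \<le> M" by (simp add: M_def)
  have E_sub: "E \<subseteq> nbhd E (L / 2 ^ k)" for k using L by (auto simp: nbhd_def)
  have small: "measure \<mu> E \<le> M"
    unfolding M_def using E_sub[of 0] sub B by (intro finite_measure_mono) auto
  have m1: "1 \<le> real m" using m_pos by simp
  show ?thesis
  proof (cases "q \<le> 4")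
    case True
    \<comment> \<open>For \<open>q \<le> 4\<close> the claimed factor is at least 1 and monotonicity
      suffices.\<close>
    have "1 \<le> 1 / real q * (4 * m / \<theta>')"
    proof -
      have "real q * \<theta>' \<le> 4 * 1" using True \<theta>' by (intro mult_mono) auto
      also have "\<dots> \<le> 4 * real m" using m1 by simp
      finally show ?thesis using q \<theta>' by (simp add: field_simps)
    qed
    then have "1 * M \<le> 1 / real q * (4 * m / \<theta>') * M" using M0 by (rule mult_right_mono)
    then show ?thesis using small by (simp add: M_def \<theta>'_def)
  next
    case False
    have step: "measure \<mu> (nbhd E (L / 2 ^ (m * j))) * (1 + \<theta>' * j) \<le> M" if "m * j + 2 \<le> q" for j
      using that
    proof (induction j)
      case 0
      then show ?case unfolding M_def using sub B by (auto intro: finite_measure_mono)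
    next
      case (Suc j)
      let ?u = "measure \<mu> (nbhd E (L / 2 ^ (m * j)))" and ?v = "measure \<mu> (nbhd E (L / 2 ^ (m * Suc j)))"
      have e: "L / 2 ^ (m * Suc j) = (L / 2 ^ (m * j)) / 2 ^ m" by (simp add: power_add)
      have "4 * L / 2 ^ q \<le> L / 2 ^ (m * Suc j)"
      proof -
        have "(4::real) * 2 ^ (m * Suc j) = 2 ^ (m * Suc j + 2)" by (simp add: power_add)
        also have "\<dots> \<le> 2 ^ q" using Suc.prems by (intro power_increasing) auto
        finally show ?thesis using L by (simp add: field_simps)
      qed
      moreover have "L / 2 ^ (m * j) \<le> L" using L by (simp add: divide_le_eq)
      ultimately have v: "?v \<le> (1 - \<theta>) * ?u"
        unfolding e using L by (intro nbhd_decay[OF dense]) auto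
      also have "\<dots> \<le> (1 - \<theta>') * ?u" using \<theta>' by (intro mult_right_mono) auto
      finally have "?v * (1 + \<theta>' * Suc j) \<le> (1 - \<theta>') * ?u * (1 + \<theta>' * Suc j)"
        using \<theta>' by (intro mult_right_mono) auto
      also have "\<dots> = ?u * ((1 - \<theta>') * (1 + \<theta>' * Suc j))" by simp
      also have "\<dots> \<le> ?u * (1 + \<theta>' * j)"
      proof (rule mult_left_mono)
        have "(1 - \<theta>') * (1 + \<theta>' * Suc j) = 1 + \<theta>' * j - \<theta>' * \<theta>' * Suc j" by (simp add: algebra_simps)
        then show "(1 - \<theta>') * (1 + \<theta>' * Suc j) \<le> 1 + \<theta>' * j" using \<theta>' by simp
      qed simp
      also have "\<dots> \<le> M" using Suc by simp
      finally show ?case .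
    qed
    \<comment> \<open>The largest number of steps whose final radius \<open>L / 2 ^ (m * J)\<close>
      is still at least \<open>4 * L / 2 ^ q\<close>, the smallest radius with known
      density.\<close>
    define J where "J = (q - 2) div m"
    have "m * J \<le> q - 2" unfolding J_def by (rule times_div_less_eq_dividend)
    then have "m * J + 2 \<le> q" using False by linarith
    then have 1: "measure \<mu> (nbhd E (L / 2 ^ (m * J))) * (1 + \<theta>' * J) \<le> M" by (rule step)
    have "measure \<mu> E \<le> measure \<mu> (nbhd E (L / 2 ^ (m * J)))"
      by (rule finite_measure_mono[OF E_sub]) auto
    then have "measure \<mu> E * (1 + \<theta>' * J) \<le> measure \<mu> (nbhd E (L / 2 ^ (m * J))) * (1 + \<theta>' * J)"
      using \<theta>' by (intro mult_right_mono) auto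
    then have "measure \<mu> E * (1 + \<theta>' * J) \<le> M" using 1 by linarith
    then have 2: "measure \<mu> E * (1 + \<theta>' * J) * (4 * m) \<le> M * (4 * m)" by (rule mult_right_mono) simp
    have "real q * \<theta>' \<le> (1 + \<theta>' * J) * (4 * m)"
    proof -
      have "q - 2 < m * (J + 1)" using dividend_less_times_div[OF m_pos, of "q - 2"] by (simp add: J_def add.commute)
      then have "q \<le> 2 * (m * (J + 1))" using False by linarith
      then have "real q \<le> real (2 * (m * (J + 1)))" by (rule of_nat_mono)
      then have "real q \<le> 2 * (real m * (real J + 1))" by (simp add: algebra_simps)
      then have "\<theta>' * real q \<le> \<theta>' * (2 * (real m * (real J + 1)))" using \<theta>' by (intro mult_left_mono) auto
      also have "\<dots> = 2 * m * (\<theta>' + \<theta>' * J)" by (simp add: algebra_simps)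
      also have "\<dots> \<le> 2 * m * (1 + \<theta>' * J)" using \<theta>' by (intro mult_left_mono) auto
      also have "\<dots> \<le> 4 * m * (1 + \<theta>' * J)" using \<theta>' by (intro mult_right_mono) auto
      finally show ?thesis by (simp add: mult_ac)
    qed
    then have "measure \<mu> E * (real q * \<theta>') \<le> measure \<mu> E * ((1 + \<theta>' * J) * (4 * m))"
      by (rule mult_left_mono) simp
    also have "\<dots> \<le> 4 * m * M" using 2 by (simp add: mult_ac)
    finally have "measure \<mu> E \<le> 4 * m * M / (real q * \<theta>')" using q \<theta>' by (simp add: pos_le_divide_eq)
    then show ?thesis by (simp add: M_def \<theta>'_def mult_ac)
  qed
qed

end

subsection \<open>Choice of parameters\<close>

lemma exp_neg_le_powr:
  fixes x Y a :: real
  assumes "0 < x" "exp (- Y) \<le> x" "0 \<le> a"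
  shows "exp (- (a * Y)) \<le> x powr a"
proof -
  have "exp (- (a * Y)) = exp (- Y) powr a" by (simp add: powr_def)
  also have "\<dots> \<le> x powr a" using assms by (intro powr_mono2) auto
  finally show ?thesis .
qed

text \<open>Every parameter is at least \<open>exp (- k X)\<close> with \<open>X = \<delta>\<^sup>-\<^sup>\<beta>\<close>; the exponent \<open>\<beta>\<close> comes from
  the number \<open>N\<close> of scales, which is of order \<open>1 / (h \<delta>)\<close>.\<close>
lemma hole_parameters_exist:
  fixes d :: nat and s G S H :: real
  assumes d: "1 \<le> d" and s: "0 < s" "real d - 1 < s" "s < real d" and G: "1 \<le> G" and H: "0 < H"
  obtains K \<beta> where "0 < K" "0 < \<beta>"
    "\<And>\<delta>. \<lbrakk>0 < \<delta>; \<delta> \<le> 1\<rbrakk> \<Longrightarrow> \<exists>\<eta> h N m. 0 < \<eta> \<and> \<eta> \<le> 1 / 4 \<and> 0 < h \<and> h \<le> 1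
      \<and> 4 ^ d * G * \<eta> powr (d - s) < \<delta> \<and> 5 / 2 * 4 ^ d * G * h powr (s + 1 - d) \<le> \<delta> / 4
      \<and> S < real N * (h * \<delta>) \<and> 1 / 2 ^ m \<le> h\<^sup>2 * \<eta> / 2 ^ Suc N
      \<and> 4 * m / min 1 (H * h * \<delta> * (h * \<eta> / 2 ^ N) powr s / (G * 3 powr s)) \<le> exp (K / \<delta> powr \<beta>)"
proof -
  \<comment> \<open>With \<open>e = \<delta> / A\<close>, the choices \<open>h = e powr a\<close>
    and \<open>\<eta> = e powr b\<close> turn both smallness conditions into
    \<open>4 ^ d * G * e = \<delta> / 10\<close>; the factor 10 in \<open>A\<close> makes the slab
    condition an equality.\<close>
  define a where "a = 1 / (s + 1 - d)"
  define b where "b = 1 / (d - s)"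
  define A where "A = 10 * 4 ^ d * G"
  define n where "n = \<bar>S\<bar> * A powr a + 2"
  define h0 where "h0 = G * 3 powr s / H"
  \<comment> \<open>Exponents of the lower bounds \<open>exp (- (T * X))\<close> for
    \<open>\<tau>\<close> and \<open>exp (- (t * X))\<close> for \<open>\<theta>\<close>, with one
    summand or group for each factor of these products.\<close>
  define T where "T = 2 * (a * A) + b * A + n + 1"
  define t where "t = h0 + a * A + 1 + s * (a * A + b * A + n)"
  have a: "1 \<le> a" "(s + 1 - d) * a = 1" and b: "1 \<le> b" "(d - s) * b = 1"
    using s by (auto simp: a_def b_def)
  have pow4: "(4::real) \<le> 4 ^ d" using d power_increasing[of 1 d "4::real"] by simp
  have A: "40 \<le> A" using mult_mono[OF pow4 G] by (simp add: A_def mult.commute)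
  have n: "2 \<le> n" by (simp add: n_def)
  have h0: "0 < h0" using G H by (simp add: h0_def)
  have T: "0 < T" using a b A n by (simp add: T_def add_pos_pos)
  have t: "0 < t" unfolding t_def using h0 a b A n s
    by (intro add_pos_nonneg add_pos_pos mult_nonneg_nonneg add_nonneg_nonneg) auto
  show thesis
  proof
    show "0 < 8 + T + t" using T t by simp
    show "0 < a + 1" using a by simp
  next
    fix \<delta> :: real assume \<delta>: "0 < \<delta>" "\<delta> \<le> 1"
    define X where "X = 1 / \<delta> powr (a + 1)"
    define e where "e = \<delta> / A"
    define h where "h = e powr a"
    define \<eta> where "\<eta> = e powr b"
    define N where "N = nat \<lceil>S / (h * \<delta>)\<rceil> + 1"
    define \<tau> where "\<tau> = h\<^sup>2 * \<eta> / 2 ^ Suc N"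
    \<comment> \<open>Crude but sufficient: \<open>m < 2 ^ m\<close> gives the required smallness,
      and \<open>1 / \<tau>\<close> is itself only exponential in \<open>X\<close>.\<close>
    define m where "m = nat \<lceil>1 / \<tau>\<rceil>"
    have "\<delta> powr (a + 1) \<le> \<delta> powr 1" using \<delta> a by (intro powr_mono') auto
    then have \<delta>X: "1 / \<delta> \<le> X" using \<delta> by (simp add: X_def frac_le)
    moreover have "1 \<le> 1 / \<delta>" using \<delta> by simp
    ultimately have X: "1 \<le> X" by linarith
    have e: "0 < e" "e \<le> 1 / 40" using \<delta> A by (auto simp: e_def intro!: frac_le[of 1 \<delta> 40 A, simplified])
    have h: "0 < h" "h \<le> 1" unfolding h_def using e a by (auto intro: powr_le1)
    have \<eta>: "0 < \<eta>" "\<eta> \<le> 1 / 4"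
    proof -
      have "\<eta> \<le> e powr 1" unfolding \<eta>_def using e b by (intro powr_mono') auto
      then show "\<eta> \<le> 1 / 4" using e by simp
    qed (use e in \<open>simp add: \<eta>_def\<close>)
    have \<eta>e: "\<eta> powr (d - s) = e" using e b by (simp add: \<eta>_def powr_powr mult.commute)
    have he: "h powr (s + 1 - d) = e" using e a by (simp add: h_def powr_powr mult.commute)
    have Ae: "4 ^ d * G * e = \<delta> / 10" using A G by (simp add: e_def A_def)
    have hd: "0 < h * \<delta>" using h \<delta> by simp
    have N1: "S / (h * \<delta>) < real N" by (simp add: N_def) linarith
    then have N2: "S < real N * (h * \<delta>)" using hd by (simp add: pos_divide_less_eq)
    have \<tau>: "0 < \<tau>" using h \<eta> by (simp add: \<tau>_def)
    have "h\<^sup>2 * \<eta> / 2 ^ Suc N \<le> 1 * 1 / 1"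
      using h \<eta> by (intro frac_le mult_mono power_le_one one_le_power) auto
    then have \<tau>1: "\<tau> \<le> 1" by (simp add: \<tau>_def)
    have m1: "1 / \<tau> \<le> real m" by (simp add: m_def) linarith
    have "real m < 2 ^ m" by (rule of_nat_less_two_power)
    then have "1 / \<tau> \<le> 2 ^ m" using m1 by linarith
    then have m2: "1 / 2 ^ m \<le> \<tau>" using \<tau> by (simp add: field_simps)
    have "0 \<le> 1 / \<tau>" using \<tau> by simp
    then have "real m \<le> 1 / \<tau> + 1" unfolding m_def by linarith
    moreover have "1 \<le> 1 / \<tau>" using \<tau> \<tau>1 by simp
    moreover have "2 / \<tau> = 1 / \<tau> + 1 / \<tau>" by simp
    ultimately have m3: "real m \<le> 2 / \<tau>" by linarith
    have expX: "exp (- (k * X)) \<le> x" if "1 / x \<le> k * X" "0 < x" for x k :: real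
    proof -
      have "1 / x \<le> exp (k * X)" using that(1) exp_ge_add_one_self[of "k * X"] by linarith
      then show ?thesis using that(2) by (simp add: exp_minus field_simps)
    qed
    have eX: "exp (- (A * X)) \<le> e"
    proof (rule expX[OF _ e(1)])
      have "1 / e = A * (1 / \<delta>)" by (simp add: e_def)
      also have "\<dots> \<le> A * X" using \<delta>X A by (intro mult_left_mono) auto
      finally show "1 / e \<le> A * X" .
    qed
    have hX: "exp (- (a * (A * X))) \<le> h" unfolding h_def using a by (intro exp_neg_le_powr e eX) auto
    have \<eta>X: "exp (- (b * (A * X))) \<le> \<eta>" unfolding \<eta>_def using b by (intro exp_neg_le_powr e eX) auto
    have \<delta>X': "exp (- (1 * X)) \<le> \<delta>" using \<delta>X \<delta> by (intro expX) auto
    have NX: "real N \<le> n * X"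
    proof -
      \<comment> \<open>The origin of \<open>\<beta> = a + 1\<close>: \<open>h\<close> contributes
        \<open>\<delta> powr a\<close> and the density one more power of
        \<open>\<delta>\<close>.\<close>
      have hdX: "1 / (h * \<delta>) = A powr a * X"
        using \<delta> A by (simp add: h_def e_def X_def powr_divide powr_add)
      have "real N \<le> \<bar>S / (h * \<delta>)\<bar> + 2" unfolding N_def by linarith
      also have "\<bar>S / (h * \<delta>)\<bar> = \<bar>S\<bar> * (1 / (h * \<delta>))" using h \<delta> by (simp add: abs_mult abs_divide)
      also have "\<dots> = \<bar>S\<bar> * A powr a * X" by (simp only: hdX mult.assoc)
      also have "\<bar>S\<bar> * A powr a * X + 2 \<le> n * X" using X by (simp add: n_def algebra_simps)
      finally show ?thesis by simp
    qed
    have two: "2 ^ k \<le> exp (real k)" for k :: nat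
    proof -
      have "(2::real) \<le> exp 1" using exp_ge_add_one_self[of 1] by simp
      then have "(2::real) ^ k \<le> exp 1 ^ k" by (intro power_mono) auto
      then show ?thesis by (simp flip: exp_of_nat_mult)
    qed
    have pow2X: "exp (- (n * X)) \<le> 1 / 2 ^ N"
    proof -
      have "2 ^ N \<le> exp (n * X)" using two[of N] NX by (meson exp_le_cancel_iff order_trans)
      then show ?thesis by (simp add: exp_minus field_simps)
    qed
    have \<tau>X: "exp (- (T * X)) \<le> \<tau>"
    proof -
      have "exp (- (T * X)) \<le> exp (- (a * (A * X))) * exp (- (a * (A * X))) * exp (- (b * (A * X))) * (exp (- (n * X)) * exp (- 1))"
        unfolding exp_add[symmetric] exp_le_cancel_iff T_def using X by (simp add: algebra_simps)
      also have "\<dots> \<le> h * h * \<eta> * (1 / 2 ^ N * (1 / 2))"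
      proof (intro mult_mono hX \<eta>X pow2X)
        have "(2::real) \<le> exp 1" using exp_ge_add_one_self[of 1] by simp
        then show "exp (- 1) \<le> 1 / (2::real)" by (simp add: exp_minus field_simps)
      qed (use h \<eta> in auto)
      also have "\<dots> = \<tau>" by (simp add: \<tau>_def power2_eq_square)
      finally show ?thesis .
    qed
    define \<theta> where "\<theta> = H * h * \<delta> * (h * \<eta> / 2 ^ N) powr s / (G * 3 powr s)"
    have \<theta>X: "exp (- (t * X)) \<le> \<theta>"
    proof -
      have "exp (- (a * (A * X))) * exp (- (b * (A * X))) * exp (- (n * X)) \<le> h * \<eta> * (1 / 2 ^ N)"
        using h \<eta> by (intro mult_mono hX \<eta>X pow2X) auto
      then have "exp (- ((a * A + b * A + n) * X)) \<le> h * \<eta> / 2 ^ N"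
        by (simp add: exp_add[symmetric] algebra_simps)
      then have 1: "exp (- (s * ((a * A + b * A + n) * X))) \<le> (h * \<eta> / 2 ^ N) powr s"
        using h \<eta> s by (intro exp_neg_le_powr) auto
      have 2: "exp (- (h0 * X)) \<le> H / (G * 3 powr s)"
      proof (rule expX)
        have "1 / (H / (G * 3 powr s)) = h0 * 1" by (simp add: h0_def)
        also have "\<dots> \<le> h0 * X" using X h0 by (intro mult_left_mono) auto
        finally show "1 / (H / (G * 3 powr s)) \<le> h0 * X" .
      qed (use H G in simp)
      have "exp (- (t * X)) = exp (- (h0 * X)) * exp (- (a * (A * X))) * exp (- (1 * X)) * exp (- (s * ((a * A + b * A + n) * X)))"
        unfolding exp_add[symmetric] t_def by (simp add: algebra_simps)
      also have "\<dots> \<le> H / (G * 3 powr s) * h * \<delta> * (h * \<eta> / 2 ^ N) powr s"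
        using h \<eta> \<delta> H G by (intro mult_mono 1 2 hX \<delta>X') auto
      also have "\<dots> = \<theta>" by (simp add: \<theta>_def)
      finally show ?thesis .
    qed
    have "0 \<le> t * X" using t X by simp
    then have \<theta>min: "exp (- (t * X)) \<le> min 1 \<theta>" using \<theta>X by simp
    have "4 * m / min 1 \<theta> \<le> (8 / \<tau>) / exp (- (t * X))"
      using m3 \<theta>min \<tau> by (intro frac_le) auto
    also have "\<dots> \<le> (8 / exp (- (T * X))) / exp (- (t * X))"
      using \<tau>X \<tau> by (intro divide_right_mono divide_left_mono) auto
    also have "\<dots> = 8 * exp (T * X + t * X)" by (simp add: exp_minus exp_add field_simps)
    also have "\<dots> \<le> exp (8 * X) * exp (T * X + t * X)"
    proof (rule mult_right_mono)
      show "8 \<le> exp (8 * X)" using exp_ge_add_one_self[of "8 * X"] X by linarith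
    qed simp
    also have "\<dots> = exp ((8 + T + t) / \<delta> powr (a + 1))"
      by (simp add: X_def exp_add[symmetric] algebra_simps add_divide_distrib)
    finally have fin: "4 * m / min 1 \<theta> \<le> exp ((8 + T + t) / \<delta> powr (a + 1))" .
    show "\<exists>\<eta> h N m. 0 < \<eta> \<and> \<eta> \<le> 1 / 4 \<and> 0 < h \<and> h \<le> 1
      \<and> 4 ^ d * G * \<eta> powr (d - s) < \<delta> \<and> 5 / 2 * 4 ^ d * G * h powr (s + 1 - d) \<le> \<delta> / 4
      \<and> S < real N * (h * \<delta>) \<and> 1 / 2 ^ m \<le> h\<^sup>2 * \<eta> / 2 ^ Suc N
      \<and> 4 * m / min 1 (H * h * \<delta> * (h * \<eta> / 2 ^ N) powr s / (G * 3 powr s)) \<le> exp ((8 + T + t) / \<delta> powr (a + 1))"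
    proof (intro exI conjI)
      show "4 ^ d * G * \<eta> powr (d - s) < \<delta>" unfolding \<eta>e Ae using \<delta> by simp
      show "5 / 2 * 4 ^ d * G * h powr (s + 1 - d) \<le> \<delta> / 4" unfolding he using Ae by (simp add: mult_ac)
    qed (use \<eta> h N2 m2 fin in \<open>simp_all add: \<tau>_def \<theta>_def\<close>)
  qed
qed

section \<open>From the Riesz transform and the dense set to the abstract estimate\<close>

lemma growth_const_ge_1: "0 \<le> C \<Longrightarrow> 1 \<le> growth_const s C"
  by (simp add: growth_const_def)

lemma hole_factor_pos: "0 < s \<Longrightarrow> 0 < hole_factor s"
  using gap_const_pos[of "riesz_exponent s"] by (simp add: hole_factor_def riesz_exponent_def)

lemma AE_norm_riesz_transform_le:
  assumes "Linfty_norm (riesz_transform s \<mu>) \<le> 1"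
  shows "AE w in lborel. norm (\<integral>y. riesz_kernel s (y - w) \<partial>\<mu>) \<le> 1"
  using esssup_AE[where M=lborel and f="\<lambda>x. ereal (norm (riesz_transform s \<mu> x))"]
proof eventually_elim
  fix w assume "ereal (norm (riesz_transform s \<mu> w)) \<le> esssup lborel (\<lambda>x. ereal (norm (riesz_transform s \<mu> x)))"
  also have "\<dots> \<le> 1" using assms by (simp add: Linfty_norm_def)
  finally show "norm (\<integral>y. riesz_kernel s (y - w) \<partial>\<mu>) \<le> 1" by (simp add: riesz_transform_def riesz_kernel_def)
qed

text \<open>A point of the closure has a dense point within \<open>r / 2\<close>, whose ball of
  radius \<open>r / 2\<close> lies in \<open>ball x r\<close>. Passing to the closure thus doubles
  the range of radii and divides \<open>\<delta>\<close> by \<open>2 powr s\<close>.\<close>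

lemma closure_dense_set_mass:
  fixes \<mu> :: "(real ^ 'n) measure"
  assumes fin: "finite_measure \<mu>" and sets: "sets \<mu> = sets borel" and r0: "0 < r0" and s: "0 < s"
    and x: "x \<in> closure (dense_set s \<mu> q \<delta> x0 r0)" and r: "4 * (r0 / 2) / 2 ^ q \<le> r" "r \<le> r0 / 2"
  shows "\<delta> / 2 powr s * r powr s \<le> measure \<mu> (ball x r)"
proof -
  interpret finite_measure \<mu> by fact
  have "0 < 4 * (r0 / 2) / 2 ^ q" using r0 by simp
  then have "0 < r" using r by linarith
  then obtain e where e: "e \<in> dense_set s \<mu> q \<delta> x0 r0" "dist e x < r / 2"
    using x closure_approachable[of x] by (meson half_gt_zero)
  have "r / 2 \<in> {r0 / 2 ^ q .. r0 / 4}" using r by (simp add: mult.commute)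
  then have "\<delta> < measure \<mu> (ball e (r / 2)) / (r / 2) powr s" using e(1) by (simp add: dense_set_def)
  then have "\<delta> * (r / 2) powr s \<le> measure \<mu> (ball e (r / 2))"
    using \<open>0 < r\<close> by (simp add: pos_less_divide_eq less_imp_le)
  also have "\<dots> \<le> measure \<mu> (ball x r)"
  proof (rule finite_measure_mono)
    show "ball e (r / 2) \<subseteq> ball x r"
    proof
      fix y assume "y \<in> ball e (r / 2)"
      then show "y \<in> ball x r" using e(2) dist_triangle[of x y e] by (simp add: dist_commute)
    qed
  qed (simp add: sets)
  finally show ?thesis by (simp add: powr_divide)
qed

theorem proposition3p1:
  fixes s :: real
  assumes "CARD('n::finite) \<ge> 2"
    and "real CARD('n) - 1 < s" and "s < real CARD('n)"
  shows "\<exists>C16 > 0. \<exists>\<beta> > 0.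
    \<forall>(\<mu> :: (real ^ 'n) measure) (\<delta> :: real) (q :: nat) (x0 :: real ^ 'n) (r0 :: real).
      finite_measure \<mu> \<longrightarrow> sets \<mu> = sets borel \<longrightarrow>
      Linfty_norm (riesz_transform s \<mu>) \<le> 1 \<longrightarrow>
      0 < \<delta> \<longrightarrow> \<delta> < 1 \<longrightarrow> q \<ge> 1 \<longrightarrow> r0 > 0 \<longrightarrow>
      measure \<mu> (dense_set s \<mu> q \<delta> x0 r0)
        \<le> 1 / real q * exp (C16 / \<delta> powr \<beta>) * measure \<mu> (ball x0 r0)"
proof -
  define d where "d = CARD('n)"
  have dim: "DIM(real ^ 'n) = d" by (simp add: d_def)
  have s: "0 < s" "real d - 1 < s" "s < real d" using assms by (auto simp: d_def)
  have d: "1 \<le> d" using assms(1) by (simp add: d_def)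
  have sD: "s < real DIM(real ^ 'n)" using s dim by simp
  obtain C where C: "0 < C"
    and field: "\<And>(\<mu>::(real ^ 'n) measure) x z n. \<lbrakk>finite_measure \<mu>; sets \<mu> = sets borel;
        AE w in lborel. norm (\<integral>y. riesz_kernel s (y - w) \<partial>\<mu>) \<le> 1; 0 < z; norm n = 1\<rbrakk> \<Longrightarrow>
      \<bar>\<integral>y. (n \<bullet> (y - x)) * ((norm (y - x))\<^sup>2 + z\<^sup>2) powr (- ((1 + s) / 2)) \<partial>\<mu>\<bar> \<le> C"
    and normal: "\<And>(\<mu>::(real ^ 'n) measure) x z. \<lbrakk>finite_measure \<mu>; sets \<mu> = sets borel;
        AE w in lborel. norm (\<integral>y. riesz_kernel s (y - w) \<partial>\<mu>) \<le> 1; 0 < z\<rbrakk> \<Longrightarrow>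
      (\<integral>y. ((norm (y - x))\<^sup>2 + z\<^sup>2) powr (- ((1 + s) / 2)) \<partial>\<mu>) \<le> C / z"
    by (rule riesz_poisson_bounds[OF s(1) sD]) (erule that, assumption+)
  obtain K \<beta> where K: "0 < K" "0 < \<beta>" and params: "\<And>\<delta>. \<lbrakk>0 < \<delta>; \<delta> \<le> 1\<rbrakk> \<Longrightarrow> \<exists>\<eta> h N m. 0 < \<eta> \<and> \<eta> \<le> 1 / 4 \<and> 0 < h \<and> h \<le> 1
      \<and> 4 ^ d * growth_const s C * \<eta> powr (d - s) < \<delta> \<and> 5 / 2 * 4 ^ d * growth_const s C * h powr (s + 1 - d) \<le> \<delta> / 4
      \<and> scale_factor s C < real N * (h * \<delta>) \<and> 1 / 2 ^ m \<le> h\<^sup>2 * \<eta> / 2 ^ Suc N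
      \<and> 4 * m / min 1 (hole_factor s * h * \<delta> * (h * \<eta> / 2 ^ N) powr s / (growth_const s C * 3 powr s)) \<le> exp (K / \<delta> powr \<beta>)"
    by (rule hole_parameters_exist[OF d s growth_const_ge_1[OF less_imp_le[OF C]] hole_factor_pos[OF s(1)]]) (erule that, assumption+)
  \<comment> \<open>The factor \<open>(2 powr s) powr \<beta>\<close> absorbs the loss of density on
    the closure.\<close>
  have main: "measure \<mu> (dense_set s \<mu> q \<delta> x0 r0)
      \<le> 1 / real q * exp (K * (2 powr s) powr \<beta> / \<delta> powr \<beta>) * measure \<mu> (ball x0 r0)"
    if \<mu>: "finite_measure \<mu>" "sets \<mu> = sets borel" "Linfty_norm (riesz_transform s \<mu>) \<le> 1"
      and \<delta>: "0 < \<delta>" "\<delta> < 1" and q: "q \<ge> 1" and r0: "0 < r0"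
    for \<mu> :: "(real ^ 'n) measure" and \<delta> q x0 r0
  proof -
    let ?\<delta> = "\<delta> / 2 powr s" and ?E = "dense_set s \<mu> q \<delta> x0 r0"
    note bdd = AE_norm_riesz_transform_le[OF \<mu>(3)]
    have "1 \<le> 2 powr s" using s by (simp add: ge_one_powr_ge_zero)
    then have \<delta>': "0 < ?\<delta>" "?\<delta> \<le> 1" using \<delta> by auto
    obtain \<eta> h N m where p: "0 < \<eta>" "\<eta> \<le> 1 / 4" "0 < h" "h \<le> 1"
      "4 ^ d * growth_const s C * \<eta> powr (d - s) < ?\<delta>" "5 / 2 * 4 ^ d * growth_const s C * h powr (s + 1 - d) \<le> ?\<delta> / 4"
      "scale_factor s C < real N * (h * ?\<delta>)" "1 / 2 ^ m \<le> h\<^sup>2 * \<eta> / 2 ^ Suc N"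
      and bound: "4 * m / min 1 (hole_factor s * h * ?\<delta> * (h * \<eta> / 2 ^ N) powr s / (growth_const s C * 3 powr s)) \<le> exp (K / ?\<delta> powr \<beta>)"
      using params[OF \<delta>'] by blast
    interpret finite_measure \<mu> by fact
    interpret hole_parameters \<mu> s C ?\<delta> \<eta> h N m
      by unfold_locales (use \<mu> s C \<delta>' p field[OF \<mu>(1,2) bdd] normal[OF \<mu>(1,2) bdd] dim in auto)
    have "measure \<mu> ?E \<le> 1 / real q * (4 * m / min 1 \<theta>) * measure \<mu> (ball x0 r0)"
    \<comment> \<open>The dense set lies in the half ball, so its neighbourhood of radius
      \<open>r0 / 2\<close> stays in the full ball; the radii from \<open>4 * L / 2 ^ q\<close> to
      \<open>L\<close> are exactly the doubled range.\<close>
    proof (rule measure_dense_le[where L="r0 / 2"])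
      show "?\<delta> * r powr s \<le> measure \<mu> (ball x r)"
        if "x \<in> closure ?E" "4 * (r0 / 2) / 2 ^ q \<le> r" "r \<le> r0 / 2" for x r
        by (rule closure_dense_set_mass[OF \<mu>(1,2) r0 s(1) that])
      show "nbhd ?E (r0 / 2) \<subseteq> ball x0 r0"
      proof
        fix y assume "y \<in> nbhd ?E (r0 / 2)"
        then obtain e where "dist x0 e < r0 / 2" "dist e y < r0 / 2" by (auto simp: nbhd_def dense_set_def)
        then show "y \<in> ball x0 r0" using dist_triangle[of x0 y e] by simp
      qed
    qed (use r0 q in auto)
    also have "\<dots> \<le> 1 / real q * exp (K / ?\<delta> powr \<beta>) * measure \<mu> (ball x0 r0)"
      using bound unfolding \<theta>_def \<kappa>_def by (intro mult_right_mono mult_left_mono) auto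
    also have "K / ?\<delta> powr \<beta> = K * (2 powr s) powr \<beta> / \<delta> powr \<beta>" by (simp add: powr_divide)
    finally show ?thesis .
  qed
  show ?thesis
    by (rule exI[of _ "K * (2 powr s) powr \<beta>"], rule conjI, use K in simp, rule exI[of _ \<beta>]) (use K main in blast)
qed

end
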